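(* Let $X$ be a centered, nondegenerate, infinitely divisible real random variable with finite variance $V>0$ and Lévy measure $\nu$, with $\int_{|x|>1}|x|^5\,\nu(dx)<\infty$. Let $\kappa_3,\kappa_4,\kappa_5$ be the third, fourth and fifth cumulants of $X$ and put $$m_1=\mathbb{E}R=\frac{\kappa_3}{3V},\quad m_2=\mathbb{E}R^2=\frac{\kappa_4}{6V},\quad m_3=\mathbb{E}R^3=\frac{\kappa_5}{10V},\quad \kappa=m_1^2-\frac{m_2}{2}=\frac{\kappa_3^2}{9V^2}-\frac{\kappa_4}{12V},$$ $$\gamma=m_1m_2-m_1^3-\frac{m_3}{6}=\frac{\kappa_3\kappa_4}{18V^2}-\frac{\kappa_3^3}{27V^3}-\frac{\kappa_5}{60V}.$$ Assume $\tau>0$, $m_1>0$, that $\Psi_1(t)<m_1$ for every $t>0$, and that $m_1>1/\tau$ when $\tau<\infty$. Assume further that $\kappa=0$ and $\gamma>0$. Then, with $\varepsilon=\theta-1\downarrow0$, $$c_*(\theta V)=m_1-3\Bigl(\frac{\gamma\varepsilon^2}{4}\Bigr)^{1/3}+o\bigl(\varepsilon^{2/3}\bigr),$$ and any maximiser $\hat t_\theta$ of $\Psi_\theta$ over $(0,\infty)$ satisfies $\hat t_\theta=\bigl(\varepsilon/(2\gamma)\bigr)^{1/3}(1+o(1))$ as $\varepsilon\downarrow0$. In particular $c_*$ has one-sided derivative $-\infty$ at $v=V$, i.e. $\lim_{v\downarrow V}\frac{c_*(v)-c_*(V)}{v-V}=-\infty$.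
   Context: Standing setting: $X$ is a centered, nondegenerate, infinitely divisible real random variable with variance $0<V=\mathrm{Var}(X)<\infty$, Gaussian variance $a\ge0$ and Lévy measure $\nu$ on $\mathbb{R}\setminus\{0\}$. For all real $t$, $K_X(t)=\log\mathbb{E}e^{tX}=\frac{at^2}{2}+\int_{\mathbb{R}\setminus\{0\}}(e^{tx}-1-tx)\,\nu(dx)\in[0,\infty]$, and $V=a+\int x^2\,\nu(dx)$. $\tau=\sup\{t>0:K_X(t)<\infty\}\in[0,\infty]$ (with $\sup\emptyset=0$). Let $H_X(dx)=a\delta_0(dx)+x^2\nu(dx)$ (total mass $V$), let $Z$ have law $H_X/V$, let $B\sim\mathrm{Beta}(1,2)$ (density $2(1-b)$ on $(0,1)$) be independent of $Z$, and put $R=BZ$, $M_R(t)=\mathbb{E}e^{tR}\in(0,\infty]$. For $\theta>0$ and $t>0$, $\Psi_\theta(t)=\frac1t\bigl(1-\frac{\theta}{M_R(t)}\bigr)$. Conventions: $1/0=\infty$, $1/\infty=0$, $\theta/\infty=0$. A pair $(v,c)\in(0,\infty)\times[0,\infty)$ is feasible for $X$ if $K_X(t)\le \frac{vt^2}{2(1-ct)}$ for every $0\le t<1/c$ (for $c=0$: for all $t\ge0$). $c_*(v)=\inf\{c\ge0:(v,c)\text{ is feasible}\}\in[0,\infty]$, with $\inf\emptyset=\infty$. *)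

theory Defs
  imports "HOL-Probability.Probability" "HOL-Library.Landau_Symbols"
begin

text \<open>Every \<open>n\<close>-th convolution root is required to exist, \<open>n \<ge> 1\<close>; the point mass at \<open>0\<close> is the
  neutral element of convolution.\<close>

definition infinitely_divisible :: "real measure \<Rightarrow> bool" where
  "infinitely_divisible \<mu> \<longleftrightarrow>
     (\<forall>n\<ge>1. \<exists>\<rho>. real_distribution \<rho> \<and> ((convolution \<rho>) ^^ n) (return borel 0) = \<mu>)"

text \<open>A measure on the line without the origin is encoded as a Borel measure on the whole line that
  does not charge the origin.\<close>

definition levy_measure :: "real measure \<Rightarrow> bool" where
  "levy_measure \<nu> \<longleftrightarrow> sets \<nu> = sets borel \<and> emeasure \<nu> {0} = 0 \<and>
     (\<integral>\<^sup>+x. ennreal (min 1 (x\<^sup>2)) \<partial>\<nu>) < \<infinity>"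

text \<open>The Levy-Khintchine representation of the characteristic function, with drift \<open>b\<close> relative to
  the truncation function \<open>x 1{|x| \<le> 1}\<close>, Gaussian variance \<open>a\<close> and Levy measure \<open>\<nu>\<close>.\<close>

definition has_levy_triplet :: "real measure \<Rightarrow> real \<Rightarrow> real \<Rightarrow> real measure \<Rightarrow> bool" where
  "has_levy_triplet \<mu> b a \<nu> \<longleftrightarrow> 0 \<le> a \<and> levy_measure \<nu> \<and>
     (\<forall>u. char \<mu> u = exp (\<i> * of_real (b * u) - of_real (a * u\<^sup>2 / 2)
        + (CLINT x|\<nu>. iexp (u * x) - 1 - (if \<bar>x\<bar> \<le> 1 then \<i> * of_real (u * x) else 0))))"

text \<open>The \<open>n\<close>-th cumulant is \<open>i\<close> to the power \<open>-n\<close> times the \<open>n\<close>-th derivative at \<open>0\<close> of the logarithm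
  of the characteristic function. The principal logarithm may be used because the characteristic
  function is close to \<open>1\<close> near \<open>0\<close>.\<close>

definition cumulant :: "'a measure \<Rightarrow> ('a \<Rightarrow> real) \<Rightarrow> nat \<Rightarrow> real" where
  "cumulant M X n = Re ((-\<i>) ^ n *
     ((\<lambda>f u. vector_derivative f (at u)) ^^ n) (\<lambda>u::real. Ln (char (distr M borel X) u)) 0)"

definition mgf :: "'a measure \<Rightarrow> ('a \<Rightarrow> real) \<Rightarrow> real \<Rightarrow> ennreal" where
  "mgf M X t = (\<integral>\<^sup>+\<omega>. ennreal (exp (t * X \<omega>)) \<partial>M)"

definition cgf :: "'a measure \<Rightarrow> ('a \<Rightarrow> real) \<Rightarrow> real \<Rightarrow> ereal" where
  "cgf M X t = (if mgf M X t = \<infinity> then \<infinity> else ereal (ln (enn2real (mgf M X t))))"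

text \<open>Inserting \<open>0\<close> implements the convention that the supremum of the empty set is \<open>0\<close>.\<close>

definition tau :: "'a measure \<Rightarrow> ('a \<Rightarrow> real) \<Rightarrow> ereal" where
  "tau M X = Sup (insert 0 {ereal t | t. 0 < t \<and> cgf M X t < \<infinity>})"

definition H_meas :: "real \<Rightarrow> real measure \<Rightarrow> real measure" where
  "H_meas a \<nu> = measure_of UNIV (sets borel)
     (\<lambda>A. ennreal a * indicator A 0 + (\<integral>\<^sup>+x\<in>A. ennreal (x\<^sup>2) \<partial>\<nu>))"

lemma space_H_meas [simp]: "space (H_meas a \<nu>) = UNIV"
  unfolding H_meas_def using sets.space_closed[of borel] by (subst space_measure_of) auto

lemma sets_H_meas [simp, measurable_cong]: "sets (H_meas a \<nu>) = sets borel"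
  unfolding H_meas_def
  using sets.sigma_sets_eq[of borel] sets.space_closed[of borel] by (subst sets_measure_of) auto

lemma emeasure_H_meas:
  assumes "sets \<nu> = sets borel" "A \<in> sets borel"
  shows "emeasure (H_meas a \<nu>) A = ennreal a * indicator A 0 + (\<integral>\<^sup>+x\<in>A. ennreal (x\<^sup>2) \<partial>\<nu>)"
proof (rule emeasure_measure_of[OF H_meas_def])
  note [measurable_cong] = assms(1)
  let ?D = "density \<nu> (\<lambda>x. ennreal (x\<^sup>2))" and ?S = "scale_measure (ennreal a) (return borel (0::real))"
  have S: "emeasure ?S B = ennreal a * indicator B 0" if "B \<in> sets borel" for B
    using that by simp
  have D: "emeasure ?D B = (\<integral>\<^sup>+x\<in>B. ennreal (x\<^sup>2) \<partial>\<nu>)" if "B \<in> sets borel" for B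
    using that assms(1) by (subst emeasure_density) auto
  show "countably_additive (sets (H_meas a \<nu>))
      (\<lambda>A. ennreal a * indicator A 0 + (\<integral>\<^sup>+x\<in>A. ennreal (x\<^sup>2) \<partial>\<nu>))"
  proof (rule countably_additiveI, unfold sets_H_meas)
    fix F :: "nat \<Rightarrow> real set"
    assume F: "range F \<subseteq> sets borel" "disjoint_family F" "\<Union> (range F) \<in> sets borel"
    then have Fi: "F i \<in> sets borel" for i by auto
    have "(\<Sum>i. ennreal a * indicator (F i) 0 + (\<integral>\<^sup>+x\<in>F i. ennreal (x\<^sup>2) \<partial>\<nu>))
        = (\<Sum>i. emeasure ?S (F i) + emeasure ?D (F i))"
      by (simp only: S[OF Fi] D[OF Fi])
    also have "\<dots> = (\<Sum>i. emeasure ?S (F i)) + (\<Sum>i. emeasure ?D (F i))"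
      by (rule suminf_add[symmetric]) auto
    also have "\<dots> = emeasure ?S (\<Union> (range F)) + emeasure ?D (\<Union> (range F))"
      using F assms(1) by (subst (1 2) suminf_emeasure) auto
    finally show "(\<Sum>i. ennreal a * indicator (F i) 0 + (\<integral>\<^sup>+x\<in>F i. ennreal (x\<^sup>2) \<partial>\<nu>))
        = ennreal a * indicator (\<Union> (range F)) 0 + (\<integral>\<^sup>+x\<in>\<Union> (range F). ennreal (x\<^sup>2) \<partial>\<nu>)"
      by (simp only: S[OF F(3)] D[OF F(3)])
  qed
qed (use assms in \<open>auto simp: positive_def\<close>)

text \<open>\<open>B\<close> has the density of \<open>Beta(1,2)\<close>, \<open>Z\<close> has the law \<open>H/V\<close>, and they are independent, on some
  auxiliary probability space \<open>N\<close>.\<close>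

definition beta_size_bias ::
    "'b measure \<Rightarrow> ('b \<Rightarrow> real) \<Rightarrow> ('b \<Rightarrow> real) \<Rightarrow> real \<Rightarrow> real measure \<Rightarrow> real \<Rightarrow> bool" where
  "beta_size_bias N B Z a \<nu> V \<longleftrightarrow> prob_space N \<and>
     distributed N lborel B (\<lambda>b. ennreal (2 * (1 - b)) * indicator {0<..<1} b) \<and>
     Z \<in> borel_measurable N \<and> distr N borel Z = scale_measure (ennreal (1 / V)) (H_meas a \<nu>) \<and>
     prob_space.indep_var N borel B borel Z"

text \<open>Division in \<open>ennreal\<close> gives \<open>\<theta>/\<infinity> = 0\<close>, so the value is \<open>1/t\<close> where the moment generating
  function of \<open>R\<close> is infinite.\<close>

definition Psi :: "'b measure \<Rightarrow> ('b \<Rightarrow> real) \<Rightarrow> real \<Rightarrow> real \<Rightarrow> real" where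
  "Psi N R \<theta> t = (1 - enn2real (ennreal \<theta> / mgf N R t)) / t"

definition feasible :: "'a measure \<Rightarrow> ('a \<Rightarrow> real) \<Rightarrow> real \<Rightarrow> real \<Rightarrow> bool" where
  "feasible M X v c \<longleftrightarrow> 0 < v \<and> 0 \<le> c \<and>
     (\<forall>t\<ge>0. c = 0 \<or> t < 1 / c \<longrightarrow> cgf M X t \<le> ereal (v * t\<^sup>2 / (2 * (1 - c * t))))"

text \<open>The infimum is taken in \<open>ereal\<close>, where the infimum of the empty set is \<open>\<infinity>\<close>.\<close>

definition c_star :: "'a measure \<Rightarrow> ('a \<Rightarrow> real) \<Rightarrow> real \<Rightarrow> ereal" where
  "c_star M X v = Inf {ereal c | c. feasible M X v c}"

end

theory Submission
  imports Defs
begin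

text \<open>
  Why the theorem is true. Let \<open>P\<close> be the law of \<open>Z\<close> and \<open>E(t)\<close> the moment generating function of
  \<open>R = B Z\<close>. Averaging an exponential over the \<open>Beta(1,2)\<close> density gives twice the quotient
  \<open>(e^y - 1 - y)/y^2\<close>, so the Levy-Khintchine formula becomes \<open>K(t) = (V t^2/2) E(t)\<close>. Given this,
  clearing denominators shows that \<open>(\<theta> V, c)\<close> is feasible exactly when \<open>c\<close> dominates \<open>Psi\<close> at level
  \<open>\<theta>\<close> on the positive half-line (\<open>feasible_iff_Psi_le\<close>). For \<open>\<theta>\<close> close to \<open>1\<close>, \<open>c_star\<close> at
  \<open>\<theta> V\<close> is therefore the supremum of \<open>Psi\<close>, which is positive there.

  By the moments of \<open>R\<close> up to order three and \<open>\<kappa> = 0\<close>, the function \<open>Psi\<close> at level \<open>1\<close> is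
  \<open>m\<^sub>1 - \<gamma> t^2 + o(t^2)\<close> at \<open>0\<close> (\<open>psi_expansion\<close>); passing from level \<open>1\<close> to \<open>1 + \<epsilon>\<close> subtracts
  \<open>\<epsilon>/(t E(t))\<close>, which is close to \<open>\<epsilon>/t\<close>. The function \<open>\<gamma> t^2 + \<epsilon>/t\<close> is minimal at
  \<open>(\<epsilon>/(2 \<gamma>))^(1/3)\<close> with value \<open>3 (\<gamma> \<epsilon>^2/4)^(1/3)\<close>, and it is quantitatively larger elsewhere;
  this yields both the value and the location of the maximum (\<open>perturbed_maximum\<close>). The maximum
  cannot come from large \<open>t\<close>, because \<open>Psi \<le> 1/t\<close> and because \<open>Psi\<close> at level \<open>1\<close> is continuous and
  below \<open>m\<^sub>1\<close> on compact intervals inside the domain of finiteness. Since \<open>\<epsilon>^(2/3)\<close> dominates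
  \<open>\<epsilon>\<close>, the slope of \<open>c_star\<close> at \<open>V\<close> is \<open>-\<infinity>\<close>.

  The identity for \<open>K\<close> has to be extracted from the characteristic function, including the claim
  that both sides are infinite together (\<open>exp_moment_eq_lk\<close>). For \<open>\<le>\<close>, the law of \<open>X\<close> is a weak limit
  of explicit convolution powers whose exponential moments are bounded by the right-hand side
  (\<open>exp_moment_le_lk\<close>). For \<open>\<ge>\<close>, the \<open>n\<close>-th convolution roots \<open>\<rho>\<close> of the law of \<open>X\<close> satisfy
  \<open>n \<rho>(dx) \<approx> V x^(-2) P(dx)\<close> after weighting by \<open>1 - cos (h x)\<close>, which follows from second differences of
  the characteristic functions and Levy's continuity theorem (\<open>lk_le_exp_moment\<close>). Both halves are
  completed by Fatou's lemma.

  The identification of the moments of \<open>R\<close> with cumulants rests on the fact that the second derivative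
  of the logarithm of the characteristic function of \<open>X\<close> is \<open>-V\<close> times the characteristic function
  of \<open>Z\<close> (\<open>cumulant_eq_moment\<close>).
\<close>

section \<open>The second-order Taylor quotient of the exponential\<close>

text \<open>The entire function \<open>(e^y - 1 - y)/y^2\<close>. Its power series supplies the value \<open>1/2\<close> at \<open>0\<close> together
  with continuity, so that atoms of a measure at the origin (the Gaussian part) are treated like all
  other points.\<close>

definition exp_rem :: "'a :: {real_normed_field, banach} \<Rightarrow> 'a" where
  "exp_rem y = (\<Sum>n. inverse (fact (n + 2)) * y ^ n)"

lemma exp_rem_term_le:
  "norm (inverse (fact (n + 2)) * (y :: 'a :: {real_normed_field, banach}) ^ n) \<le> norm (y ^ n /\<^sub>R fact n)"
proof -
  have "inverse (fact (n + 2)) \<le> (inverse (fact n) :: real)"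
    by (intro le_imp_inverse_le fact_mono) auto
  then show ?thesis
    by (simp add: norm_mult norm_inverse norm_power mult_right_mono del: fact_Suc add_2_eq_Suc')
qed

lemma summable_exp_rem: "summable (\<lambda>n. inverse (fact (n + 2)) * (y :: 'a :: {real_normed_field, banach}) ^ n)"
  by (rule summable_comparison_test'[where N = 0, OF summable_norm_exp[of y] exp_rem_term_le])

lemma exp_rem_0 [simp]: "exp_rem 0 = 1 / 2"
  unfolding exp_rem_def by (subst powser_zero) (simp add: numeral_2_eq_2)

lemma isCont_exp_rem [simp]: "isCont exp_rem y"
  unfolding exp_rem_def by (rule isCont_powser_converges_everywhere[OF summable_exp_rem])

lemma continuous_exp_rem [continuous_intros]:
  "continuous F f \<Longrightarrow> continuous F (\<lambda>x. exp_rem (f x))"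
  unfolding continuous_def by (rule isCont_tendsto_compose[OF isCont_exp_rem])

lemma tendsto_exp_rem [tendsto_intros]: "(f \<longlongrightarrow> l) F \<Longrightarrow> ((\<lambda>x. exp_rem (f x)) \<longlongrightarrow> exp_rem l) F"
  by (rule isCont_tendsto_compose[OF isCont_exp_rem])

lemma borel_measurable_exp_rem [measurable]: "exp_rem \<in> borel_measurable borel"
  by (intro borel_measurable_continuous_onI continuous_at_imp_continuous_on) auto

lemma square_exp_rem: "y\<^sup>2 * exp_rem y = exp y - 1 - y"
proof -
  have "exp y = 1 + y + (\<Sum>n. inverse (fact (n + 2)) *\<^sub>R (y ^ (n + 2)))"
    by (rule exp_first_two_terms)
  also have "(\<lambda>n. inverse (fact (n + 2)) *\<^sub>R (y ^ (n + 2))) = (\<lambda>n. y\<^sup>2 * (inverse (fact (n + 2)) * y ^ n))"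
    by (auto simp: scaleR_conv_of_real power_add power2_eq_square algebra_simps)
  also have "(\<Sum>n. y\<^sup>2 * (inverse (fact (n + 2)) * y ^ n)) = y\<^sup>2 * exp_rem y"
    unfolding exp_rem_def by (rule suminf_mult[OF summable_exp_rem])
  finally show ?thesis by simp
qed

lemma exp_rem_eq: "y \<noteq> 0 \<Longrightarrow> exp_rem y = (exp y - 1 - y) / y\<^sup>2"
  by (simp add: square_exp_rem[symmetric])

lemma exp_rem_nonneg: "0 \<le> exp_rem (y :: real)"
  by (cases "y = 0") (auto simp: exp_rem_eq exp_ge_add_one_self algebra_simps)

lemma exp_rem_le: "exp_rem (y :: real) \<le> exp \<bar>y\<bar>"
proof -
  have "norm (exp_rem y) \<le> (\<Sum>n. norm (y ^ n /\<^sub>R fact n))"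
    unfolding exp_rem_def
    by (rule norm_suminf_le[OF exp_rem_term_le summable_norm_exp])
  also have "\<dots> = exp \<bar>y\<bar>"
    by (simp add: exp_def abs_mult power_abs)
  finally show ?thesis by simp
qed

lemma norm_exp_rem_iexp: "norm (exp_rem (\<i> * complex_of_real y)) \<le> 1 / 2"
proof (cases "y = 0")
  case False
  have "cmod (iexp y - 1 - \<i> * y) \<le> y\<^sup>2 / 2"
    using iexp_approx1[of y 1] by (simp add: numeral_2_eq_2 algebra_simps)
  with False show ?thesis
    by (simp add: exp_rem_eq norm_divide norm_power divide_simps norm_mult)
qed simp

text \<open>The kernel \<open>(1 - cos y)/y^2\<close>, which arises below from second
  differences of characteristic functions.\<close>

abbreviation cos_rem :: "real \<Rightarrow> real" where
  "cos_rem y \<equiv> Re (exp_rem (\<i> * complex_of_real y))"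

text \<open>The compensated kernel \<open>(e^(i u z) - 1 - i u z)/z^2\<close>, extended to \<open>z = 0\<close> by the Gaussian value \<open>-u^2/2\<close>.\<close>

abbreviation lk_kernel :: "real \<Rightarrow> real \<Rightarrow> complex" where
  "lk_kernel u z \<equiv> (\<i> * complex_of_real u)\<^sup>2 * exp_rem (\<i> * complex_of_real (u * z))"

lemma Re_exp_rem_iexp: "y\<^sup>2 * cos_rem y = 1 - cos y"
  using arg_cong[OF square_exp_rem[of "\<i> * complex_of_real y"], of Re]
  by (simp add: power_mult_distrib Re_exp flip: of_real_power)

lemma Re_exp_rem_iexp_nonneg: "0 \<le> cos_rem y"
proof (cases "y = 0")
  case False
  then have "cos_rem y = (1 - cos y) / y\<^sup>2"
    by (simp add: Re_exp_rem_iexp[symmetric])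
  then show ?thesis by simp
qed simp

text \<open>The integral form of the Taylor remainder; this identity is what makes the \<open>Beta(1,2)\<close> law appear.\<close>

lemma nn_integral_beta_exp:
  "(\<integral>\<^sup>+b. ennreal (exp (b * y)) * (ennreal (2 * (1 - b)) * indicator {0<..<1} b) \<partial>lborel) = ennreal (2 * exp_rem (y :: real))"
proof (cases "y = 0")
  case True
  have "(\<integral>\<^sup>+b. ennreal (2 * (1 - b)) * indicator {0..1} b \<partial>lborel) = ennreal ((2 * 1 - 1\<^sup>2) - (2 * 0 - 0\<^sup>2 :: real))"
    by (rule nn_integral_FTC_Icc) (auto intro!: derivative_eq_intros)
  moreover have "(\<integral>\<^sup>+b. ennreal (2 * (1 - b)) * indicator {0..1} b \<partial>lborel)
     = (\<integral>\<^sup>+b. ennreal (exp (b * y)) * (ennreal (2 * (1 - b)) * indicator {0<..<1} b) \<partial>lborel)"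
    using AE_lborel_singleton[of 0] AE_lborel_singleton[of 1]
    by (intro nn_integral_cong_AE, eventually_elim) (auto simp: True indicator_def)
  ultimately show ?thesis by (simp add: True)
next
  case False
  define F where "F b = 2 * ((1 - b) * exp (b * y) / y + exp (b * y) / y\<^sup>2)" for b
  have "(\<integral>\<^sup>+b. ennreal (2 * (1 - b) * exp (b * y)) * indicator {0..1} b \<partial>lborel) = ennreal (F 1 - F 0)"
    using False unfolding F_def
    by (intro nn_integral_FTC_Icc) (auto intro!: derivative_eq_intros simp: field_simps power2_eq_square)
  moreover have "(\<integral>\<^sup>+b. ennreal (2 * (1 - b) * exp (b * y)) * indicator {0..1} b \<partial>lborel)
     = (\<integral>\<^sup>+b. ennreal (exp (b * y)) * (ennreal (2 * (1 - b)) * indicator {0<..<1} b) \<partial>lborel)"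
    using AE_lborel_singleton[of 0] AE_lborel_singleton[of 1]
    by (intro nn_integral_cong_AE, eventually_elim) (auto simp: indicator_def ennreal_mult' mult.commute)
  moreover have "F 1 - F 0 = 2 * exp_rem y"
    using False by (simp add: F_def exp_rem_eq field_simps power2_eq_square)
  ultimately show ?thesis by simp
qed

section \<open>Convolution powers\<close>

abbreviation conv_pow :: "real measure \<Rightarrow> nat \<Rightarrow> real measure" where
  "conv_pow \<rho> n \<equiv> ((convolution \<rho>) ^^ n) (return borel 0)"

abbreviation exp_moment :: "real measure \<Rightarrow> real \<Rightarrow> ennreal" where
  "exp_moment \<mu> t \<equiv> \<integral>\<^sup>+x. ennreal (exp (t * x)) \<partial>\<mu>"

lemma real_distribution_convolution:
  assumes "real_distribution \<rho>" "real_distribution \<sigma>"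
  shows "real_distribution (convolution \<rho> \<sigma>)"
proof -
  interpret \<rho>: real_distribution \<rho> by fact
  interpret \<sigma>: real_distribution \<sigma> by fact
  interpret P: pair_prob_space \<rho> \<sigma> ..
  have "prob_space (convolution \<rho> \<sigma>)"
    unfolding convolution_def by (intro P.prob_space_distr) simp
  then show ?thesis
    by (simp add: real_distribution_def real_distribution_axioms_def)
qed

lemma char_convolution:
  assumes "real_distribution \<rho>" "real_distribution \<sigma>"
  shows "char (convolution \<rho> \<sigma>) u = char \<rho> u * char \<sigma> u"
proof -
  interpret \<rho>: real_distribution \<rho> by fact
  interpret \<sigma>: real_distribution \<sigma> by fact
  interpret P: pair_prob_space \<rho> \<sigma> ..
  have "char (convolution \<rho> \<sigma>) u = (CLINT z|\<rho> \<Otimes>\<^sub>M \<sigma>. iexp (u * (case z of (x, y) \<Rightarrow> x + y)))"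
    unfolding char_def convolution_def by (rule integral_distr) auto
  also have "\<dots> = (CLINT x|\<rho>. CLINT y|\<sigma>. iexp (u * (x + y)))"
    by (subst P.integral_fst'[symmetric]) (auto intro!: P.integrable_const_bound[where B = 1])
  also have "\<dots> = (CLINT x|\<rho>. CLINT y|\<sigma>. iexp (u * x) * iexp (u * y))"
    by (simp add: algebra_simps exp_add)
  also have "\<dots> = char \<rho> u * char \<sigma> u"
    by (simp add: char_def)
  finally show ?thesis .
qed

lemma real_distribution_return: "real_distribution (return borel x)"
  by (auto simp: real_distribution_def real_distribution_axioms_def intro: prob_space_return)

lemma real_distribution_conv_pow: "real_distribution \<rho> \<Longrightarrow> real_distribution (conv_pow \<rho> n)"
  by (induction n) (auto intro: real_distribution_return real_distribution_convolution)

lemma char_conv_pow: "real_distribution \<rho> \<Longrightarrow> char (conv_pow \<rho> n) u = char \<rho> u ^ n"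
proof (induction n)
  case 0
  show ?case by (simp add: char_def integral_return)
next
  case (Suc n)
  then show ?case by (simp add: char_convolution real_distribution_conv_pow)
qed

lemma exp_moment_conv_pow:
  assumes \<rho>: "real_distribution \<rho>"
  shows "exp_moment (conv_pow \<rho> n) t = exp_moment \<rho> t ^ n"
proof (induction n)
  case 0
  show ?case by (simp add: nn_integral_return)
next
  case (Suc n)
  interpret \<rho>: real_distribution \<rho> by fact
  interpret \<sigma>: real_distribution "conv_pow \<rho> n" by (rule real_distribution_conv_pow[OF \<rho>])
  have "exp_moment (conv_pow \<rho> (Suc n)) t
      = (\<integral>\<^sup>+x. \<integral>\<^sup>+y. ennreal (exp (t * x)) * ennreal (exp (t * y)) \<partial>conv_pow \<rho> n \<partial>\<rho>)"
    by (simp add: nn_integral_convolution \<rho>.finite_measure_axioms \<sigma>.finite_measure_axioms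
        distrib_left exp_add ennreal_mult)
  also have "\<dots> = exp_moment \<rho> t * exp_moment (conv_pow \<rho> n) t"
    by (simp add: nn_integral_cmult nn_integral_multc)
  finally show ?case by (simp add: Suc)
qed

section \<open>Exponential moments under weak convergence\<close>

text \<open>The form of Fatou's lemma by which truncations and approximations are removed.\<close>

lemma nn_integral_le_of_tendsto:
  fixes f :: "'a \<Rightarrow> ennreal"
  assumes "\<And>i :: nat. u i \<in> borel_measurable M" and "\<And>x. (\<lambda>i. u i x) \<longlonglongrightarrow> f x"
    and "\<And>i. (\<integral>\<^sup>+x. u i x \<partial>M) \<le> C i" and "C \<longlonglongrightarrow> c"
  shows "(\<integral>\<^sup>+x. f x \<partial>M) \<le> c"
proof -
  have "(\<integral>\<^sup>+x. f x \<partial>M) = (\<integral>\<^sup>+x. liminf (\<lambda>i. u i x) \<partial>M)"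
    by (intro nn_integral_cong) (simp add: lim_imp_Liminf[OF _ assms(2)])
  also have "\<dots> \<le> liminf (\<lambda>i. \<integral>\<^sup>+x. u i x \<partial>M)"
    by (rule nn_integral_liminf) (rule assms(1))
  also have "\<dots> \<le> liminf C"
    by (intro Liminf_mono always_eventually allI assms(3))
  also have "\<dots> = c"
    using assms(4) by (intro lim_imp_Liminf) auto
  finally show ?thesis .
qed

lemma tendsto_min_real_of_nat: "(\<lambda>k. min (y::real) (real k)) \<longlonglongrightarrow> y"
proof (rule tendsto_eventually)
  have "eventually (\<lambda>k. y \<le> real k) sequentially"
    using filterlim_real_sequentially by (auto simp: filterlim_at_top)
  then show "\<forall>\<^sub>F k in sequentially. min y (real k) = y"
    by eventually_elim simp
qed

text \<open>Exponential moments are lower semicontinuous under weak convergence: \<open>e^(t x)\<close> cut off at height \<open>k\<close>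
  is a bounded continuous test function, and \<open>k\<close> tends to infinity by Fatou's lemma.\<close>

lemma exp_moment_le_of_char_tendsto:
  assumes S: "\<And>n. real_distribution (S n)" and \<mu>: "real_distribution \<mu>"
    and char: "\<And>u. (\<lambda>n. char (S n) u) \<longlonglongrightarrow> char \<mu> u"
    and le: "\<And>n. exp_moment (S n) t \<le> ennreal (C n)"
    and C: "C \<longlonglongrightarrow> c" and nn: "\<And>n. 0 \<le> C n"
  shows "exp_moment \<mu> t \<le> ennreal c"
proof (rule nn_integral_le_of_tendsto[where C = "\<lambda>_. ennreal c"
      and u = "\<lambda>k x. ennreal (min (exp (t * x)) (real k))"])
  interpret \<mu>: real_distribution \<mu> by fact
  fix k :: nat
  let ?f = "\<lambda>x. min (exp (t * x)) (real k)"
  show "(\<lambda>x. ennreal (?f x)) \<in> borel_measurable \<mu>"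
    by measurable
  have wc: "weak_conv_m S \<mu>"
    by (rule levy_continuity[OF S \<mu> char])
  have lim: "(\<lambda>n. \<integral>x. ?f x \<partial>S n) \<longlonglongrightarrow> (\<integral>x. ?f x \<partial>\<mu>)"
    by (rule weak_conv_imp_integral_bdd_continuous_conv[OF S \<mu> wc, where B = "real k"])
      (auto intro!: continuous_intros)
  have "(\<integral>x. ?f x \<partial>S n) \<le> C n" for n
  proof -
    interpret S: real_distribution "S n" by (rule S)
    have "ennreal (\<integral>x. ?f x \<partial>S n) = (\<integral>\<^sup>+x. ennreal (?f x) \<partial>S n)"
      by (rule nn_integral_eq_integral[symmetric]) (auto intro!: S.integrable_const_bound[where B = "real k"])
    also have "\<dots> \<le> exp_moment (S n) t"
      by (intro nn_integral_mono ennreal_leI) auto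
    also note le[of n]
    finally show ?thesis
      using nn[of n] by (simp add: ennreal_le_iff)
  qed
  then have "(\<integral>x. ?f x \<partial>\<mu>) \<le> c"
    by (intro LIMSEQ_le[OF lim C]) auto
  moreover have "(\<integral>\<^sup>+x. ennreal (?f x) \<partial>\<mu>) = ennreal (\<integral>x. ?f x \<partial>\<mu>)"
    by (rule nn_integral_eq_integral) (auto intro!: \<mu>.integrable_const_bound[where B = "real k"])
  ultimately show "(\<integral>\<^sup>+x. ennreal (?f x) \<partial>\<mu>) \<le> ennreal c"
    by (simp add: ennreal_leI)
next
  fix x
  show "(\<lambda>k. ennreal (min (exp (t * x)) (real k))) \<longlonglongrightarrow> ennreal (exp (t * x))"
    using tendsto_ennrealI[OF tendsto_min_real_of_nat[of "exp (t * x)"]] .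
next
  show "(\<lambda>_ :: nat. ennreal c) \<longlonglongrightarrow> ennreal c"
    by simp
qed

section \<open>Upper bound for exponential moments\<close>

text \<open>A uniform variable provides the randomisation in the construction of the approximating
  distributions: the event that it is below \<open>w\<close> has probability \<open>w\<close>.\<close>

abbreviation uniform01 :: "real measure" where
  "uniform01 \<equiv> uniform_measure lborel {0..1}"

lemma prob_space_uniform01: "prob_space uniform01"
  by (rule prob_space_uniform_measure) auto

lemma integral_uniform01_if:
  fixes A C :: "'a :: {banach, second_countable_topology}"
  assumes "0 \<le> w" "w \<le> 1"
  shows "(\<integral>x. (if x < w then A else C) \<partial>uniform01) = w *\<^sub>R A + (1 - w) *\<^sub>R C"
proof -
  interpret U: prob_space uniform01 by (rule prob_space_uniform01)
  have "{0..1} \<inter> {..<w} = {0..<w}" using assms by auto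
  then have w: "measure uniform01 {..<w} = w"
    using assms by (simp add: measure_uniform_measure)
  have "(\<integral>x. (if x < w then A else C) \<partial>uniform01) = (\<integral>x. C + indicator {..<w} x *\<^sub>R (A - C) \<partial>uniform01)"
    by (intro Bochner_Integration.integral_cong) (auto simp: indicator_def)
  also have "\<dots> = C + w *\<^sub>R (A - C)"
  proof -
    have "integrable uniform01 (indicator {..<w} :: real \<Rightarrow> real)"
      by (intro U.integrable_const_bound[where B = 1]) auto
    then show ?thesis
      using U.prob_space by (simp add: w)
  qed
  finally show ?thesis
    by (simp add: algebra_simps)
qed

lemma (in prob_space) integral_affine:
  fixes f g :: "'a \<Rightarrow> 'b :: {real_normed_field, banach, second_countable_topology}"
  assumes "integrable M f" "integrable M g"
  shows "integrable M (\<lambda>x. p * (1 + q * f x + r * (s * g x)))"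
    and "(\<integral>x. p * (1 + q * f x + r * (s * g x)) \<partial>M) = p * (1 + q * (\<integral>x. f x \<partial>M) + r * (\<integral>x. s * g x \<partial>M))"
  using assms prob_space by simp_all

lemma tendsto_scaled_exp_minus_1:
  fixes z :: "'a :: {real_normed_field, banach}"
  assumes "filterlim m at_top sequentially"
  shows "(\<lambda>n. of_real (m n) * (exp (z / of_real (m n)) - 1)) \<longlonglongrightarrow> z"
proof -
  have i: "(\<lambda>n. inverse (of_real (m n)) :: 'a) \<longlonglongrightarrow> 0"
    using tendsto_of_real[OF tendsto_inverse_0_at_top[OF assms], where ?'a = 'a] by simp
  have "(\<lambda>n. z + z\<^sup>2 * inverse (of_real (m n)) * exp_rem (z * inverse (of_real (m n)))) \<longlonglongrightarrow> z + z\<^sup>2 * 0 * exp_rem (z * 0)"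
    by (intro tendsto_intros i)
  moreover have "\<forall>\<^sub>F n in sequentially. z + z\<^sup>2 * inverse (of_real (m n)) * exp_rem (z * inverse (of_real (m n))) = of_real (m n) * (exp (z / of_real (m n)) - 1)"
    using filterlim_at_top_dense[THEN iffD1, OF assms, rule_format, of 0]
  proof eventually_elim
    case (elim n)
    have "exp (z / of_real (m n)) - 1 = z / of_real (m n) + (z / of_real (m n))\<^sup>2 * exp_rem (z / of_real (m n))"
      by (simp add: square_exp_rem)
    then show ?case
      using elim by (simp add: field_simps power2_eq_square)
  qed
  ultimately show ?thesis
    by (auto intro: Lim_transform_eventually)
qed

text \<open>One summand of an infinitesimal array with limit exponent \<open>V\<close> times the mean of
  \<open>(e^(i u z) - 1 - i u z)/z^2\<close> under \<open>P\<close>. A point \<open>z\<close> is drawn from \<open>P\<close>, moved to \<open>\<zeta> z\<close>, and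
  taken as a jump with probability \<open>V/(m (\<zeta> z)^2)\<close>; then the mean \<open>d\<close> is subtracted. Moving points
  with \<open>|z| < \<delta>\<close> to \<open>\<delta>\<close> keeps the probabilities at most \<open>1\<close> and replaces the Gaussian part, the atom of
  \<open>P\<close> at \<open>0\<close>, by small jumps. The exponential moment bound is \<open>1 + x \<le> e^x\<close>.\<close>

lemma centred_jump_distribution:
  fixes P :: "real measure" and V \<delta> t m :: real
  assumes P: "real_distribution P" and V: "0 < V" and \<delta>: "0 < \<delta>" and m: "0 < m" and Vm: "V \<le> m * \<delta>\<^sup>2"
  defines "\<zeta> \<equiv> \<lambda>z. if \<bar>z\<bar> < \<delta> then \<delta> else z"
  defines "d \<equiv> (\<integral>z. V / (m * \<zeta> z) \<partial>P)"
  assumes int: "integrable P (\<lambda>z. exp_rem (t * \<zeta> z))"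
  obtains \<rho> where "real_distribution \<rho>" and "\<bar>d\<bar> \<le> V / (m * \<delta>)"
    and "\<And>u. char \<rho> (u::real) = exp (- (\<i> * complex_of_real (u * d))) * (1 + \<i> * complex_of_real (u * d) +
          complex_of_real (V / m) * (CLINT z|P. lk_kernel u (\<zeta> z)))"
    and "exp_moment \<rho> t \<le> ennreal (exp ((V / m) * (\<integral>z. t\<^sup>2 * exp_rem (t * \<zeta> z) \<partial>P)))"
proof -
  interpret P: real_distribution P by fact
  interpret U: prob_space uniform01 by (rule prob_space_uniform01)
  interpret PU: pair_prob_space P uniform01 ..
  have [measurable]: "\<zeta> \<in> borel_measurable borel" unfolding \<zeta>_def by measurable
  have \<zeta>: "\<zeta> z \<noteq> 0" "\<delta> \<le> \<bar>\<zeta> z\<bar>" for z using \<delta> by (auto simp: \<zeta>_def)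
  define w where "w z = V / (m * (\<zeta> z)\<^sup>2)" for z
  have [measurable]: "w \<in> borel_measurable borel" unfolding w_def by measurable
  have w0: "0 \<le> w z" for z using V m by (simp add: w_def)
  have w1: "w z \<le> 1" for z
  proof -
    have "\<delta>\<^sup>2 \<le> (\<zeta> z)\<^sup>2" using power_mono[OF \<zeta>(2)[of z], of 2] \<delta> by simp
    then have "V \<le> m * (\<zeta> z)\<^sup>2" using Vm m by (meson mult_left_mono order_trans less_imp_le)
    then show ?thesis using m \<zeta>[of z] by (simp add: w_def)
  qed
  have bd: "\<bar>V / (m * \<zeta> z)\<bar> \<le> V / (m * \<delta>)" for z
    using V m \<delta> \<zeta>[of z] by (simp add: abs_mult frac_le)
  have intd: "integrable P (\<lambda>z. V / (m * \<zeta> z))"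
    using bd by (intro P.integrable_const_bound[where B = "V / (m * \<delta>)"]) auto
  have d: "\<bar>d\<bar> \<le> V / (m * \<delta>)"
  proof -
    have "d \<le> V / (m * \<delta>)" "- (V / (m * \<delta>)) \<le> d"
      unfolding d_def using bd abs_le_D1[OF bd] abs_le_D2[OF bd]
      by (auto intro!: P.integral_le_const[OF intd] P.integral_ge_const[OF intd] AE_I2 simp: minus_le_iff)
    then show ?thesis by auto
  qed
  define Y where "Y = (\<lambda>(z, x). (if x < w z then \<zeta> z else 0) - d)"
  have Y[measurable]: "Y \<in> borel_measurable (P \<Otimes>\<^sub>M uniform01)" unfolding Y_def by measurable
  let ?\<rho> = "distr (P \<Otimes>\<^sub>M uniform01) borel Y"
  show thesis
  proof
    show "real_distribution ?\<rho>"
      by (auto simp: real_distribution_def real_distribution_axioms_def intro!: PU.prob_space_distr)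
  next
    show "\<bar>d\<bar> \<le> V / (m * \<delta>)"
      by (rule d)
  next
    fix u :: real
    let ?e = "exp (- (\<i> * complex_of_real (u * d)))"
    have "char ?\<rho> u = (CLINT p|P \<Otimes>\<^sub>M uniform01. iexp (u * Y p))"
      unfolding char_def by (rule integral_distr) auto
    also have "\<dots> = (CLINT z|P. CLINT x|uniform01. iexp (u * Y (z, x)))"
      by (subst PU.integral_fst'[symmetric]) (auto intro!: PU.integrable_const_bound[where B = 1])
    also have "\<dots> = (CLINT z|P. ?e * (1 + \<i> * complex_of_real u * complex_of_real (V / (m * \<zeta> z))
        + complex_of_real (V / m) * (lk_kernel u (\<zeta> z))))"
    proof (intro Bochner_Integration.integral_cong refl)
      fix z
      have "(CLINT x|uniform01. iexp (u * Y (z, x)))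
          = (CLINT x|uniform01. if x < w z then ?e * iexp (u * \<zeta> z) else ?e)"
        by (intro Bochner_Integration.integral_cong refl) (auto simp: Y_def algebra_simps exp_add[symmetric])
      also have "\<dots> = ?e * (1 + w z * (iexp (u * \<zeta> z) - 1))"
        by (subst integral_uniform01_if) (auto simp: w0 w1 scaleR_conv_of_real algebra_simps)
      also have "iexp (u * \<zeta> z) - 1 = \<i> * complex_of_real (u * \<zeta> z)
          + (\<i> * complex_of_real (u * \<zeta> z))\<^sup>2 * exp_rem (\<i> * complex_of_real (u * \<zeta> z))"
        by (simp add: square_exp_rem)
      also have "w z * \<dots> = \<i> * complex_of_real u * complex_of_real (V / (m * \<zeta> z))
        + complex_of_real (V / m) * (lk_kernel u (\<zeta> z))"
        using \<zeta>[of z] m by (simp add: w_def field_simps power2_eq_square)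
      finally show "(CLINT x|uniform01. iexp (u * Y (z, x))) = ?e * (1 + \<i> * complex_of_real u * complex_of_real (V / (m * \<zeta> z))
        + complex_of_real (V / m) * (lk_kernel u (\<zeta> z)))"
        by (simp add: add.assoc)
    qed
    also have "\<dots> = ?e * (1 + \<i> * complex_of_real u * complex_of_real d
        + complex_of_real (V / m) * (CLINT z|P. lk_kernel u (\<zeta> z)))"
    proof -
      have i1: "integrable P (\<lambda>z. exp_rem (\<i> * complex_of_real (u * \<zeta> z)))"
        by (rule P.integrable_const_bound[where B = "1/2", OF AE_I2[OF norm_exp_rem_iexp]]) measurable
      have i2: "integrable P (\<lambda>z. complex_of_real (V / (m * \<zeta> z)))"
        by (rule integrable_of_real[OF intd])
      have E: "(CLINT z|P. complex_of_real (V / (m * \<zeta> z))) = complex_of_real d"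
        unfolding d_def by (rule integral_complex_of_real)
      show ?thesis
        by (subst P.integral_affine(2)[OF i2 i1]) (simp only: E)
    qed
    finally show "char ?\<rho> u = exp (- (\<i> * complex_of_real (u * d))) * (1 + \<i> * complex_of_real (u * d) +
          complex_of_real (V / m) * (CLINT z|P. lk_kernel u (\<zeta> z)))"
      by (simp only: mult.assoc of_real_mult)
  next
    let ?h = "\<lambda>z. exp (- (t * d)) * (1 + t * (V / (m * \<zeta> z)) + (V / m) * (t\<^sup>2 * exp_rem (t * \<zeta> z)))"
    define q where "q = (V / m) * (\<integral>z. t\<^sup>2 * exp_rem (t * \<zeta> z) \<partial>P)"
    have "exp_moment ?\<rho> t = (\<integral>\<^sup>+p. ennreal (exp (t * Y p)) \<partial>(P \<Otimes>\<^sub>M uniform01))"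
      by (rule nn_integral_distr) auto
    also have "\<dots> = (\<integral>\<^sup>+z. \<integral>\<^sup>+x. ennreal (exp (t * Y (z, x))) \<partial>uniform01 \<partial>P)"
      by (subst U.nn_integral_fst[symmetric]) auto
    also have "\<dots> = (\<integral>\<^sup>+z. ennreal (?h z) \<partial>P)"
    proof (intro nn_integral_cong)
      fix z
      have "(\<integral>\<^sup>+x. ennreal (exp (t * Y (z, x))) \<partial>uniform01)
          = (\<integral>\<^sup>+x. ennreal (if x < w z then exp (- (t * d)) * exp (t * \<zeta> z) else exp (- (t * d))) \<partial>uniform01)"
        by (intro nn_integral_cong) (auto simp: Y_def algebra_simps exp_add[symmetric])
      also have "\<dots> = ennreal (\<integral>x. (if x < w z then exp (- (t * d)) * exp (t * \<zeta> z) else exp (- (t * d))) \<partial>uniform01)"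
        by (rule nn_integral_eq_integral)
          (auto intro!: U.integrable_const_bound[where B = "exp (- (t * d)) * exp (t * \<zeta> z) + exp (- (t * d))"])
      also have "\<dots> = ennreal (exp (- (t * d)) * (1 + w z * (exp (t * \<zeta> z) - 1)))"
        by (subst integral_uniform01_if) (auto simp: w0 w1 algebra_simps)
      also have "exp (t * \<zeta> z) - 1 = t * \<zeta> z + (t * \<zeta> z)\<^sup>2 * exp_rem (t * \<zeta> z)"
        by (simp add: square_exp_rem)
      also have "w z * \<dots> = t * (V / (m * \<zeta> z)) + (V / m) * (t\<^sup>2 * exp_rem (t * \<zeta> z))"
        using \<zeta>[of z] m by (simp add: w_def field_simps power2_eq_square)
      finally show "(\<integral>\<^sup>+x. ennreal (exp (t * Y (z, x))) \<partial>uniform01) = ennreal (?h z)"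
        by (simp only: add.assoc)
    qed
    also have "\<dots> = ennreal (\<integral>z. ?h z \<partial>P)"
    proof (rule nn_integral_eq_integral)
      show "integrable P ?h"
        by (rule P.integral_affine(1)[OF intd int])
      have "t * (V / (m * \<zeta> z)) + (V / m) * (t\<^sup>2 * exp_rem (t * \<zeta> z)) = w z * (exp (t * \<zeta> z) - 1)" for z
      proof -
        have "exp (t * \<zeta> z) - 1 = t * \<zeta> z + (t * \<zeta> z)\<^sup>2 * exp_rem (t * \<zeta> z)"
          by (simp add: square_exp_rem)
        then show ?thesis
          using \<zeta>[of z] m by (simp add: w_def field_simps power2_eq_square)
      qed
      moreover have "0 \<le> 1 + w z * (exp (t * \<zeta> z) - 1)" for z
      proof -
        have eq: "1 + w z * (exp (t * \<zeta> z) - 1) = (1 - w z) + w z * exp (t * \<zeta> z)"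
          by (simp add: algebra_simps)
        show ?thesis unfolding eq using w0[of z] w1[of z] by (intro add_nonneg_nonneg mult_nonneg_nonneg) auto
      qed
      ultimately have "0 \<le> 1 + t * (V / (m * \<zeta> z)) + (V / m) * (t\<^sup>2 * exp_rem (t * \<zeta> z))" for z
        by (metis add.assoc)
      then show "AE z in P. 0 \<le> ?h z"
        by simp
    qed
    also have "(\<integral>z. ?h z \<partial>P)
       = exp (- (t * d)) * (1 + t * d + q)"
      unfolding d_def q_def by (rule P.integral_affine(2)[OF intd int])
    also have "exp (- (t * d)) * (1 + t * d + q) \<le> exp (- (t * d)) * exp (t * d + q)"
      using exp_ge_add_one_self[of "t * d + q"] by (intro mult_left_mono) (auto simp: add.assoc)
    also have "\<dots> = exp q"
      by (simp add: exp_add[symmetric])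
    finally show "exp_moment ?\<rho> t \<le> ennreal (exp ((V / m) * (\<integral>z. t\<^sup>2 * exp_rem (t * \<zeta> z) \<partial>P)))"
      by (simp add: q_def ennreal_leI)
  qed
qed


text \<open>The compensated Levy-Khintchine exponent \<open>- a u^2/2 + \<integral> (e^(i u x) - 1 - i u x) \<nu>(dx)\<close>, written as an
  integral over the probability law \<open>P = (a \<delta>\<^sub>0 + x^2 \<nu>(dx))/V\<close>.\<close>

definition lk_exponent :: "real measure \<Rightarrow> real \<Rightarrow> real \<Rightarrow> complex" where
  "lk_exponent P V u = complex_of_real V *
     (CLINT z|P. lk_kernel u z)"

lemma (in real_distribution) integrable_exp_rem_iexp:
  assumes "f \<in> borel_measurable M"
  shows "integrable M (\<lambda>z. exp_rem (\<i> * complex_of_real (f z)))"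
  by (rule integrable_const_bound[where B = "1/2", OF AE_I2[OF norm_exp_rem_iexp]]) (use assms in measurable)

lemma (in real_distribution) Re_lk_exponent:
  "Re (lk_exponent M V u) = - (V * u\<^sup>2 * (\<integral>z. cos_rem (u * z) \<partial>M))"
  by (simp add: lk_exponent_def power_mult_distrib integrable_exp_rem_iexp del: of_real_mult flip: of_real_power)

lemma (in real_distribution) Re_lk_exponent_le_0:
  assumes "0 \<le> V"
  shows "Re (lk_exponent M V u) \<le> 0"
  using assms Re_exp_rem_iexp_nonneg
  by (simp add: Re_lk_exponent Bochner_Integration.integral_nonneg mult_nonneg_nonneg del: of_real_mult)

text \<open>The measure \<open>\<mu>\<close> is approximated by the \<open>m\<close>-th convolution powers of the centred jump distributions with
  \<open>\<delta> = 1/k\<close> and \<open>m = k^4\<close>. The drift per summand is then of order \<open>k^(-3)\<close>, so that \<open>m d^2\<close> tends to \<open>0\<close> and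
  the centring contributes nothing to the limit, while \<open>V \<le> m \<delta>^2 = k^2\<close> holds for \<open>k \<ge> V\<close>, \<open>k \<ge> 1\<close>. Each
  convolution power has an exponential moment below the bound up to an error that vanishes, and the
  bound passes to the weak limit.\<close>

lemma (in real_distribution) exp_moment_le_lk:
  assumes \<mu>: "real_distribution \<mu>" and V: "0 < V"
    and char: "\<And>u. char \<mu> u = exp (lk_exponent M V u)"
    and int: "integrable M (\<lambda>z. exp_rem (t * z))"
  shows "exp_moment \<mu> t \<le> ennreal (exp (V * (\<integral>z. t\<^sup>2 * exp_rem (t * z) \<partial>M)))"
proof -
  define k where "k n = Suc n + nat \<lceil>V\<rceil>" for n
  have k1: "1 \<le> real (k n)" and kV: "V \<le> real (k n)" and kn: "real n \<le> real (k n)" for n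
    using V by (auto simp: k_def) linarith+
  have k0: "real (k n) \<noteq> 0" "0 < real (k n)" for n using k1[of n] by linarith+
  have klim: "filterlim (\<lambda>n. real (k n)) at_top sequentially"
    by (rule filterlim_at_top_mono[OF filterlim_real_sequentially]) (intro always_eventually allI kn)
  have kinv: "(\<lambda>n. 1 / real (k n)) \<longlonglongrightarrow> 0"
    using tendsto_inverse_0_at_top[OF klim] by (simp add: inverse_eq_divide)
  define \<zeta> where "\<zeta> n z = (if \<bar>z\<bar> < 1 / k n then 1 / k n else z)" for n z
  have [measurable]: "\<zeta> n \<in> borel_measurable borel" for n unfolding \<zeta>_def by measurable
  have \<zeta>lim: "(\<lambda>n. \<zeta> n z) \<longlonglongrightarrow> z" for z
  proof (rule Lim_null_comparison[where f = "\<lambda>n. \<zeta> n z - z" and g = "\<lambda>n. 2 * (1 / real (k n))" for z, THEN LIM_zero_cancel])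
    show "\<forall>\<^sub>F n in sequentially. norm (\<zeta> n z - z) \<le> 2 * (1 / real (k n))"
      using k0 by (auto simp: \<zeta>_def intro!: always_eventually)
    show "(\<lambda>n. 2 * (1 / real (k n))) \<longlonglongrightarrow> 0"
      using tendsto_mult_right_zero[OF kinv] by blast
  qed
  define m where "m n = k n ^ 4" for n
  have m0: "0 < real (m n)" for n using k0(2)[of n] by (simp add: m_def)
  have mlim: "filterlim (\<lambda>n. real (m n)) at_top sequentially"
  proof (rule filterlim_at_top_mono[OF klim], rule always_eventually, rule allI)
    fix n show "real (k n) \<le> real (m n)"
      using power_increasing[OF _ k1[of n], of 1 4] by (simp add: m_def)
  qed
  have Vm: "V \<le> real (m n) * (1 / real (k n))\<^sup>2" for n
  proof -
    have "V \<le> real (k n) * 1" using kV by simp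
    also have "\<dots> \<le> real (k n) * real (k n)" using k1[of n] by (intro mult_left_mono) auto
    also have "\<dots> = real (m n) * (1 / real (k n))\<^sup>2"
      using k0[of n] by (simp add: m_def field_simps power2_eq_square power4_eq_xxxx)
    finally show ?thesis .
  qed
  have dom: "\<bar>exp_rem (t * \<zeta> n z)\<bar> \<le> exp_rem (t * z) + exp \<bar>t\<bar>" for n z
  proof (cases "\<bar>z\<bar> < 1 / k n")
    case True
    have "\<bar>t * (1 / real (k n))\<bar> \<le> \<bar>t\<bar> * 1"
      unfolding abs_mult using k1[of n] by (intro mult_left_mono) auto
    then have "exp \<bar>t * (1 / real (k n))\<bar> \<le> exp \<bar>t\<bar>" by simp
    then have "exp_rem (t * (1 / real (k n))) \<le> exp \<bar>t\<bar>"
      using exp_rem_le[of "t * (1 / real (k n))"] by linarith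
    with True show ?thesis
      using exp_rem_nonneg[of "t * z"] exp_rem_nonneg[of "t * (1 / real (k n))"] by (simp add: \<zeta>_def)
  next
    case False
    then show ?thesis using exp_rem_nonneg[of "t * z"] by (simp add: \<zeta>_def)
  qed
  have int_dom: "integrable M (\<lambda>z. exp_rem (t * z) + exp \<bar>t\<bar>)"
    using int by simp
  have int\<zeta>: "integrable M (\<lambda>z. exp_rem (t * \<zeta> n z))" for n
    by (rule Bochner_Integration.integrable_bound[OF int_dom])
      (auto intro!: AE_I2 order_trans[OF dom])
  define d where "d n = (\<integral>z. V / (real (m n) * \<zeta> n z) \<partial>M)" for n
  define Q where "Q n u = (CLINT z|M. lk_kernel u (\<zeta> n z))" for n u
  define q where "q n = (\<integral>z. t\<^sup>2 * exp_rem (t * \<zeta> n z) \<partial>M)" for n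
  have "\<forall>n. \<exists>\<rho>. real_distribution \<rho> \<and> \<bar>d n\<bar> \<le> V / (real (m n) * (1 / real (k n))) \<and>
     (\<forall>u. char \<rho> u = exp (- (\<i> * complex_of_real (u * d n))) * (1 + \<i> * complex_of_real (u * d n) +
          complex_of_real (V / real (m n)) * Q n u)) \<and>
     exp_moment \<rho> t \<le> ennreal (exp ((V / real (m n)) * q n))"
    (is "\<forall>n. \<exists>\<rho>. ?Q n \<rho>")
  proof
    fix n
    have \<delta>: "0 < 1 / real (k n)" using k0(2)[of n] by simp
    note jump = centred_jump_distribution[OF real_distribution_axioms V \<delta> m0[of n] Vm[of n], where t = t,
        folded \<zeta>_def, OF int\<zeta>[of n], folded d_def Q_def q_def]
    show "\<exists>\<rho>. ?Q n \<rho>"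
      by (rule jump) blast
  qed
  then obtain \<rho> where \<rho>: "\<And>n. real_distribution (\<rho> n)"
    and d: "\<And>n. \<bar>d n\<bar> \<le> V / (real (m n) * (1 / real (k n)))"
    and char\<rho>: "\<And>n u. char (\<rho> n) u = exp (- (\<i> * complex_of_real (u * d n))) * (1 + \<i> * complex_of_real (u * d n) +
          complex_of_real (V / real (m n)) * Q n u)"
    and mgf\<rho>: "\<And>n. exp_moment (\<rho> n) t \<le> ennreal (exp ((V / real (m n)) * q n))"
    by metis
  have md: "(\<lambda>n. real (m n) * (d n)\<^sup>2) \<longlonglongrightarrow> 0"
  proof (rule Lim_null_comparison)
    show "\<forall>\<^sub>F n in sequentially. norm (real (m n) * (d n)\<^sup>2) \<le> V\<^sup>2 * (1 / real (k n))\<^sup>2"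
    proof (intro always_eventually allI)
      fix n
      have "\<bar>d n\<bar>\<^sup>2 \<le> (V / (real (m n) * (1 / real (k n))))\<^sup>2"
        by (rule power_mono[OF d]) simp
      then have "real (m n) * (d n)\<^sup>2 \<le> real (m n) * (V / (real (m n) * (1 / real (k n))))\<^sup>2"
        by (intro mult_left_mono) auto
      also have "\<dots> = V\<^sup>2 * (1 / real (k n))\<^sup>2"
        using k0[of n] by (simp add: m_def field_simps power2_eq_square power4_eq_xxxx)
      finally show "norm (real (m n) * (d n)\<^sup>2) \<le> V\<^sup>2 * (1 / real (k n))\<^sup>2"
        by simp
    qed
    have "(\<lambda>n. V\<^sup>2 * (1 / real (k n))\<^sup>2) \<longlonglongrightarrow> V\<^sup>2 * 0\<^sup>2"
      by (intro tendsto_intros kinv)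
    then show "(\<lambda>n. V\<^sup>2 * (1 / real (k n))\<^sup>2) \<longlonglongrightarrow> 0" by simp
  qed
  have d0: "d \<longlonglongrightarrow> 0"
  proof (rule Lim_null_comparison)
    show "\<forall>\<^sub>F n in sequentially. norm (d n) \<le> V * (1 / real (k n))"
    proof (intro always_eventually allI)
      fix n
      have "real (k n) * 1 \<le> real (m n) * (1 / real (k n))"
        using power_increasing[OF _ k1[of n], of 1 3] k0[of n]
        by (simp add: m_def power4_eq_xxxx power3_eq_cube)
      then have "V / (real (m n) * (1 / real (k n))) \<le> V / (real (k n) * 1)"
        using V k0[of n] by (intro divide_left_mono) (auto simp: m_def)
      then show "norm (d n) \<le> V * (1 / real (k n))"
        using d[of n] by simp
    qed
    show "(\<lambda>n. V * (1 / real (k n))) \<longlonglongrightarrow> 0"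
      using tendsto_mult_right_zero[OF kinv] by blast
  qed
  have qlim: "q \<longlonglongrightarrow> (\<integral>z. t\<^sup>2 * exp_rem (t * z) \<partial>M)"
    unfolding q_def
  proof (rule integral_dominated_convergence[where w = "\<lambda>z. t\<^sup>2 * (exp_rem (t * z) + exp \<bar>t\<bar>)"])
    show "integrable M (\<lambda>z. t\<^sup>2 * (exp_rem (t * z) + exp \<bar>t\<bar>))"
      using int_dom by (rule integrable_mult_right)
    show "AE z in M. norm (t\<^sup>2 * exp_rem (t * \<zeta> n z)) \<le> t\<^sup>2 * (exp_rem (t * z) + exp \<bar>t\<bar>)" for n
      unfolding norm_mult by (intro AE_I2 mult_mono) (use dom in auto)
  qed (auto intro!: tendsto_intros \<zeta>lim)
  have Qlim: "(\<lambda>n. Q n u) \<longlonglongrightarrow> (CLINT z|M. lk_kernel u z)" for u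
    unfolding Q_def
  proof (rule integral_dominated_convergence[where w = "\<lambda>z. u\<^sup>2"])
    show "AE z in M. norm (lk_kernel u (\<zeta> n z)) \<le> u\<^sup>2" for n
    proof (rule AE_I2)
      fix z
      have "norm (exp_rem (\<i> * complex_of_real (u * \<zeta> n z))) \<le> 1"
        using norm_exp_rem_iexp[of "u * \<zeta> n z"] by simp
      then show "norm (lk_kernel u (\<zeta> n z)) \<le> u\<^sup>2"
        by (simp add: norm_mult norm_power mult_left_le del: of_real_mult)
    qed
    show "AE z in M. (\<lambda>n. lk_kernel u (\<zeta> n z))
        \<longlonglongrightarrow> lk_kernel u z"
      by (intro AE_I2 tendsto_intros \<zeta>lim)
  qed auto
  have main: "(\<lambda>n. char (conv_pow (\<rho> n) (m n)) u) \<longlonglongrightarrow> char \<mu> u" for u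
  proof -
    let ?\<Phi> = "lk_exponent M V u"
    let ?y = "\<lambda>n. \<i> * complex_of_real (u * d n)"
    have 1: "(\<lambda>n. of_real (m n) * (exp (- ?y n) * (1 + ?y n) - 1)) \<longlonglongrightarrow> 0"
    proof (rule Lim_null_comparison)
      show "\<forall>\<^sub>F n in sequentially. norm (of_real (m n) * (exp (- ?y n) * (1 + ?y n) - 1))
          \<le> u\<^sup>2 * (real (m n) * (d n)\<^sup>2)"
      proof (intro always_eventually allI)
        fix n
        have "exp (- ?y n) * (1 + ?y n) - 1 = - (exp (- ?y n) * ((?y n)\<^sup>2 * exp_rem (?y n)))"
          unfolding square_exp_rem by (simp add: algebra_simps exp_minus_inverse del: of_real_mult)
        then have "norm (exp (- ?y n) * (1 + ?y n) - 1) = (u * d n)\<^sup>2 * norm (exp_rem (?y n))"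
          using norm_exp_i_times[of "- (u * d n)"]
          by (simp add: norm_mult norm_power del: of_real_mult)
        also have "\<dots> \<le> (u * d n)\<^sup>2 * 1"
          using norm_exp_rem_iexp[of "u * d n"] by (intro mult_left_mono) auto
        finally have "norm (exp (- ?y n) * (1 + ?y n) - 1) \<le> (u * d n)\<^sup>2" by simp
        then have "real (m n) * norm (exp (- ?y n) * (1 + ?y n) - 1) \<le> real (m n) * (u * d n)\<^sup>2"
          by (intro mult_left_mono) auto
        then show "norm (of_real (m n) * (exp (- ?y n) * (1 + ?y n) - 1)) \<le> u\<^sup>2 * (real (m n) * (d n)\<^sup>2)"
          by (simp only: norm_mult norm_of_real abs_of_nat power_mult_distrib mult.left_commute)
      qed
      show "(\<lambda>n. u\<^sup>2 * (real (m n) * (d n)\<^sup>2)) \<longlonglongrightarrow> 0"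
        by (rule tendsto_mult_right_zero[OF md])
    qed
    have "(\<lambda>n. exp (- ?y n) * (complex_of_real V * Q n u)) \<longlonglongrightarrow> exp (- (\<i> * complex_of_real (u * 0))) * ?\<Phi>"
      unfolding lk_exponent_def by (intro tendsto_intros d0 Qlim)
    then have 2: "(\<lambda>n. exp (- ?y n) * (complex_of_real V * Q n u)) \<longlonglongrightarrow> ?\<Phi>"
      by simp
    have 3: "(\<lambda>n. of_real (m n) * (exp (?\<Phi> / of_real (m n)) - 1)) \<longlonglongrightarrow> ?\<Phi>"
      by (rule tendsto_scaled_exp_minus_1[OF mlim])
    have "(\<lambda>n. of_real (m n) * (exp (- ?y n) * (1 + ?y n) - 1)
        + exp (- ?y n) * (complex_of_real V * Q n u)
        - of_real (m n) * (exp (?\<Phi> / of_real (m n)) - 1)) \<longlonglongrightarrow> 0 + ?\<Phi> - ?\<Phi>"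
      by (intro tendsto_diff tendsto_add 1 2 3)
    also have "(\<lambda>n. of_real (m n) * (exp (- ?y n) * (1 + ?y n) - 1)
        + exp (- ?y n) * (complex_of_real V * Q n u)
        - of_real (m n) * (exp (?\<Phi> / of_real (m n)) - 1))
      = (\<lambda>n. of_real (m n) * (char (\<rho> n) u - exp (?\<Phi> / of_real (m n))))"
    proof
      fix n
      define e y r where "e = exp (- ?y n)" and "y = ?y n"
        and "r = exp (?\<Phi> / of_real (m n))"
      have *: "complex_of_real (V / real (m n)) = of_real V / of_real (m n)" by simp
      have "(of_real (m n) :: complex) \<noteq> 0" using m0[of n] by simp
      then show "of_real (m n) * (exp (- ?y n) * (1 + ?y n) - 1)
        + exp (- ?y n) * (complex_of_real V * Q n u)
        - of_real (m n) * (exp (?\<Phi> / of_real (m n)) - 1) = of_real (m n) * (char (\<rho> n) u - exp (?\<Phi> / of_real (m n)))"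
        unfolding char\<rho> * e_def[symmetric] r_def[symmetric] unfolding y_def[symmetric]
        by (simp add: field_simps)
    qed
    finally have lim: "(\<lambda>n. of_real (m n) * (char (\<rho> n) u - exp (?\<Phi> / of_real (m n)))) \<longlonglongrightarrow> 0"
      by simp
    have "(\<lambda>n. char (conv_pow (\<rho> n) (m n)) u - exp ?\<Phi>) \<longlonglongrightarrow> 0"
    proof (rule Lim_null_comparison[OF always_eventually tendsto_norm_zero[OF lim]], rule allI)
      fix n
      interpret \<rho>: real_distribution "\<rho> n" by (rule \<rho>)
      have "exp ?\<Phi> = exp (?\<Phi> / of_real (m n)) ^ m n"
        using m0[of n] by (simp add: exp_of_nat_mult[symmetric])
      moreover have "norm (exp (?\<Phi> / of_real (m n))) \<le> 1"
        using Re_lk_exponent_le_0[of V u] V m0[of n] by (simp add: divide_nonpos_pos)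
      ultimately have "norm (char (\<rho> n) u ^ m n - exp ?\<Phi>) \<le> m n * norm (char (\<rho> n) u - exp (?\<Phi> / of_real (m n)))"
        by (simp add: norm_power_diff \<rho>.cmod_char_le_1)
      then show "norm (char (conv_pow (\<rho> n) (m n)) u - exp ?\<Phi>) \<le> norm (of_real (m n) * (char (\<rho> n) u - exp (?\<Phi> / of_real (m n))))"
        by (simp add: char_conv_pow[OF \<rho>] norm_mult)
    qed
    then show ?thesis
      unfolding char by (rule LIM_zero_cancel)
  qed
  show ?thesis
  proof (rule exp_moment_le_of_char_tendsto[OF real_distribution_conv_pow[OF \<rho>] \<mu> main, where C = "\<lambda>n. exp (V * q n)"])
    fix n
    have "exp_moment (conv_pow (\<rho> n) (m n)) t \<le> ennreal (exp ((V / real (m n)) * q n)) ^ m n"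
      unfolding exp_moment_conv_pow[OF \<rho>] by (intro power_mono mgf\<rho>) auto
    also have "\<dots> = ennreal (exp (V * q n))"
      using m0[of n] by (simp add: ennreal_power exp_of_nat_mult[symmetric])
    finally show "exp_moment (conv_pow (\<rho> n) (m n)) t \<le> ennreal (exp (V * q n))" .
  next
    show "(\<lambda>n. exp (V * q n)) \<longlonglongrightarrow> exp (V * (\<integral>z. t\<^sup>2 * exp_rem (t * z) \<partial>M))"
      by (intro tendsto_intros qlim)
  qed simp
qed

section \<open>Differentiation under the integral sign\<close>

lemma has_vector_derivative_iff_quotient:
  "(f has_vector_derivative d) (at x) \<longleftrightarrow> ((\<lambda>h. (f (x + h) - f x) /\<^sub>R h) \<longlongrightarrow> d) (at 0)"
proof -
  have "(f has_vector_derivative d) (at x) \<longleftrightarrow> ((\<lambda>h. norm (f (x + h) - f x - h *\<^sub>R d) / norm h) \<longlongrightarrow> 0) (at 0)"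
    unfolding has_vector_derivative_def has_derivative_at by (simp add: bounded_linear_scaleR_left)
  also have "\<dots> \<longleftrightarrow> ((\<lambda>h. norm ((f (x + h) - f x) /\<^sub>R h - d)) \<longlongrightarrow> 0) (at 0)"
  proof (rule filterlim_cong[OF refl refl])
    have "norm (f (x + h) - f x - h *\<^sub>R d) / norm h = norm ((f (x + h) - f x) /\<^sub>R h - d)" if "h \<noteq> 0" for h
    proof -
      have "(f (x + h) - f x) /\<^sub>R h - d = (f (x + h) - f x - h *\<^sub>R d) /\<^sub>R h"
        using that by (simp add: scaleR_diff_right)
      then show ?thesis by (simp add: divide_inverse_commute)
    qed
    then show "\<forall>\<^sub>F h in at 0. norm (f (x + h) - f x - h *\<^sub>R d) / norm h = norm ((f (x + h) - f x) /\<^sub>R h - d)"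
      by (simp add: eventually_at_filter)
  qed
  also have "\<dots> \<longleftrightarrow> ((\<lambda>h. (f (x + h) - f x) /\<^sub>R h) \<longlongrightarrow> d) (at 0)"
    by (simp add: tendsto_norm_zero_iff LIM_zero_iff)
  finally show ?thesis .
qed

text \<open>Dominated convergence for difference quotients, which the mean value inequality bounds by \<open>w\<close>.\<close>

lemma has_vector_derivative_integral:
  fixes F :: "real \<Rightarrow> 'a \<Rightarrow> 'b :: {banach, second_countable_topology}"
  assumes int: "\<And>u. integrable M (F u)"
    and der: "\<And>u x. ((\<lambda>u. F u x) has_vector_derivative F' u x) (at u)"
    and bound: "\<And>u x. \<bar>u - u0\<bar> < 1 \<Longrightarrow> norm (F' u x) \<le> w x"
    and w: "integrable M w" and meas: "F' u0 \<in> borel_measurable M"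
  shows "((\<lambda>u. \<integral>x. F u x \<partial>M) has_vector_derivative (\<integral>x. F' u0 x \<partial>M)) (at u0)"
proof -
  have "((\<lambda>h. ((\<integral>x. F (u0 + h) x \<partial>M) - (\<integral>x. F u0 x \<partial>M)) /\<^sub>R h) \<longlongrightarrow> (\<integral>x. F' u0 x \<partial>M)) (at 0)"
    unfolding tendsto_at_iff_sequentially comp_def
  proof (intro allI impI)
    fix X :: "nat \<Rightarrow> real" assume X: "\<forall>i. X i \<in> UNIV - {0}" "X \<longlonglongrightarrow> 0"
    from X(2) obtain n0 where n0: "\<And>n. n \<ge> n0 \<Longrightarrow> \<bar>X n\<bar> < 1"
      using LIMSEQ_D[OF X(2), of 1] by auto
    define Y where "Y n = X (n + n0)" for n
    have Y: "\<bar>Y n\<bar> < 1" "Y n \<noteq> 0" for n using n0[of "n + n0"] X(1) by (auto simp: Y_def)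
    have Ylim: "Y \<longlonglongrightarrow> 0" unfolding Y_def by (rule LIMSEQ_ignore_initial_segment[OF X(2)])
    have lim: "(\<lambda>n. \<integral>x. (F (u0 + Y n) x - F u0 x) /\<^sub>R Y n \<partial>M) \<longlonglongrightarrow> (\<integral>x. F' u0 x \<partial>M)"
    proof (rule integral_dominated_convergence[where w = w])
      show "AE x in M. (\<lambda>n. (F (u0 + Y n) x - F u0 x) /\<^sub>R Y n) \<longlonglongrightarrow> F' u0 x"
      proof (rule AE_I2)
        fix x
        have "((\<lambda>h. (F (u0 + h) x - F u0 x) /\<^sub>R h) \<longlongrightarrow> F' u0 x) (at 0)"
          using der[of x u0] by (simp add: has_vector_derivative_iff_quotient)
        then show "(\<lambda>n. (F (u0 + Y n) x - F u0 x) /\<^sub>R Y n) \<longlonglongrightarrow> F' u0 x"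
          using Y(2) Ylim unfolding tendsto_at_iff_sequentially comp_def by auto
      qed
      show "AE x in M. norm ((F (u0 + Y n) x - F u0 x) /\<^sub>R Y n) \<le> w x" for n
      proof (rule AE_I2)
        fix x
        have "norm (F (u0 + Y n) x - F u0 x) \<le> w x * norm (u0 + Y n - u0)"
        proof (rule differentiable_bound[where S = "{u0 - 1<..<u0 + 1}" and f' = "\<lambda>u h. h *\<^sub>R F' u x"])
          fix u assume u: "u \<in> {u0 - 1<..<u0 + 1}"
          show "((\<lambda>u. F u x) has_derivative (\<lambda>h. h *\<^sub>R F' u x)) (at u within {u0 - 1<..<u0 + 1})"
            using der[of x u] unfolding has_vector_derivative_def by (rule has_derivative_at_withinI)
          show "onorm (\<lambda>h. h *\<^sub>R F' u x) \<le> w x"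
          proof (rule onorm_le)
            fix h :: real
            have "\<bar>h\<bar> * norm (F' u x) \<le> \<bar>h\<bar> * w x"
              using u by (intro mult_left_mono bound) auto
            then show "norm (h *\<^sub>R F' u x) \<le> w x * norm h" by (simp add: mult.commute)
          qed
        qed (use Y(1)[of n] in auto)
        then show "norm ((F (u0 + Y n) x - F u0 x) /\<^sub>R Y n) \<le> w x"
          using Y(2)[of n] by (simp add: divide_simps mult.commute)
      qed
    qed (use int meas w in auto)
    have eq: "(\<integral>x. (F (u0 + Y n) x - F u0 x) /\<^sub>R Y n \<partial>M) = ((\<integral>x. F (u0 + Y n) x \<partial>M) - (\<integral>x. F u0 x \<partial>M)) /\<^sub>R Y n" for n
      using int by simp
    have "(\<lambda>n. ((\<integral>x. F (u0 + X (n + n0)) x \<partial>M) - (\<integral>x. F u0 x \<partial>M)) /\<^sub>R X (n + n0)) \<longlonglongrightarrow> (\<integral>x. F' u0 x \<partial>M)"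
      using lim unfolding eq unfolding Y_def .
    then show "(\<lambda>n. ((\<integral>x. F (u0 + X n) x \<partial>M) - (\<integral>x. F u0 x \<partial>M)) /\<^sub>R X n) \<longlonglongrightarrow> (\<integral>x. F' u0 x \<partial>M)"
      by (rule LIMSEQ_offset)
  qed
  then show ?thesis
    by (simp add: has_vector_derivative_iff_quotient)
qed

lemma has_vector_derivative_iexp_mult:
  "((\<lambda>u. exp (\<i> * complex_of_real (u * z))) has_vector_derivative \<i> * complex_of_real z * exp (\<i> * complex_of_real (u * z))) (at u)"
  by (auto intro!: derivative_eq_intros simp: has_vector_derivative_complex_iff Re_exp Im_exp)

text \<open>Each derivative of a characteristic function costs one moment.\<close>

lemma (in real_distribution) has_vector_derivative_moment_char:
  assumes "integrable M (\<lambda>x. x ^ k)" "integrable M (\<lambda>x. x ^ Suc k)"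
  shows "((\<lambda>u. CLINT x|M. (\<i> * complex_of_real x) ^ k * iexp (u * x)) has_vector_derivative
     (CLINT x|M. (\<i> * complex_of_real x) ^ Suc k * iexp (u * x))) (at u)"
proof (rule has_vector_derivative_integral[where w = "\<lambda>x. \<bar>x ^ Suc k\<bar>"])
  show "integrable M (\<lambda>x. (\<i> * complex_of_real x) ^ k * iexp (u * x))" for u
    by (rule Bochner_Integration.integrable_bound[OF integrable_norm[OF assms(1)]])
      (auto simp: norm_mult norm_power power_abs)
  show "((\<lambda>u. (\<i> * complex_of_real x) ^ k * iexp (u * x)) has_vector_derivative (\<i> * complex_of_real x) ^ Suc k * iexp (u * x)) (at u)" for u x
    using has_vector_derivative_mult_right[OF has_vector_derivative_iexp_mult, of "(\<i> * complex_of_real x) ^ k" x u] by (simp add: mult_ac)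
  show "integrable M (\<lambda>x. \<bar>x ^ Suc k\<bar>)"
    using assms(2) by (rule integrable_abs)
qed (auto simp: norm_mult norm_power power_abs abs_mult)

section \<open>Lower bound for exponential moments\<close>

lemma (in real_distribution) isCont_lk_exponent: "isCont (lk_exponent M V) u"
  unfolding continuous_at_sequentially
proof safe
  fix X assume X: "X \<longlonglongrightarrow> u"
  have "(\<lambda>n. CLINT z|M. exp_rem (\<i> * complex_of_real (X n * z))) \<longlonglongrightarrow> (CLINT z|M. exp_rem (\<i> * complex_of_real (u * z)))"
  proof (rule integral_dominated_convergence[where w = "\<lambda>_. 1 / 2"])
    show "AE z in M. (\<lambda>n. exp_rem (\<i> * complex_of_real (X n * z))) \<longlonglongrightarrow> exp_rem (\<i> * complex_of_real (u * z))"
      by (intro AE_I2 tendsto_intros X)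
    show "AE z in M. norm (exp_rem (\<i> * complex_of_real (X n * z))) \<le> 1 / 2" for n
      by (intro AE_I2 norm_exp_rem_iexp)
  qed auto
  then show "(lk_exponent M V \<circ> X) \<longlonglongrightarrow> lk_exponent M V u"
    unfolding comp_def lk_exponent_def by (simp del: of_real_mult) (intro tendsto_intros X)
qed

lemma lk_exponent_0 [simp]: "lk_exponent P V 0 = 0"
  by (simp add: lk_exponent_def)

text \<open>The quotient of the two sides is continuous with values in the finite set of \<open>N\<close>-th roots of unity, hence
  constant, and it equals \<open>1\<close> at \<open>0\<close>.\<close>

lemma char_root:
  assumes \<rho>: "real_distribution \<rho>" and N: "0 < N" and pow: "\<And>u. char \<rho> u ^ N = exp (\<Phi> u)"
    and cont: "\<And>u. isCont \<Phi> u" and 0: "\<Phi> 0 = 0"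
  shows "char \<rho> u = exp (\<Phi> u / of_nat N)"
proof -
  interpret \<rho>: real_distribution \<rho> by fact
  define f where "f u = char \<rho> u * exp (- (\<Phi> u / of_nat N))" for u
  have "f u ^ N = 1" for u
  proof -
    have "f u ^ N = exp (\<Phi> u) * exp (of_nat N * (- (\<Phi> u / of_nat N)))"
      by (simp only: f_def power_mult_distrib pow exp_of_nat_mult)
    also have "of_nat N * (- (\<Phi> u / of_nat N)) = - \<Phi> u" using N by simp
    finally show ?thesis by (simp add: exp_minus_inverse)
  qed
  then have "f ` UNIV \<subseteq> {z. z ^ N = 1}" by auto
  then have fin: "finite (range f)"
    using finite_roots_unity[of N, where ?'a = complex] N finite_subset by (auto simp: Suc_le_eq)
  have "continuous_on UNIV f"
    unfolding f_def using N
    by (intro continuous_at_imp_continuous_on ballI continuous_intros \<rho>.isCont_char cont) auto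
  then have "f constant_on UNIV"
    by (rule continuous_finite_range_constant[OF connected_UNIV _ fin])
  then have "f u = f 0" by (auto simp: constant_on_def)
  also have "f 0 = 1" by (simp add: f_def 0 \<rho>.char_zero)
  finally show ?thesis
    by (simp add: f_def exp_minus field_simps)
qed

text \<open>By Tonelli's theorem some translate of \<open>\<sigma>\<close> has a finite first absolute moment.\<close>

lemma integrable_convolution_factor:
  assumes \<rho>: "real_distribution \<rho>" and \<sigma>: "real_distribution \<sigma>"
    and int: "integrable (convolution \<rho> \<sigma>) (\<lambda>x. x)"
  shows "integrable \<sigma> (\<lambda>x. x)"
proof -
  interpret \<rho>: real_distribution \<rho> by fact
  interpret \<sigma>: real_distribution \<sigma> by fact
  have "(\<integral>\<^sup>+x. \<integral>\<^sup>+y. ennreal \<bar>x + y\<bar> \<partial>\<sigma> \<partial>\<rho>) < \<infinity>"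
    using int by (simp add: integrable_iff_bounded nn_integral_convolution
        \<rho>.finite_measure_axioms \<sigma>.finite_measure_axioms)
  then have "AE x in \<rho>. (\<integral>\<^sup>+y. ennreal \<bar>x + y\<bar> \<partial>\<sigma>) \<noteq> \<infinity>"
    by (intro nn_integral_PInf_AE) auto
  then obtain x where "(\<integral>\<^sup>+y. ennreal \<bar>x + y\<bar> \<partial>\<sigma>) \<noteq> \<infinity>"
    using \<rho>.AE_contr eventually_mono by blast
  then have "integrable \<sigma> (\<lambda>y. x + y)"
    by (simp add: integrable_iff_bounded less_top[symmetric])
  then have "integrable \<sigma> (\<lambda>y. (x + y) - x)"
    by (intro Bochner_Integration.integrable_diff) auto
  then show ?thesis by simp
qed

text \<open>A second difference in the frequency multiplies the underlying measure by \<open>1 - cos (h x)\<close>. This factor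
  vanishes to second order at the origin, so a measure with a singularity there becomes finite while its
  Fourier transform remains explicit. The next three lemmas apply this to the exponent and to a
  characteristic function.\<close>

lemma iexp_second_difference:
  "iexp (u * x) - (iexp ((u + h) * x) + iexp ((u - h) * x)) / 2 = iexp (u * x) * complex_of_real (1 - cos (h * x))"
proof -
  have "complex_of_real (cos (h * x)) = (iexp (h * x) + exp (- (\<i> * complex_of_real (h * x)))) / 2"
    by (simp add: cos_of_real[symmetric] cos_exp_eq)
  moreover have "iexp ((u + h) * x) = iexp (u * x) * iexp (h * x)"
    "iexp ((u - h) * x) = iexp (u * x) * exp (- (\<i> * complex_of_real (h * x)))"
    by (simp_all add: exp_add[symmetric] algebra_simps)
  ultimately show ?thesis
    by (simp only: of_real_diff of_real_1) (simp add: field_simps del: of_real_mult)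
qed

lemma exp_rem_second_difference:
  fixes u h z :: real
  defines "G \<equiv> \<lambda>u. lk_kernel u z"
  shows "G u - (G (u + h) + G (u - h)) / 2
    = complex_of_real (h\<^sup>2) * (iexp (u * z) * complex_of_real (cos_rem (h * z)))"
proof (cases "z = 0")
  case True
  then show ?thesis by (simp add: G_def power2_eq_square field_simps)
next
  case False
  have G: "complex_of_real (z\<^sup>2) * G u = iexp (u * z) - 1 - \<i> * complex_of_real (u * z)" for u
    unfolding G_def square_exp_rem[symmetric] by (simp add: power2_eq_square)
  have "complex_of_real (z\<^sup>2) * (G u - (G (u + h) + G (u - h)) / 2)
      = complex_of_real (z\<^sup>2) * G u - (complex_of_real (z\<^sup>2) * G (u + h) + complex_of_real (z\<^sup>2) * G (u - h)) / 2"
    by (simp add: algebra_simps add_divide_distrib)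
  also have "\<dots> = iexp (u * z) - (iexp ((u + h) * z) + iexp ((u - h) * z)) / 2"
    unfolding G by (simp add: field_simps)
  also have "\<dots> = iexp (u * z) * complex_of_real ((h * z)\<^sup>2 * cos_rem (h * z))"
    unfolding iexp_second_difference Re_exp_rem_iexp ..
  also have "\<dots> = complex_of_real (z\<^sup>2) * (complex_of_real (h\<^sup>2) * (iexp (u * z) * complex_of_real (cos_rem (h * z))))"
    by (simp add: power_mult_distrib mult_ac)
  finally show ?thesis
    using False by (simp only: mult_cancel_left of_real_eq_0_iff) simp
qed

lemma (in real_distribution) lk_exponent_second_difference:
  "lk_exponent M V u - (lk_exponent M V (u + h) + lk_exponent M V (u - h)) / 2
   = complex_of_real (V * h\<^sup>2) * (CLINT z|M. iexp (u * z) * complex_of_real (cos_rem (h * z)))"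
proof -
  define G where "G u z = lk_kernel u z" for u z
  have G: "integrable M (G u)" for u
    unfolding G_def by (intro integrable_mult_right integrable_exp_rem_iexp) simp
  have "lk_exponent M V u - (lk_exponent M V (u + h) + lk_exponent M V (u - h)) / 2
     = complex_of_real V * (CLINT z|M. G u z - (G (u + h) z + G (u - h) z) / 2)"
    using G[of u] G[of "u + h"] G[of "u - h"] unfolding lk_exponent_def G_def[symmetric]
    by (simp add: right_diff_distrib distrib_left)
  also have "(\<lambda>z. G u z - (G (u + h) z + G (u - h) z) / 2)
     = (\<lambda>z. complex_of_real (h\<^sup>2) * (iexp (u * z) * complex_of_real (cos_rem (h * z))))"
    unfolding G_def by (rule ext exp_rem_second_difference)+
  finally show ?thesis by simp
qed

lemma (in real_distribution) char_second_difference: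
  "char M u - (char M (u + h) + char M (u - h)) / 2 = (CLINT x|M. iexp (u * x) * complex_of_real (1 - cos (h * x)))"
proof -
  have i: "integrable M (\<lambda>x. iexp (v * x))" for v
    by (intro integrable_const_bound[where B = 1]) auto
  have "(CLINT x|M. iexp (u * x) * complex_of_real (1 - cos (h * x)))
    = (CLINT x|M. iexp (u * x) - (iexp ((u + h) * x) + iexp ((u - h) * x)) / 2)"
    by (simp only: iexp_second_difference)
  also have "\<dots> = char M u - (char M (u + h) + char M (u - h)) / 2"
    unfolding char_def using i[of u] i[of "u + h"] i[of "u - h"]
    by (simp del: of_real_mult of_real_add of_real_diff)
  finally show ?thesis ..
qed

lemma (in real_distribution) real_distribution_density:
  assumes [measurable]: "g \<in> borel_measurable borel" and g: "\<And>x. 0 \<le> g x" and int: "integrable M g"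
    and 1: "(\<integral>x. g x \<partial>M) = (1 :: real)"
  shows "real_distribution (density M (\<lambda>x. ennreal (g x)))"
    and "\<And>f :: real \<Rightarrow> 'b :: {banach, second_countable_topology}. f \<in> borel_measurable borel \<Longrightarrow>
      (\<integral>x. f x \<partial>density M (\<lambda>x. ennreal (g x))) = (\<integral>x. g x *\<^sub>R f x \<partial>M)"
proof -
  have "emeasure (density M (\<lambda>x. ennreal (g x))) UNIV = 1"
    using nn_integral_eq_integral[OF int] g by (simp add: emeasure_density 1)
  then have "prob_space (density M (\<lambda>x. ennreal (g x)))"
    by (intro prob_spaceI) simp
  then show "real_distribution (density M (\<lambda>x. ennreal (g x)))"
    by (simp add: real_distribution_def real_distribution_axioms_def)
  show "(\<integral>x. f x \<partial>density M (\<lambda>x. ennreal (g x))) = (\<integral>x. g x *\<^sub>R f x \<partial>M)"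
    if "f \<in> borel_measurable borel" for f :: "real \<Rightarrow> 'b"
    using that g by (intro integral_density) auto
qed


lemma scaleR_divide_complex: "(p / q) *\<^sub>R z = z * complex_of_real p / complex_of_real q"
  by (simp add: scaleR_conv_of_real)

text \<open>A convolution root inherits from \<open>\<mu>\<close> the exponent divided by \<open>n + 1\<close>, a vanishing mean (compare the
  derivatives at \<open>0\<close> of the characteristic functions), and the exponential moment.\<close>

lemma infinitely_divisible_root:
  assumes P: "real_distribution P" and inf: "infinitely_divisible \<mu>"
    and char: "\<And>u. char \<mu> u = exp (lk_exponent P V u)"
    and mean: "integrable \<mu> (\<lambda>x. x)" "(\<integral>x. x \<partial>\<mu>) = 0"
    and mgf: "exp_moment \<mu> t = ennreal (exp K)"
  obtains \<rho> where "real_distribution \<rho>" "\<And>u. char \<rho> u = exp (lk_exponent P V u / of_nat (Suc n))"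
    "integrable \<rho> (\<lambda>x. x)" "(\<integral>x. x \<partial>\<rho>) = 0"
    "exp_moment \<rho> t = ennreal (exp (K / real (Suc n)))"
proof -
  interpret P: real_distribution P by fact
  obtain \<rho> where \<rho>: "real_distribution \<rho>" and conv: "conv_pow \<rho> (Suc n) = \<mu>"
  proof -
    have "1 \<le> Suc n" by simp
    from inf[unfolded infinitely_divisible_def, rule_format, OF this] that show thesis by blast
  qed
  interpret \<rho>: real_distribution \<rho> by fact
  interpret \<sigma>: real_distribution "conv_pow \<rho> n" by (rule real_distribution_conv_pow[OF \<rho>])
  interpret \<mu>: real_distribution \<mu> using real_distribution_conv_pow[OF \<rho>, of "Suc n"] by (simp only: conv)
  have pow: "char \<rho> u ^ Suc n = exp (lk_exponent P V u)" for u
    by (simp only: char_conv_pow[OF \<rho>, symmetric] conv char)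
  have char\<rho>: "char \<rho> u = exp (lk_exponent P V u / of_nat (Suc n))" for u
    by (rule char_root[OF \<rho> _ pow P.isCont_lk_exponent]) auto
  have "\<mu> = convolution (conv_pow \<rho> n) \<rho>"
    using conv convolution_commutative[of "conv_pow \<rho> n" \<rho>]
    by (simp add: \<rho>.finite_measure_axioms \<sigma>.finite_measure_axioms)
  then have int: "integrable \<rho> (\<lambda>x. x)"
    using integrable_convolution_factor[OF \<sigma>.real_distribution_axioms \<rho>] mean(1) by simp
  have d\<rho>: "(char \<rho> has_vector_derivative \<i> * complex_of_real (\<integral>x. x \<partial>\<rho>)) (at 0)"
    using \<rho>.has_vector_derivative_moment_char[of 0 0] int by (simp add: char_def[abs_def])
  have "(char \<mu> has_vector_derivative \<i> * complex_of_real (\<integral>x. x \<partial>\<mu>)) (at 0)"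
    using \<mu>.has_vector_derivative_moment_char[of 0 0] mean by (simp add: char_def[abs_def])
  then have "((\<lambda>u. char \<rho> u ^ Suc n) has_vector_derivative 0) (at 0)"
    using mean(2) pow by (simp add: char[abs_def] del: power_Suc)
  moreover have "((\<lambda>u. char \<rho> u ^ Suc n) has_vector_derivative of_nat (Suc n) * (\<i> * complex_of_real (\<integral>x. x \<partial>\<rho>))) (at 0)"
  proof -
    have "((\<lambda>z :: complex. z ^ Suc n) has_field_derivative of_nat (Suc n)) (at (char \<rho> 0))"
      unfolding \<rho>.char_zero by (auto intro!: derivative_eq_intros simp del: power_Suc)
    from field_vector_diff_chain_at[OF d\<rho> this] show ?thesis
      by (simp add: comp_def mult_ac del: power_Suc)
  qed
  ultimately have "of_nat (Suc n) * (\<i> * complex_of_real (\<integral>x. x \<partial>\<rho>)) = 0"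
    using vector_derivative_unique_at by blast
  then have mean0: "(\<integral>x. x \<partial>\<rho>) = 0"
    by (simp del: of_nat_Suc)
  have "exp_moment \<rho> t ^ Suc n = ennreal (exp K)"
    by (simp only: exp_moment_conv_pow[OF \<rho>, symmetric] conv mgf)
  moreover obtain r where r: "0 \<le> r" "exp_moment \<rho> t = ennreal r"
    using calculation by (cases "exp_moment \<rho> t") (auto simp: ennreal_top_mult)
  ultimately have "r ^ Suc n = exp K"
    by (simp add: ennreal_power del: power_Suc)
  also have "exp K = exp (K / real (Suc n)) ^ Suc n"
    unfolding exp_of_nat_mult[symmetric] by simp
  finally have "r = exp (K / real (Suc n))"
    using r(1) power_eq_imp_eq_base[of r "Suc n"] by simp
  with r have "exp_moment \<rho> t = ennreal (exp (K / real (Suc n)))" by simp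
  from that[OF \<rho> char\<rho> int mean0 this] show thesis .
qed

text \<open>Let \<open>\<rho> n\<close> be the \<open>(n + 1)\<close>-th convolution root. The finite measures \<open>(n + 1) (1 - cos (h x)) \<rho>\<^sub>n(dx)\<close>
  converge weakly to \<open>V (1 - cos (h z))/z^2 P(dz)\<close>, by Levy's continuity theorem for the normalised
  measures. Testing with the bounded continuous function \<open>f(x) = min k ((e^(t x) - 1 - t x)/x^2)\<close> gives the claim,
  since \<open>2/h^2 (1 - cos (h x)) f(x) \<le> e^(t x) - 1 - t x\<close> and the integral of the right-hand side under
  \<open>(n + 1) \<rho>\<^sub>n\<close> is \<open>(n + 1) (e^(K/(n + 1)) - 1)\<close>, which tends to \<open>K\<close>.\<close>

lemma lk_truncated_le:
  assumes P: "real_distribution P" and V: "0 < V" and h: "h \<noteq> 0" and inf: "infinitely_divisible \<mu>"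
    and char: "\<And>u. char \<mu> u = exp (lk_exponent P V u)"
    and mean: "integrable \<mu> (\<lambda>x. x)" "(\<integral>x. x \<partial>\<mu>) = 0"
    and mgf: "exp_moment \<mu> t = ennreal (exp K)" and K: "0 \<le> K"
  shows "V * (\<integral>z. 2 * cos_rem (h * z) * min (real k) (t\<^sup>2 * exp_rem (t * z)) \<partial>P) \<le> K"
proof -
  interpret P: real_distribution P by fact
  let ?\<Phi> = "lk_exponent P V"
  define c where "c z = cos_rem (h * z)" for z
  define f where "f z = min (real k) (t\<^sup>2 * exp_rem (t * z))" for z
  have [measurable]: "c \<in> borel_measurable borel" "f \<in> borel_measurable borel"
    unfolding c_def f_def by measurable
  have c0: "0 \<le> c z" for z unfolding c_def by (rule Re_exp_rem_iexp_nonneg)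
  have c1: "c z \<le> 1 / 2" for z
    unfolding c_def using complex_Re_le_cmod norm_exp_rem_iexp order_trans by blast
  have f0: "0 \<le> f z" and fk: "f z \<le> real k" for z
    unfolding f_def by (auto simp: exp_rem_nonneg)
  have fcont: "isCont f z" for z unfolding f_def by (intro continuous_intros)
  have intc: "integrable P c"
    using c0 c1 by (intro P.integrable_const_bound[where B = "1/2"]) auto
  define A where "A = (\<integral>z. c z \<partial>P)"
  have A0: "0 \<le> A" unfolding A_def by (intro Bochner_Integration.integral_nonneg c0)
  \<comment> \<open>If the weight vanishes almost everywhere there is no limit measure to normalise, but the left-hand side is \<open>0\<close>.\<close>
  show ?thesis unfolding c_def[symmetric] f_def[symmetric]
  proof (cases "A = 0")
    case True
    then have "AE z in P. c z = 0"
      using integral_nonneg_eq_0_iff_AE[OF intc] c0 by (simp add: A_def)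
    then have "(\<integral>z. 2 * c z * f z \<partial>P) = (\<integral>z. 0 \<partial>P)"
      by (intro integral_cong_AE) auto
    then show "V * (\<integral>z. 2 * c z * f z \<partial>P) \<le> K" using K by simp
  next
    case False
    with A0 have A: "0 < A" by simp
    have "\<forall>n. \<exists>\<rho>. real_distribution \<rho> \<and> (\<forall>u. char \<rho> u = exp (?\<Phi> u / of_nat (Suc n))) \<and>
        integrable \<rho> (\<lambda>x. x) \<and> (\<integral>x. x \<partial>\<rho>) = 0 \<and>
        exp_moment \<rho> t = ennreal (exp (K / real (Suc n)))"
      (is "\<forall>n. \<exists>\<rho>. ?Q n \<rho>")
    proof
      fix n
      show "\<exists>\<rho>. ?Q n \<rho>"
        by (rule infinitely_divisible_root[OF P inf char mean mgf, of n]) blast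
    qed
    then obtain \<rho> where \<rho>: "\<And>n. real_distribution (\<rho> n)"
      and char\<rho>: "\<And>n u. char (\<rho> n) u = exp (?\<Phi> u / of_real (real (Suc n)))"
      and int\<rho>: "\<And>n. integrable (\<rho> n) (\<lambda>x. x)" and mean\<rho>: "\<And>n. (\<integral>x. x \<partial>\<rho> n) = 0"
      and mgf\<rho>: "\<And>n. exp_moment (\<rho> n) t = ennreal (exp (K / real (Suc n)))"
      unfolding of_real_of_nat_eq by metis
    have Nlim: "filterlim (\<lambda>n. real (Suc n)) at_top sequentially"
      by (rule filterlim_at_top_mono[OF filterlim_real_sequentially]) simp
    have scaled: "(\<lambda>n. of_real (real (Suc n)) * (char (\<rho> n) u - 1)) \<longlonglongrightarrow> ?\<Phi> u" for u
      unfolding char\<rho> by (rule tendsto_scaled_exp_minus_1[OF Nlim])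
    define D where "D n u = (CLINT x|\<rho> n. iexp (u * x) * complex_of_real (1 - cos (h * x)))" for n u
    have D: "D n u = char (\<rho> n) u - (char (\<rho> n) (u + h) + char (\<rho> n) (u - h)) / 2" for n u
    proof -
      interpret \<rho>: real_distribution "\<rho> n" by (rule \<rho>)
      show ?thesis unfolding D_def \<rho>.char_second_difference ..
    qed
    define L where "L u = (CLINT z|P. iexp (u * z) * complex_of_real (c z))" for u
    have Dlim: "(\<lambda>n. of_real (real (Suc n)) * D n u) \<longlonglongrightarrow> complex_of_real (V * h\<^sup>2) * L u" for u
    proof -
      have "(\<lambda>n. of_real (real (Suc n)) * (char (\<rho> n) u - 1)
          - (of_real (real (Suc n)) * (char (\<rho> n) (u + h) - 1) + of_real (real (Suc n)) * (char (\<rho> n) (u - h) - 1)) / 2)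
          \<longlonglongrightarrow> ?\<Phi> u - (?\<Phi> (u + h) + ?\<Phi> (u - h)) / 2"
        by (intro tendsto_intros scaled) simp
      then show ?thesis
        unfolding P.lk_exponent_second_difference L_def c_def D
        by (simp add: algebra_simps add_divide_distrib diff_divide_distrib del: of_nat_Suc)
    qed
    define a where "a n = (\<integral>x. 1 - cos (h * x) \<partial>\<rho> n)" for n
    have Da: "D n 0 = complex_of_real (a n)" for n
      by (simp add: D_def a_def del: of_real_diff)
    have L0: "L 0 = complex_of_real A"
      by (simp add: L_def A_def)
    have alim: "(\<lambda>n. real (Suc n) * a n) \<longlonglongrightarrow> V * h\<^sup>2 * A"
      using tendsto_Re[OF Dlim[of 0]] by (simp add: Da L0 del: of_nat_Suc)
    have lim0: "0 < V * h\<^sup>2 * A" using V A h by simp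
    then have "eventually (\<lambda>n. 0 < real (Suc n) * a n) sequentially"
      by (rule order_tendstoD(1)[OF alim])
    \<comment> \<open>The sequence is shifted by \<open>n0\<close> so that every total mass is positive and can be normalised to \<open>1\<close>.\<close>
    then obtain n0 where n0: "\<And>n. n \<ge> n0 \<Longrightarrow> 0 < a n"
      by (auto simp: eventually_sequentially zero_less_mult_iff)
    define \<sigma> where "\<sigma> n = density (\<rho> (n + n0)) (\<lambda>x. ennreal ((1 - cos (h * x)) / a (n + n0)))" for n
    define \<tau> where "\<tau> = density P (\<lambda>z. ennreal (c z / A))"
    have \<sigma>: "real_distribution (\<sigma> n)"
      and int\<sigma>: "\<And>f :: real \<Rightarrow> real. f \<in> borel_measurable borel \<Longrightarrow> (\<integral>x. f x \<partial>\<sigma> n) = (\<integral>x. (1 - cos (h * x)) / a (n + n0) * f x \<partial>\<rho> (n + n0))"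
      and char\<sigma>: "char (\<sigma> n) u = D (n + n0) u / complex_of_real (a (n + n0))" for n u
    proof -
      interpret \<rho>: real_distribution "\<rho> (n + n0)" by (rule \<rho>)
      have a: "0 < a (n + n0)" by (rule n0) simp
      have bd: "\<bar>1 - cos y\<bar> \<le> 2" for y :: real
        using cos_ge_minus_one[of y] cos_le_one[of y] by (auto simp: abs_le_iff)
      have int: "integrable (\<rho> (n + n0)) (\<lambda>x. (1 - cos (h * x)) / a (n + n0))"
        using bd by (intro integrable_divide_zero \<rho>.integrable_const_bound[where B = 2]) auto
      have g0: "0 \<le> (1 - cos (h * x)) / a (n + n0)" for x using a by simp
      have 1: "(\<integral>x. (1 - cos (h * x)) / a (n + n0) \<partial>\<rho> (n + n0)) = 1"
        using a by (simp only: integral_divide_zero a_def[symmetric]) simp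
      note dens = \<rho>.real_distribution_density[OF _ g0 int 1, folded \<sigma>_def]
      show "real_distribution (\<sigma> n)" by (rule dens(1)) measurable
      show "(\<integral>x. f x \<partial>\<sigma> n) = (\<integral>x. (1 - cos (h * x)) / a (n + n0) * f x \<partial>\<rho> (n + n0))"
        if "f \<in> borel_measurable borel" for f :: "real \<Rightarrow> real"
        using dens(2)[OF _ that] by simp
      have "char (\<sigma> n) u = (CLINT x|\<rho> (n + n0). ((1 - cos (h * x)) / a (n + n0)) *\<^sub>R iexp (u * x))"
        unfolding char_def by (rule dens(2)) measurable
      also have "\<dots> = (CLINT x|\<rho> (n + n0). iexp (u * x) * complex_of_real (1 - cos (h * x)) / complex_of_real (a (n + n0)))"
        by (simp only: scaleR_divide_complex)
      also have "\<dots> = D (n + n0) u / complex_of_real (a (n + n0))"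
        unfolding D_def by (rule integral_divide_zero)
      finally show "char (\<sigma> n) u = D (n + n0) u / complex_of_real (a (n + n0))" .
    qed
    have \<tau>: "real_distribution \<tau>" and int\<tau>: "(\<integral>x. f x \<partial>\<tau>) = (\<integral>z. c z / A * f z \<partial>P)"
      and char\<tau>: "char \<tau> u = L u / complex_of_real A" for u
    proof -
      have g0: "0 \<le> c z / A" for z using A c0 by simp
      have int: "integrable P (\<lambda>z. c z / A)" using intc by simp
      have 1: "(\<integral>z. c z / A \<partial>P) = 1" using A by (simp add: A_def[symmetric])
      note dens = P.real_distribution_density[OF _ g0 int 1, folded \<tau>_def]
      show "real_distribution \<tau>" by (rule dens(1)) measurable
      show "(\<integral>x. f x \<partial>\<tau>) = (\<integral>z. c z / A * f z \<partial>P)"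
        by (subst dens(2)) auto
      have "char \<tau> u = (CLINT z|P. (c z / A) *\<^sub>R iexp (u * z))"
        unfolding char_def by (rule dens(2)) measurable
      also have "\<dots> = (CLINT z|P. iexp (u * z) * complex_of_real (c z) / complex_of_real A)"
        by (simp only: scaleR_divide_complex)
      also have "\<dots> = L u / complex_of_real A"
        unfolding L_def by (rule integral_divide_zero)
      finally show "char \<tau> u = L u / complex_of_real A" .
    qed
    have "(\<lambda>n. char (\<sigma> n) u) \<longlonglongrightarrow> char \<tau> u" for u
    proof -
      have "(\<lambda>n. (of_real (real (Suc (n + n0))) * D (n + n0) u) / complex_of_real (real (Suc (n + n0)) * a (n + n0)))
          \<longlonglongrightarrow> complex_of_real (V * h\<^sup>2) * L u / complex_of_real (V * h\<^sup>2 * A)"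
      proof (intro tendsto_divide tendsto_of_real)
        show "(\<lambda>n. of_real (real (Suc (n + n0))) * D (n + n0) u) \<longlonglongrightarrow> complex_of_real (V * h\<^sup>2) * L u"
          by (rule LIMSEQ_ignore_initial_segment[OF Dlim])
        show "(\<lambda>n. real (Suc (n + n0)) * a (n + n0)) \<longlonglongrightarrow> V * h\<^sup>2 * A"
          by (rule LIMSEQ_ignore_initial_segment[OF alim])
      qed (use V A h in simp)
      moreover have "(of_real (real (Suc (n + n0))) * D (n + n0) u) / complex_of_real (real (Suc (n + n0)) * a (n + n0)) = char (\<sigma> n) u" for n
        unfolding char\<sigma> by (simp del: of_nat_Suc)
      moreover have "complex_of_real (V * h\<^sup>2) * L u / complex_of_real (V * h\<^sup>2 * A) = char \<tau> u"
        unfolding char\<tau> using V h by simp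
      ultimately show ?thesis by simp
    qed
    then have "weak_conv_m \<sigma> \<tau>"
      by (rule levy_continuity[OF \<sigma> \<tau>])
    then have flim: "(\<lambda>n. \<integral>x. f x \<partial>\<sigma> n) \<longlonglongrightarrow> (\<integral>x. f x \<partial>\<tau>)"
      using f0 fk by (intro weak_conv_imp_integral_bdd_continuous_conv[OF \<sigma> \<tau> _ fcont, where B = "real k"]) auto
    have "(\<lambda>n. 2 / h\<^sup>2 * (real (Suc (n + n0)) * a (n + n0) * (\<integral>x. f x \<partial>\<sigma> n))) \<longlonglongrightarrow> 2 / h\<^sup>2 * (V * h\<^sup>2 * A * (\<integral>x. f x \<partial>\<tau>))"
      by (intro tendsto_intros flim LIMSEQ_ignore_initial_segment[OF alim])
    also have "2 / h\<^sup>2 * (V * h\<^sup>2 * A * (\<integral>x. f x \<partial>\<tau>)) = V * (\<integral>z. 2 * c z * f z \<partial>P)"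
    proof -
      have "(\<integral>x. f x \<partial>\<tau>) = (\<integral>z. (2 * c z * f z) / (2 * A) \<partial>P)"
        unfolding int\<tau> by (intro Bochner_Integration.integral_cong) auto
      also have "\<dots> = (\<integral>z. 2 * c z * f z \<partial>P) / (2 * A)"
        by (rule integral_divide_zero)
      finally show ?thesis using h A by simp
    qed
    finally have lhs: "(\<lambda>n. 2 / h\<^sup>2 * (real (Suc (n + n0)) * a (n + n0) * (\<integral>x. f x \<partial>\<sigma> n))) \<longlonglongrightarrow> V * (\<integral>z. 2 * c z * f z \<partial>P)" .
    have rhs: "(\<lambda>n. real (Suc (n + n0)) * (exp (K / real (Suc (n + n0))) - 1)) \<longlonglongrightarrow> K"
      using LIMSEQ_ignore_initial_segment[OF tendsto_scaled_exp_minus_1[OF Nlim, of K]] by simp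
    show "V * (\<integral>z. 2 * c z * f z \<partial>P) \<le> K"
    proof (rule LIMSEQ_le[OF lhs rhs], intro exI allI impI)
      fix n
      let ?n = "n + n0"
      interpret \<rho>: real_distribution "\<rho> ?n" by (rule \<rho>)
      have a: "0 < a ?n" by (rule n0) simp
      have intexp: "integrable (\<rho> ?n) (\<lambda>x. exp (t * x))"
        using mgf\<rho>[of ?n] by (simp add: integrable_iff_bounded)
      have exp: "(\<integral>x. exp (t * x) \<partial>\<rho> ?n) = exp (K / real (Suc ?n))"
        using mgf\<rho>[of ?n] nn_integral_eq_integral[OF intexp] by (simp del: of_nat_Suc)
      have "2 / h\<^sup>2 * (real (Suc ?n) * a ?n * (\<integral>x. f x \<partial>\<sigma> n)) = real (Suc ?n) * (\<integral>x. 2 / h\<^sup>2 * ((1 - cos (h * x)) * f x) \<partial>\<rho> ?n)"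
      proof -
        have "(\<integral>x. f x \<partial>\<sigma> n) = (\<integral>x. (1 - cos (h * x)) * f x / a ?n \<partial>\<rho> ?n)"
          by (subst int\<sigma>) (auto intro!: Bochner_Integration.integral_cong)
        also have "\<dots> = (\<integral>x. (1 - cos (h * x)) * f x \<partial>\<rho> ?n) / a ?n"
          by (rule integral_divide_zero)
        finally show ?thesis using a by (simp del: of_nat_Suc)
      qed
      also have "\<dots> \<le> real (Suc ?n) * (\<integral>x. exp (t * x) - 1 - t * x \<partial>\<rho> ?n)"
      proof (intro mult_left_mono integral_mono)
        fix x
        have "2 / h\<^sup>2 * ((1 - cos (h * x)) * f x) = (2 * c x) * (x\<^sup>2 * f x)"
          unfolding c_def Re_exp_rem_iexp[symmetric] using h by (simp add: power_mult_distrib)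
        also have "\<dots> \<le> 1 * (x\<^sup>2 * f x)"
          using c1[of x] f0[of x] by (intro mult_right_mono) auto
        also have "\<dots> \<le> x\<^sup>2 * (t\<^sup>2 * exp_rem (t * x))"
          by (simp add: f_def mult_left_mono)
        also have "\<dots> = exp (t * x) - 1 - t * x"
          unfolding square_exp_rem[symmetric] by (simp add: power_mult_distrib)
        finally show "2 / h\<^sup>2 * ((1 - cos (h * x)) * f x) \<le> exp (t * x) - 1 - t * x" .
      next
        have bd: "\<bar>1 - cos y\<bar> \<le> 2" for y :: real
          using cos_ge_minus_one[of y] cos_le_one[of y] by (auto simp: abs_le_iff)
        have "\<bar>(1 - cos (h * x)) * f x\<bar> \<le> 2 * real k" for x
          unfolding abs_mult using f0[of x] fk[of x] by (intro mult_mono bd) auto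
        then have "integrable (\<rho> ?n) (\<lambda>x. (1 - cos (h * x)) * f x)"
          by (intro \<rho>.integrable_const_bound[where B = "2 * real k"]) auto
        then show "integrable (\<rho> ?n) (\<lambda>x. 2 / h\<^sup>2 * ((1 - cos (h * x)) * f x))"
          by (rule integrable_mult_right)
        show "integrable (\<rho> ?n) (\<lambda>x. exp (t * x) - 1 - t * x)"
          using intexp int\<rho>[of ?n] by auto
      qed auto
      also have "(\<integral>x. exp (t * x) - 1 - t * x \<partial>\<rho> ?n) = exp (K / real (Suc ?n)) - 1"
        using intexp int\<rho>[of ?n] \<rho>.prob_space by (simp add: exp mean\<rho> del: of_nat_Suc)
      finally show "2 / h\<^sup>2 * (real (Suc ?n) * a ?n * (\<integral>x. f x \<partial>\<sigma> n)) \<le> real (Suc ?n) * (exp (K / real (Suc ?n)) - 1)" .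
    qed
  qed
qed

text \<open>Letting \<open>h\<close> tend to \<open>0\<close> removes the cosine weight, and letting \<open>k\<close> tend to infinity the truncation.\<close>

lemma lk_le_exp_moment:
  assumes P: "real_distribution P" and V: "0 < V" and inf: "infinitely_divisible \<mu>"
    and char: "\<And>u. char \<mu> u = exp (lk_exponent P V u)"
    and mean: "integrable \<mu> (\<lambda>x. x)" "(\<integral>x. x \<partial>\<mu>) = 0"
    and mgf: "exp_moment \<mu> t = ennreal (exp K)" and K: "0 \<le> K"
  shows "(\<integral>\<^sup>+z. ennreal (t\<^sup>2 * exp_rem (t * z)) \<partial>P) \<le> ennreal (K / V)"
proof (rule nn_integral_le_of_tendsto[where C = "\<lambda>_. ennreal (K / V)"
      and u = "\<lambda>k z. ennreal (min (t\<^sup>2 * exp_rem (t * z)) (real k))"])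
  interpret P: real_distribution P by fact
  fix k :: nat
  let ?f = "\<lambda>z. min (real k) (t\<^sup>2 * exp_rem (t * z))"
  show "(\<lambda>z. ennreal (min (t\<^sup>2 * exp_rem (t * z)) (real k))) \<in> borel_measurable P"
    by measurable
  have intf: "integrable P ?f"
    by (intro P.integrable_const_bound[where B = "real k"]) (auto simp: exp_rem_nonneg)
  have "(\<lambda>j. V * (\<integral>z. 2 * cos_rem (1 / real (Suc j) * z) * ?f z \<partial>P))
      \<longlonglongrightarrow> V * (\<integral>z. ?f z \<partial>P)"
  proof (intro tendsto_mult tendsto_const integral_dominated_convergence[where w = ?f])
    show "AE z in P. (\<lambda>j. 2 * cos_rem (1 / real (Suc j) * z) * ?f z) \<longlonglongrightarrow> ?f z"
    proof (rule AE_I2)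
      fix z
      have "(\<lambda>j. 2 * cos_rem (1 / real (Suc j) * z) * ?f z)
          \<longlonglongrightarrow> 2 * cos_rem (0 * z) * ?f z"
        by (intro tendsto_intros LIMSEQ_Suc[OF lim_1_over_n])
      then show "(\<lambda>j. 2 * cos_rem (1 / real (Suc j) * z) * ?f z) \<longlonglongrightarrow> ?f z"
        by simp
    qed
    show "AE z in P. norm (2 * cos_rem (1 / real (Suc j) * z) * ?f z) \<le> ?f z" for j
    proof (rule AE_I2)
      fix z
      let ?r = "cos_rem (1 / real (Suc j) * z)"
      have "0 \<le> ?r" "?r \<le> 1 / 2"
        using Re_exp_rem_iexp_nonneg complex_Re_le_cmod norm_exp_rem_iexp order_trans by blast+
      moreover have "0 \<le> ?f z" by (simp add: exp_rem_nonneg)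
      ultimately have "norm (2 * ?r * ?f z) = 2 * ?r * ?f z" "2 * ?r * ?f z \<le> 1 * ?f z"
        by (simp_all only: real_norm_def abs_of_nonneg mult_nonneg_nonneg zero_le_numeral) (intro mult_right_mono; linarith)
      then show "norm (2 * ?r * ?f z) \<le> ?f z" by simp
    qed
  qed (use intf in auto)
  then have "V * (\<integral>z. ?f z \<partial>P) \<le> K"
  proof (rule LIMSEQ_le_const2, intro exI allI impI)
    fix j
    show "V * (\<integral>z. 2 * cos_rem (1 / real (Suc j) * z) * ?f z \<partial>P) \<le> K"
      by (rule lk_truncated_le[OF P V _ inf char mean mgf K]) simp
  qed
  then have "(\<integral>z. ?f z \<partial>P) \<le> K / V"
    using V by (simp add: field_simps)
  moreover have "(\<integral>\<^sup>+z. ennreal (?f z) \<partial>P) = ennreal (\<integral>z. ?f z \<partial>P)"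
    by (rule nn_integral_eq_integral[OF intf]) (auto simp: exp_rem_nonneg)
  ultimately show "(\<integral>\<^sup>+z. ennreal (min (t\<^sup>2 * exp_rem (t * z)) (real k)) \<partial>P) \<le> ennreal (K / V)"
    by (simp add: min.commute ennreal_leI)
next
  fix z
  show "(\<lambda>k. ennreal (min (t\<^sup>2 * exp_rem (t * z)) (real k))) \<longlonglongrightarrow> ennreal (t\<^sup>2 * exp_rem (t * z))"
    using tendsto_ennrealI[OF tendsto_min_real_of_nat[of "t\<^sup>2 * exp_rem (t * z)"]] .
next
  show "(\<lambda>_ :: nat. ennreal (K / V)) \<longlonglongrightarrow> ennreal (K / V)"
    by simp
qed

section \<open>The size-biased Levy measure and the characteristic function\<close>

lemma nn_integral_H_meas:
  assumes s: "sets \<nu> = sets borel" and f: "f \<in> borel_measurable borel"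
  shows "(\<integral>\<^sup>+x. f x \<partial>H_meas a \<nu>) = ennreal a * f 0 + (\<integral>\<^sup>+x. f x * ennreal (x\<^sup>2) \<partial>\<nu>)"
proof -
  note [measurable_cong] = s
  show ?thesis using f
  proof (induction rule: borel_measurable_induct)
    case (cong f g)
    then show ?case by (simp cong: nn_integral_cong_simp)
  next
    case (set A)
    then show ?case by (simp add: emeasure_H_meas[OF s] mult.commute)
  next
    case (mult u c)
    then show ?case
      by (simp add: nn_integral_cmult mult.assoc distrib_left) (simp add: mult.left_commute)
  next
    case (add u v)
    then show ?case
      by (simp add: nn_integral_add distrib_left distrib_right add_ac)
  next
    case (seq U)
    have m[measurable]: "U i \<in> borel_measurable borel" for i by (rule seq)
    have inc: "incseq (\<lambda>i x. U i x * ennreal (x\<^sup>2))"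
      using \<open>incseq U\<close> by (auto simp: incseq_def le_fun_def intro!: mult_right_mono)
    have "(\<integral>\<^sup>+x. (SUP i. U i) x \<partial>H_meas a \<nu>) = (SUP i. \<integral>\<^sup>+x. U i x \<partial>H_meas a \<nu>)"
      unfolding SUP_apply by (rule nn_integral_monotone_convergence_SUP[OF \<open>incseq U\<close>]) simp
    also have "\<dots> = (SUP i. ennreal a * U i 0 + (\<integral>\<^sup>+x. U i x * ennreal (x\<^sup>2) \<partial>\<nu>))"
      using seq by simp
    also have "\<dots> = (SUP i. ennreal a * U i 0) + (SUP i. (\<integral>\<^sup>+x. U i x * ennreal (x\<^sup>2) \<partial>\<nu>))"
      using \<open>incseq U\<close>
      by (intro ennreal_SUP_add) (auto simp: incseq_def le_fun_def intro!: mult_left_mono mult_right_mono nn_integral_mono)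
    also have "(SUP i. ennreal a * U i 0) = ennreal a * (SUP i. U i) 0"
      by (simp only: SUP_apply SUP_mult_left_ennreal)
    also have "(SUP i. (\<integral>\<^sup>+x. U i x * ennreal (x\<^sup>2) \<partial>\<nu>)) = (\<integral>\<^sup>+x. (SUP i. U i) x * ennreal (x\<^sup>2) \<partial>\<nu>)"
      unfolding SUP_apply SUP_mult_right_ennreal
      by (rule nn_integral_monotone_convergence_SUP[symmetric, OF inc]) simp
    finally show ?case by simp
  qed
qed

text \<open>In the following \<open>P\<close> is the probability law \<open>(a \<delta>\<^sub>0 + x^2 \<nu>(dx))/V\<close>.\<close>

context
  fixes P \<nu> :: "real measure" and a V :: real
  assumes P: "real_distribution P" and \<nu>: "sets \<nu> = sets borel" and a: "0 \<le> a" and V: "0 < V"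
    and P_eq: "P = scale_measure (ennreal (1 / V)) (H_meas a \<nu>)"
begin

interpretation P: real_distribution P by (rule P)

lemma nn_integral_size_bias:
  assumes "f \<in> borel_measurable borel"
  shows "(\<integral>\<^sup>+x. f x \<partial>P) = ennreal (1 / V) * (ennreal a * f 0 + (\<integral>\<^sup>+x. f x * ennreal (x\<^sup>2) \<partial>\<nu>))"
  using assms unfolding P_eq by (subst nn_integral_scale_measure) (simp_all add: nn_integral_H_meas[OF \<nu>])

lemma nn_integral_levy_le:
  assumes "f \<in> borel_measurable borel"
  shows "(\<integral>\<^sup>+x. f x * ennreal (x\<^sup>2) \<partial>\<nu>) \<le> ennreal V * (\<integral>\<^sup>+x. f x \<partial>P)"
proof -
  have "ennreal V * (\<integral>\<^sup>+x. f x \<partial>P) = (ennreal V * ennreal (1 / V)) * (ennreal a * f 0 + (\<integral>\<^sup>+x. f x * ennreal (x\<^sup>2) \<partial>\<nu>))"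
    unfolding nn_integral_size_bias[OF assms] by (simp add: mult.assoc)
  also have "ennreal V * ennreal (1 / V) = 1"
    using V by (simp add: ennreal_mult[symmetric])
  finally show ?thesis by simp
qed

lemma integral_size_bias:
  fixes f :: "real \<Rightarrow> 'b :: {banach, second_countable_topology}"
  assumes "integrable P f"
  shows "integrable \<nu> (\<lambda>x. x\<^sup>2 *\<^sub>R f x)"
    and "V *\<^sub>R (\<integral>x. f x \<partial>P) = a *\<^sub>R f 0 + (\<integral>x. x\<^sup>2 *\<^sub>R f x \<partial>\<nu>)"
proof -
  note [measurable_cong] = \<nu>
  have int: "integrable \<nu> (\<lambda>x. x\<^sup>2 *\<^sub>R g x)" if g: "integrable P g" for g :: "real \<Rightarrow> 'b"
  proof -
    have [measurable]: "g \<in> borel_measurable borel" using borel_measurable_integrable[OF g] by simp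
    have "(\<integral>\<^sup>+x. ennreal (norm (x\<^sup>2 *\<^sub>R g x)) \<partial>\<nu>) = (\<integral>\<^sup>+x. ennreal (norm (g x)) * ennreal (x\<^sup>2) \<partial>\<nu>)"
      by (intro nn_integral_cong) (simp add: ennreal_mult mult.commute)
    also have "\<dots> \<le> ennreal V * (\<integral>\<^sup>+x. ennreal (norm (g x)) \<partial>P)"
      by (rule nn_integral_levy_le) simp
    also have "\<dots> < \<infinity>"
      using g by (simp add: integrable_iff_bounded ennreal_mult_less_top)
    finally show ?thesis by (intro integrableI_bounded) auto
  qed
  show "integrable \<nu> (\<lambda>x. x\<^sup>2 *\<^sub>R f x)" by (rule int[OF assms])
  show "V *\<^sub>R (\<integral>x. f x \<partial>P) = a *\<^sub>R f 0 + (\<integral>x. x\<^sup>2 *\<^sub>R f x \<partial>\<nu>)"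
    using assms
  proof (induction rule: integrable_induct)
    case (base A c)
    let ?I = "\<integral>\<^sup>+x. indicator A x * ennreal (x\<^sup>2) \<partial>\<nu>" and ?J = "\<integral>x. x\<^sup>2 * indicator A x \<partial>\<nu>"
    have [measurable]: "A \<in> sets borel" using base by simp
    have intA: "integrable P (indicator A :: real \<Rightarrow> real)"
      using base by (intro integrable_real_indicator) auto
    have fin: "?I < \<infinity>"
      using nn_integral_levy_le[of "indicator A"] base
      by (auto simp: ennreal_mult_less_top intro: le_less_trans)
    have i2: "integrable \<nu> (\<lambda>x. x\<^sup>2 * indicator A x)"
    proof (rule integrableI_bounded)
      have "(\<integral>\<^sup>+x. ennreal (norm (x\<^sup>2 * indicator A x)) \<partial>\<nu>) = ?I"
        by (intro nn_integral_cong) (simp split: split_indicator)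
      then show "(\<integral>\<^sup>+x. ennreal (norm (x\<^sup>2 * indicator A x)) \<partial>\<nu>) < \<infinity>" using fin by simp
    qed measurable
    have "ennreal V * emeasure P A = ennreal V * (ennreal (1 / V) * (ennreal a * indicator A 0 + ?I))"
      by (subst nn_integral_size_bias[of "indicator A", symmetric]) auto
    also have "\<dots> = ennreal a * indicator A 0 + ?I"
      using V by (simp add: mult.assoc[symmetric] ennreal_mult[symmetric])
    also have "?I = (\<integral>\<^sup>+x. ennreal (x\<^sup>2 * indicator A x) \<partial>\<nu>)"
      by (intro nn_integral_cong) (simp split: split_indicator)
    also have "\<dots> = ennreal ?J"
      by (rule nn_integral_eq_integral[OF i2]) (auto split: split_indicator)
    also have "ennreal a * indicator A 0 = ennreal (a * indicator A 0)"
      by (simp split: split_indicator)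
    finally have "ennreal (V * measure P A) = ennreal (a * indicator A 0 + ?J)"
      using V a by (simp add: P.emeasure_eq_measure ennreal_mult ennreal_plus[symmetric] split: split_indicator)
    moreover have "0 \<le> ?J"
      by (intro Bochner_Integration.integral_nonneg) simp
    ultimately have eq: "V * measure P A = a * indicator A 0 + ?J"
      using V a by (subst (asm) ennreal_inj) (auto split: split_indicator)
    have "V *\<^sub>R (\<integral>x. indicator A x *\<^sub>R c \<partial>P) = (V * measure P A) *\<^sub>R c"
      using intA base by simp
    also have "\<dots> = a *\<^sub>R (indicator A 0 *\<^sub>R c) + (\<integral>x. (x\<^sup>2 * indicator A x) *\<^sub>R c \<partial>\<nu>)"
      using i2 by (simp add: eq scaleR_add_left)
    finally show ?case by simp
  next
    case (add f g)
    then show ?case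
      using add.IH add.hyps int[OF add.hyps(1)] int[OF add.hyps(2)] by (simp add: scaleR_add_right)
  next
    case (lim f s)
    have [measurable]: "f \<in> borel_measurable borel" "\<And>i. s i \<in> borel_measurable borel"
      using borel_measurable_integrable[OF lim.hyps(4)] borel_measurable_integrable[OF lim.hyps(1)] by simp_all
    have "(\<lambda>i. \<integral>x. s i x \<partial>P) \<longlonglongrightarrow> (\<integral>x. f x \<partial>P)"
      by (rule integral_dominated_convergence[where w = "\<lambda>x. 2 * norm (f x)"])
        (use lim.hyps in auto)
    then have "(\<lambda>i. V *\<^sub>R (\<integral>x. s i x \<partial>P)) \<longlonglongrightarrow> V *\<^sub>R (\<integral>x. f x \<partial>P)"
      by (intro tendsto_intros)
    moreover have "(\<lambda>i. \<integral>x. x\<^sup>2 *\<^sub>R s i x \<partial>\<nu>) \<longlonglongrightarrow> (\<integral>x. x\<^sup>2 *\<^sub>R f x \<partial>\<nu>)"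
    proof (rule integral_dominated_convergence[where w = "\<lambda>x. 2 * norm (x\<^sup>2 *\<^sub>R f x)"])
      show "integrable \<nu> (\<lambda>x. 2 * norm (x\<^sup>2 *\<^sub>R f x))"
        by (intro integrable_mult_right integrable_norm int lim.hyps)
      show "AE x in \<nu>. (\<lambda>i. x\<^sup>2 *\<^sub>R s i x) \<longlonglongrightarrow> x\<^sup>2 *\<^sub>R f x"
        using lim.hyps(2) by (intro AE_I2 tendsto_intros) auto
      show "AE x in \<nu>. norm (x\<^sup>2 *\<^sub>R s i x) \<le> 2 * norm (x\<^sup>2 *\<^sub>R f x)" for i
      proof (rule AE_I2)
        fix x assume "x \<in> space \<nu>"
        have "x\<^sup>2 * norm (s i x) \<le> x\<^sup>2 * (2 * norm (f x))"
          by (intro mult_left_mono lim.hyps(3)) auto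
        then show "norm (x\<^sup>2 *\<^sub>R s i x) \<le> 2 * norm (x\<^sup>2 *\<^sub>R f x)"
          by (simp add: mult.left_commute)
      qed
    qed auto
    then have "(\<lambda>i. a *\<^sub>R s i 0 + (\<integral>x. x\<^sup>2 *\<^sub>R s i x \<partial>\<nu>)) \<longlonglongrightarrow> a *\<^sub>R f 0 + (\<integral>x. x\<^sup>2 *\<^sub>R f x \<partial>\<nu>)"
      using lim.hyps(2)[of 0] by (intro tendsto_intros) auto
    ultimately show ?case
      using lim.IH LIMSEQ_unique by simp
  qed
qed

text \<open>The exponent compensated by \<open>i u x\<close> differs from the one compensated by \<open>i u x\<close> on \<open>|x| \<le> 1\<close> only in a
  drift, because \<open>x\<close> is \<open>\<nu>\<close>-integrable outside the unit interval when \<open>x^2\<close> is.\<close>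

lemma char_levy_triplet:
  assumes trip: "has_levy_triplet \<mu> b a \<nu>"
  obtains c where "\<And>u. char \<mu> u = exp (\<i> * complex_of_real (c * u) + lk_exponent P V u)"
proof
  note [measurable_cong] = \<nu>
  let ?big = "\<lambda>x :: real. if \<bar>x\<bar> \<le> 1 then 0 else x"
  define c where "c = b + (\<integral>x. ?big x \<partial>\<nu>)"
  have int1: "integrable \<nu> (\<lambda>x. ?big x)"
  proof (rule Bochner_Integration.integrable_bound)
    show "integrable \<nu> (\<lambda>x. x\<^sup>2 *\<^sub>R (1 :: real))"
      by (rule integral_size_bias(1)) simp
    show "AE x in \<nu>. norm (?big x) \<le> norm (x\<^sup>2 *\<^sub>R (1 :: real))"
    proof (rule AE_I2)
      fix x :: real
      show "norm (?big x) \<le> norm (x\<^sup>2 *\<^sub>R (1 :: real))"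
        using self_le_power[of "\<bar>x\<bar>" 2] by auto
    qed
  qed measurable
  fix u :: real
  let ?F = "CLINT x|\<nu>. iexp (u * x) - 1 - (if \<bar>x\<bar> \<le> 1 then \<i> * of_real (u * x) else 0)"
  let ?G = "\<lambda>z. lk_kernel u z"
  have intG: "integrable P ?G"
    by (intro integrable_mult_right P.integrable_exp_rem_iexp) simp
  have i\<nu>: "integrable \<nu> (\<lambda>x. x\<^sup>2 *\<^sub>R ?G x)" by (rule integral_size_bias(1)[OF intG])
  have "?F = (CLINT x|\<nu>. x\<^sup>2 *\<^sub>R ?G x + \<i> * complex_of_real u * complex_of_real (?big x))"
  proof (intro Bochner_Integration.integral_cong refl)
    fix x
    have "x\<^sup>2 *\<^sub>R ?G x = (\<i> * complex_of_real (u * x))\<^sup>2 * exp_rem (\<i> * complex_of_real (u * x))"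
      by (simp add: scaleR_conv_of_real power_mult_distrib)
    then have "x\<^sup>2 *\<^sub>R ?G x = iexp (u * x) - 1 - \<i> * complex_of_real (u * x)"
      unfolding square_exp_rem .
    then show "iexp (u * x) - 1 - (if \<bar>x\<bar> \<le> 1 then \<i> * of_real (u * x) else 0)
        = x\<^sup>2 *\<^sub>R ?G x + \<i> * complex_of_real u * complex_of_real (?big x)"
      by simp
  qed
  also have "\<dots> = (CLINT x|\<nu>. x\<^sup>2 *\<^sub>R ?G x) + \<i> * complex_of_real u * complex_of_real (c - b)"
  proof -
    have "(CLINT x|\<nu>. complex_of_real (?big x)) = complex_of_real (c - b)"
      unfolding c_def by (simp only: integral_complex_of_real) simp
    moreover have "integrable \<nu> (\<lambda>x. complex_of_real (?big x))"
      by (rule integrable_of_real[OF int1])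
    ultimately show ?thesis
      by (subst Bochner_Integration.integral_add[OF i\<nu>]) (simp_all only: integrable_mult_right integral_mult_right_zero)
  qed
  finally have eq: "?F = (CLINT x|\<nu>. x\<^sup>2 *\<^sub>R ?G x) + \<i> * complex_of_real u * complex_of_real (c - b)" .
  have "lk_exponent P V u = V *\<^sub>R (CLINT z|P. ?G z)"
    by (simp add: lk_exponent_def scaleR_conv_of_real)
  also have "\<dots> = a *\<^sub>R ?G 0 + (CLINT x|\<nu>. x\<^sup>2 *\<^sub>R ?G x)"
    by (rule integral_size_bias(2)[OF intG])
  also have "a *\<^sub>R ?G 0 = - of_real (a * u\<^sup>2 / 2)"
    by (simp add: scaleR_conv_of_real power_mult_distrib)
  finally have lk: "lk_exponent P V u = - of_real (a * u\<^sup>2 / 2) + (CLINT x|\<nu>. x\<^sup>2 *\<^sub>R ?G x)" .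
  have "char \<mu> u = exp (\<i> * of_real (b * u) - of_real (a * u\<^sup>2 / 2) + ?F)"
    using trip unfolding has_levy_triplet_def by blast
  also have "\<dots> = exp (\<i> * complex_of_real (c * u) + lk_exponent P V u)"
    unfolding eq lk by (simp add: algebra_simps)
  finally show "char \<mu> u = exp (\<i> * complex_of_real (c * u) + lk_exponent P V u)" .
qed

lemma integrable_moments_size_bias:
  assumes "(\<integral>\<^sup>+x\<in>{x. 1 < \<bar>x\<bar>}. ennreal (\<bar>x\<bar> ^ 5) \<partial>\<nu>) < \<infinity>" and j: "j \<le> 3"
  shows "integrable P (\<lambda>x. x ^ j)"
proof -
  note [measurable_cong] = \<nu>
  have one: "(\<integral>\<^sup>+x. ennreal (x\<^sup>2) \<partial>\<nu>) < \<infinity>"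
    using nn_integral_levy_le[of "\<lambda>_. 1"] P.emeasure_space_1 by (auto intro: le_less_trans)
  have "(\<integral>\<^sup>+x. ennreal (\<bar>x\<bar> ^ 3) * ennreal (x\<^sup>2) \<partial>\<nu>) \<le> (\<integral>\<^sup>+x. ennreal (x\<^sup>2) + ennreal (\<bar>x\<bar> ^ 5) * indicator {x. 1 < \<bar>x\<bar>} x \<partial>\<nu>)"
  proof (rule nn_integral_mono)
    fix x :: real
    have *: "\<bar>x\<bar> ^ 3 * x\<^sup>2 = \<bar>x\<bar> ^ 5"
      by (subst power2_abs[symmetric]) (simp only: power_add[symmetric], simp)
    show "ennreal (\<bar>x\<bar> ^ 3) * ennreal (x\<^sup>2) \<le> ennreal (x\<^sup>2) + ennreal (\<bar>x\<bar> ^ 5) * indicator {x. 1 < \<bar>x\<bar>} x"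
    proof (cases "1 < \<bar>x\<bar>")
      case True
      then show ?thesis by (simp add: ennreal_mult[symmetric] *)
    next
      case False
      then have "\<bar>x\<bar> ^ 3 * x\<^sup>2 \<le> 1 * x\<^sup>2"
        by (intro mult_right_mono power_le_one) auto
      then show ?thesis using False by (simp add: ennreal_mult[symmetric] ennreal_leI)
    qed
  qed
  also have "\<dots> = (\<integral>\<^sup>+x. ennreal (x\<^sup>2) \<partial>\<nu>) + (\<integral>\<^sup>+x\<in>{x. 1 < \<bar>x\<bar>}. ennreal (\<bar>x\<bar> ^ 5) \<partial>\<nu>)"
    by (rule nn_integral_add) measurable
  also have "\<dots> < \<infinity>" using one assms(1) by simp
  finally have "(\<integral>\<^sup>+x. ennreal (\<bar>x\<bar> ^ 3) \<partial>P) < \<infinity>"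
    by (subst nn_integral_size_bias) (auto simp: ennreal_mult_less_top)
  then have "integrable P (\<lambda>x. \<bar>x\<bar> ^ 3)"
    by (intro integrableI_bounded) auto
  then have "integrable P (\<lambda>x. 1 + \<bar>x\<bar> ^ 3)" by simp
  then show ?thesis
  proof (rule Bochner_Integration.integrable_bound)
    show "AE x in P. norm (x ^ j) \<le> norm (1 + \<bar>x\<bar> ^ 3)"
    proof (rule AE_I2)
      fix x :: real
      have "\<bar>x\<bar> ^ j \<le> 1 + \<bar>x\<bar> ^ 3"
      proof (cases "\<bar>x\<bar> \<le> 1")
        case True
        then show ?thesis using power_le_one[of "\<bar>x\<bar>" j] by (simp add: add_increasing2)
      next
        case False
        then have "1 \<le> \<bar>x\<bar>" by simp
        from power_increasing[OF j this] show ?thesis by simp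
      qed
      then show "norm (x ^ j) \<le> norm (1 + \<bar>x\<bar> ^ 3)" by (simp add: power_abs)
    qed
  qed measurable
qed

end

section \<open>Derivatives of the exponent and cumulants\<close>

text \<open>The derivative in \<open>u\<close> of \<open>(e^(i u z) - 1 - i u z)/z^2\<close>.\<close>

definition lk_kernel_deriv :: "real \<Rightarrow> real \<Rightarrow> complex" where
  "lk_kernel_deriv u z = (if z = 0 then - complex_of_real u else \<i> * (iexp (u * z) - 1) / complex_of_real z)"

lemma norm_lk_kernel_deriv_le: "norm (lk_kernel_deriv u z) \<le> \<bar>u\<bar>"
proof (cases "z = 0")
  case False
  have "cmod (iexp (u * z) - 1) \<le> \<bar>u * z\<bar>"
    using iexp_approx1[of "u * z" 0] by simp
  with False show ?thesis
    by (simp add: lk_kernel_deriv_def norm_divide norm_mult divide_simps abs_mult del: of_real_mult)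
qed (simp add: lk_kernel_deriv_def)

lemma borel_measurable_lk_kernel_deriv [measurable]: "lk_kernel_deriv u \<in> borel_measurable borel"
  unfolding lk_kernel_deriv_def by measurable

lemma has_vector_derivative_lk_kernel:
  "((\<lambda>u. lk_kernel u z) has_vector_derivative lk_kernel_deriv u z) (at u)"
proof (cases "z = 0")
  case True
  have "((\<lambda>u. - complex_of_real (u\<^sup>2) / 2) has_vector_derivative - complex_of_real u) (at u)"
    by (auto intro!: derivative_eq_intros simp: has_vector_derivative_complex_iff)
  then show ?thesis
    by (simp add: True lk_kernel_deriv_def power_mult_distrib)
next
  case False
  have eq: "lk_kernel u z
     = (iexp (u * z) - 1 - complex_of_real u * (\<i> * complex_of_real z)) * (1 / complex_of_real (z\<^sup>2))" for u
  proof -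
    have "complex_of_real (z\<^sup>2) * (lk_kernel u z)
        = (\<i> * complex_of_real (u * z))\<^sup>2 * exp_rem (\<i> * complex_of_real (u * z))"
      by (simp add: power_mult_distrib)
    also have "\<dots> = iexp (u * z) - 1 - \<i> * complex_of_real (u * z)"
      by (rule square_exp_rem)
    finally show ?thesis using False by (simp add: field_simps)
  qed
  have "((\<lambda>u. (iexp (u * z) - 1 - complex_of_real u * (\<i> * complex_of_real z)) * (1 / complex_of_real (z\<^sup>2)))
      has_vector_derivative (\<i> * complex_of_real z * iexp (u * z) - 0 - complex_of_real 1 * (\<i> * complex_of_real z)) * (1 / complex_of_real (z\<^sup>2))) (at u)"
    by (intro has_vector_derivative_mult_left has_vector_derivative_diff has_vector_derivative_iexp_mult
        has_vector_derivative_const has_vector_derivative_of_real DERIV_ident)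
  moreover have "(\<i> * complex_of_real z * iexp (u * z) - 0 - complex_of_real 1 * (\<i> * complex_of_real z)) * (1 / complex_of_real (z\<^sup>2)) = lk_kernel_deriv u z"
    using False by (simp add: lk_kernel_deriv_def field_simps power2_eq_square)
  ultimately show ?thesis unfolding eq by simp
qed

lemma has_vector_derivative_lk_kernel_deriv:
  "((\<lambda>u. lk_kernel_deriv u z) has_vector_derivative - iexp (u * z)) (at u)"
proof (cases "z = 0")
  case True
  have "((\<lambda>u. - complex_of_real u) has_vector_derivative - 1) (at u)"
    by (auto intro!: derivative_eq_intros simp: has_vector_derivative_complex_iff)
  then show ?thesis by (simp add: True lk_kernel_deriv_def)
next
  case False
  have "((\<lambda>u. (iexp (u * z) - 1) * (\<i> / complex_of_real z)) has_vector_derivative (\<i> * complex_of_real z * iexp (u * z) - 0) * (\<i> / complex_of_real z)) (at u)"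
    by (intro has_vector_derivative_mult_left has_vector_derivative_diff has_vector_derivative_iexp_mult has_vector_derivative_const)
  moreover have "(\<lambda>u. lk_kernel_deriv u z) = (\<lambda>u. (iexp (u * z) - 1) * (\<i> / complex_of_real z))"
    using False by (auto simp: lk_kernel_deriv_def)
  moreover have "(\<i> * complex_of_real z * iexp (u * z) - 0) * (\<i> / complex_of_real z) = - iexp (u * z)"
    using False by (simp add: field_simps)
  ultimately show ?thesis by simp
qed

text \<open>The successive derivatives of the exponent. Differentiating \<open>(e^(i u z) - 1 - i u z)/z^2\<close> twice in \<open>u\<close> gives
  \<open>- e^(i u z)\<close>, so from order two on they are \<open>-V\<close> times the derivatives of the characteristic function of \<open>P\<close>.\<close>

fun lk_deriv :: "real measure \<Rightarrow> real \<Rightarrow> nat \<Rightarrow> real \<Rightarrow> complex" where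
  "lk_deriv P V 0 u = lk_exponent P V u"
| "lk_deriv P V (Suc 0) u = complex_of_real V * (CLINT z|P. lk_kernel_deriv u z)"
| "lk_deriv P V (Suc (Suc k)) u = - (complex_of_real V * (CLINT z|P. (\<i> * complex_of_real z) ^ k * iexp (u * z)))"

lemma (in real_distribution) has_vector_derivative_lk_deriv:
  assumes mom: "\<And>j. j \<le> n \<Longrightarrow> integrable M (\<lambda>x. x ^ j)" and k: "k < n + 2"
  shows "(lk_deriv M V k has_vector_derivative lk_deriv M V (Suc k) u) (at u)"
proof -
  consider "k = 0" | "k = 1" | j where "k = Suc (Suc j)" "j < n"
    using k by (metis One_nat_def Suc_less_eq add_2_eq_Suc' not0_implies_Suc)
  then show ?thesis
  proof cases
    case 1
    have "((\<lambda>u. CLINT z|M. lk_kernel u z) has_vector_derivative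
        (CLINT z|M. lk_kernel_deriv u z)) (at u)"
    proof (rule has_vector_derivative_integral[where w = "\<lambda>_. \<bar>u\<bar> + 1"])
      show "integrable M (\<lambda>z. lk_kernel u z)" for u
        by (intro integrable_mult_right integrable_exp_rem_iexp) simp
      show "norm (lk_kernel_deriv v z) \<le> \<bar>u\<bar> + 1" if "\<bar>v - u\<bar> < 1" for v z
        using norm_lk_kernel_deriv_le[of v z] that by linarith
    qed (rule has_vector_derivative_lk_kernel | simp)+
    moreover have "lk_deriv M V 0 = (\<lambda>u. complex_of_real V * (CLINT z|M. lk_kernel u z))"
      by (simp add: fun_eq_iff lk_exponent_def)
    ultimately show ?thesis
      unfolding 1 by (simp only: lk_deriv.simps(2) has_vector_derivative_mult_right)
  next
    case 2
    have "((\<lambda>u. CLINT z|M. lk_kernel_deriv u z) has_vector_derivative (CLINT z|M. - iexp (u * z))) (at u)"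
    proof (rule has_vector_derivative_integral[where w = "\<lambda>_. 1"])
      show "integrable M (lk_kernel_deriv u)" for u
        using norm_lk_kernel_deriv_le by (intro integrable_const_bound[where B = "\<bar>u\<bar>"]) auto
    qed (rule has_vector_derivative_lk_kernel_deriv | simp)+
    moreover have "lk_deriv M V (Suc 0) = (\<lambda>u. complex_of_real V * (CLINT z|M. lk_kernel_deriv u z))"
      by (simp add: fun_eq_iff)
    ultimately show ?thesis
      using has_vector_derivative_mult_right[of _ _ _ "complex_of_real V"] unfolding 2 by fastforce
  next
    case 3
    have "((\<lambda>u. - (complex_of_real V * (CLINT z|M. (\<i> * complex_of_real z) ^ j * iexp (u * z)))) has_vector_derivative
       - (complex_of_real V * (CLINT z|M. (\<i> * complex_of_real z) ^ Suc j * iexp (u * z)))) (at u)"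
      using 3 by (intro has_vector_derivative_minus has_vector_derivative_mult_right has_vector_derivative_moment_char mom) auto
    moreover have "lk_deriv M V (Suc (Suc j)) = (\<lambda>u. - (complex_of_real V * (CLINT z|M. (\<i> * complex_of_real z) ^ j * iexp (u * z))))"
      by (simp add: fun_eq_iff)
    ultimately show ?thesis
      unfolding 3 by (simp only: lk_deriv.simps(3))
  qed
qed

lemma iterated_vector_derivative_eq:
  assumes S: "open S" and f: "\<And>u. u \<in> S \<Longrightarrow> f u = F 0 u"
    and F: "\<And>k u. k < n \<Longrightarrow> (F k has_vector_derivative F (Suc k) u) (at u)"
  shows "k \<le> n \<Longrightarrow> u \<in> S \<Longrightarrow> ((\<lambda>f u. vector_derivative f (at u)) ^^ k) f u = F k u"
proof (induction k arbitrary: u)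
  case 0
  then show ?case by (simp add: f)
next
  case (Suc k)
  have "(((\<lambda>f u. vector_derivative f (at u)) ^^ k) f has_vector_derivative F (Suc k) u) (at u)"
    by (rule has_vector_derivative_transform_within_open[OF F S \<open>u \<in> S\<close>]) (use Suc in auto)
  then show ?case
    by (simp add: vector_derivative_at)
qed

text \<open>The derivative of the characteristic function at \<open>0\<close> is \<open>i\<close> times the mean on the one hand and \<open>i c\<close> on
  the other.\<close>

lemma (in real_distribution) lk_drift_eq_0:
  assumes \<mu>: "real_distribution \<mu>"
    and char: "\<And>u. char \<mu> u = exp (\<i> * complex_of_real (c * u) + lk_exponent M V u)"
    and mean: "integrable \<mu> (\<lambda>x. x)" "(\<integral>x. x \<partial>\<mu>) = 0"
  shows "c = 0"
proof -
  interpret \<mu>: real_distribution \<mu> by fact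
  have d1: "(char \<mu> has_vector_derivative 0) (at 0)"
    using \<mu>.has_vector_derivative_moment_char[of 0 0] mean by (simp add: char_def[abs_def])
  have "(lk_exponent M V has_vector_derivative 0) (at 0)"
  proof -
    have "lk_deriv M V 0 = lk_exponent M V" "lk_kernel_deriv 0 = (\<lambda>_. 0)"
      by (auto simp: lk_kernel_deriv_def fun_eq_iff)
    then show ?thesis
      using has_vector_derivative_lk_deriv[of 0 0 V 0] by simp
  qed
  then have "((\<lambda>u. \<i> * complex_of_real (c * u) + lk_exponent M V u) has_vector_derivative (\<i> * complex_of_real (c * 1) + 0)) (at 0)"
    by (intro has_vector_derivative_add has_vector_derivative_mult_right has_vector_derivative_of_real) (auto intro!: derivative_eq_intros)
  from field_vector_diff_chain_at[OF this, of exp 1]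
  have "(char \<mu> has_vector_derivative \<i> * complex_of_real c) (at 0)"
    using DERIV_exp[of "0 :: complex"] by (simp add: comp_def char[abs_def])
  with d1 have "\<i> * complex_of_real c = 0"
    using vector_derivative_unique_at by blast
  then show ?thesis by simp
qed

text \<open>Near \<open>0\<close> the imaginary part of the exponent is less than \<open>\<pi>\<close> in modulus, so the principal logarithm
  of the characteristic function is the exponent itself, and its derivatives at \<open>0\<close> are moments of \<open>P\<close>.\<close>

lemma (in real_distribution) cumulant_eq_moment:
  assumes char: "\<And>u. char (distr N borel X) u = exp (lk_exponent M V u)"
    and mom: "\<And>j. j \<le> n \<Longrightarrow> integrable M (\<lambda>x. x ^ j)"
  shows "cumulant N X (n + 2) = V * (\<integral>x. x ^ n \<partial>M)"
proof -
  define S where "S = {u. \<bar>Im (lk_exponent M V u)\<bar> < pi}"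
  have "open S"
    unfolding S_def
    by (intro open_Collect_less continuous_at_imp_continuous_on ballI continuous_intros isCont_lk_exponent)
  moreover have "Ln (char (distr N borel X) u) = lk_deriv M V 0 u" if "u \<in> S" for u
    using that by (auto simp: S_def char abs_less_iff intro!: Ln_exp)
  moreover have "0 \<in> S" by (simp add: S_def)
  ultimately have "((\<lambda>f u. vector_derivative f (at u)) ^^ (n + 2)) (\<lambda>u::real. Ln (char (distr N borel X) u)) 0 = lk_deriv M V (n + 2) 0"
    using has_vector_derivative_lk_deriv[OF mom]
    by (intro iterated_vector_derivative_eq[where n = "n + 2" and S = S]) auto
  also have "\<dots> = - (complex_of_real V * (CLINT x|M. \<i> ^ n * complex_of_real (x ^ n)))"
    by (simp add: power_mult_distrib)
  also have "(CLINT x|M. \<i> ^ n * complex_of_real (x ^ n)) = \<i> ^ n * complex_of_real (\<integral>x. x ^ n \<partial>M)"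
    by (simp only: integral_mult_right_zero integral_complex_of_real)
  finally have "cumulant N X (n + 2) = Re ((- \<i>) ^ (n + 2) * (- (complex_of_real V * (\<i> ^ n * complex_of_real (\<integral>x. x ^ n \<partial>M)))))"
    unfolding cumulant_def by simp
  also have "(- \<i>) ^ (n + 2) * (- (complex_of_real V * (\<i> ^ n * complex_of_real (\<integral>x. x ^ n \<partial>M))))
     = ((- \<i>) * \<i>) ^ n * complex_of_real (V * (\<integral>x. x ^ n \<partial>M))"
    unfolding power_mult_distrib power_add by (simp add: power2_eq_square)
  finally show ?thesis by simp
qed

section \<open>Products with a Beta(1,2) variable\<close>

abbreviation beta_density :: "real \<Rightarrow> ennreal" where
  "beta_density b \<equiv> ennreal (2 * (1 - b)) * indicator {0<..<1} b"

lemma mgf_beta_product: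
  assumes N: "prob_space N" and B: "distributed N lborel B beta_density"
    and indep: "prob_space.indep_var N borel B borel Z"
  shows "mgf N (\<lambda>\<omega>. B \<omega> * Z \<omega>) t = (\<integral>\<^sup>+z. ennreal (2 * exp_rem (t * z)) \<partial>distr N borel Z)"
proof -
  interpret N: prob_space N by fact
  have [measurable]: "B \<in> borel_measurable N" "Z \<in> borel_measurable N"
    using N.indep_var_rv1[OF indep] N.indep_var_rv2[OF indep] by auto
  interpret PB: prob_space "distr N borel B" by (rule N.prob_space_distr) simp
  interpret PZ: prob_space "distr N borel Z" by (rule N.prob_space_distr) simp
  interpret BZ: pair_sigma_finite "distr N borel B" "distr N borel Z" ..
  have dB: "distr N borel B = density lborel (\<lambda>b. ennreal (2 * (1 - b)) * indicator {0<..<1} b)"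
  proof -
    have "distr N borel B = distr N lborel B" by (rule distr_cong) simp_all
    then show ?thesis by (simp only: distributed_distr_eq_density[OF B])
  qed
  have joint: "distr N borel B \<Otimes>\<^sub>M distr N borel Z = distr N (borel \<Otimes>\<^sub>M borel) (\<lambda>\<omega>. (B \<omega>, Z \<omega>))"
    using indep unfolding N.indep_var_distribution_eq by blast
  have "mgf N (\<lambda>\<omega>. B \<omega> * Z \<omega>) t = (\<integral>\<^sup>+p. ennreal (exp (t * (fst p * snd p))) \<partial>distr N (borel \<Otimes>\<^sub>M borel) (\<lambda>\<omega>. (B \<omega>, Z \<omega>)))"
    unfolding mgf_def by (subst nn_integral_distr) auto
  also have "\<dots> = (\<integral>\<^sup>+z. \<integral>\<^sup>+b. ennreal (exp (t * (b * z))) \<partial>distr N borel B \<partial>distr N borel Z)"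
    unfolding joint[symmetric] by (subst BZ.nn_integral_snd[symmetric]) auto
  also have "\<dots> = (\<integral>\<^sup>+z. ennreal (2 * exp_rem (t * z)) \<partial>distr N borel Z)"
  proof (intro nn_integral_cong)
    fix z
    have "(\<integral>\<^sup>+b. ennreal (exp (t * (b * z))) \<partial>distr N borel B)
       = (\<integral>\<^sup>+b. (ennreal (2 * (1 - b)) * indicator {0<..<1} b) * ennreal (exp (t * (b * z))) \<partial>lborel)"
      unfolding dB by (rule nn_integral_density) measurable
    also have "\<dots> = ennreal (2 * exp_rem (t * z))"
      unfolding nn_integral_beta_exp[symmetric] by (intro nn_integral_cong) (simp add: mult_ac)
    finally show "(\<integral>\<^sup>+b. ennreal (exp (t * (b * z))) \<partial>distr N borel B) = ennreal (2 * exp_rem (t * z))" .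
  qed
  finally show ?thesis .
qed

lemma beta_moment:
  assumes B: "distributed N lborel B beta_density"
  shows "integrable N (\<lambda>\<omega>. B \<omega> ^ j)" "(\<integral>\<omega>. B \<omega> ^ j \<partial>N) = 2 / (real (j + 1) * real (j + 2))"
proof -
  define f :: "real \<Rightarrow> real" where "f b = 2 * (1 - b) * indicator {0<..<1} b" for b
  have f0: "0 \<le> f b" for b by (simp add: f_def split: split_indicator)
  have eq: "(\<lambda>b. ennreal (2 * (1 - b)) * indicator {0<..<1} b) = (\<lambda>b. ennreal (f b))"
    by (auto simp: f_def fun_eq_iff split: split_indicator)
  define F where "F b = 2 * (b ^ (j + 1) / real (j + 1) - b ^ (j + 2) / real (j + 2))" for b :: real
  have "has_bochner_integral lborel (\<lambda>b. (2 * (1 - b) * b ^ j) * indicator {0..1} b) (F 1 - F 0)"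
  proof (rule has_bochner_integral_FTC_Icc_nonneg)
    fix b :: real
    have pow: "((\<lambda>b. b ^ Suc k / real (Suc k)) has_real_derivative b ^ k) (at b)" for k
      by (rule DERIV_cong[OF DERIV_cdivide[OF DERIV_pow]]) (simp del: of_nat_Suc)
    show "(F has_real_derivative 2 * (1 - b) * b ^ j) (at b)"
      using DERIV_cmult[OF DERIV_diff[OF pow[of j] pow[of "Suc j"]], of 2]
      by (simp add: F_def[abs_def] algebra_simps)
  qed auto
  moreover have "AE b in lborel. (2 * (1 - b) * b ^ j) * indicator {0..1} b = f b * b ^ j"
    using AE_lborel_singleton[of "0::real"] AE_lborel_singleton[of "1::real"]
    by eventually_elim (auto simp: f_def indicator_def)
  ultimately have *: "has_bochner_integral lborel (\<lambda>b. f b * b ^ j) (F 1 - F 0)"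
    by (subst has_bochner_integral_cong_AE[symmetric]) (auto simp: f_def)
  have F: "F 1 - F 0 = 2 / (real (j + 1) * real (j + 2))"
    by (simp add: F_def field_simps)
  show "integrable N (\<lambda>\<omega>. B \<omega> ^ j)"
    using distributed_integrable[OF B[unfolded eq], of "\<lambda>b. b ^ j"] * f0 by (auto dest: integrable.intros)
  show "(\<integral>\<omega>. B \<omega> ^ j \<partial>N) = 2 / (real (j + 1) * real (j + 2))"
    using distributed_integral[OF B[unfolded eq], of "\<lambda>b. b ^ j"] has_bochner_integral_integral_eq[OF *] f0 F by simp
qed

lemma beta_product_moment:
  assumes N: "prob_space N" and B: "distributed N lborel B beta_density"
    and indep: "prob_space.indep_var N borel B borel Z" and int: "integrable (distr N borel Z) (\<lambda>z. z ^ j)"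
  shows "integrable N (\<lambda>\<omega>. (B \<omega> * Z \<omega>) ^ j)"
    and "(\<integral>\<omega>. (B \<omega> * Z \<omega>) ^ j \<partial>N) = 2 / (real (j + 1) * real (j + 2)) * (\<integral>z. z ^ j \<partial>distr N borel Z)"
proof -
  interpret N: prob_space N by fact
  have Z[measurable]: "Z \<in> borel_measurable N" using N.indep_var_rv2[OF indep] .
  have iZ: "integrable N (\<lambda>\<omega>. Z \<omega> ^ j)"
    using int by (simp add: integrable_distr_eq)
  have "N.indep_var borel ((\<lambda>b. b ^ j) \<circ> B) borel ((\<lambda>z. z ^ j) \<circ> Z)"
    by (rule N.indep_var_compose[OF indep]) auto
  then have ind: "N.indep_var borel (\<lambda>\<omega>. B \<omega> ^ j) borel (\<lambda>\<omega>. Z \<omega> ^ j)" by (simp add: comp_def)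
  show "integrable N (\<lambda>\<omega>. (B \<omega> * Z \<omega>) ^ j)"
    unfolding power_mult_distrib by (rule N.indep_var_integrable[OF ind beta_moment(1)[OF B] iZ])
  show "(\<integral>\<omega>. (B \<omega> * Z \<omega>) ^ j \<partial>N) = 2 / (real (j + 1) * real (j + 2)) * (\<integral>z. z ^ j \<partial>distr N borel Z)"
    unfolding power_mult_distrib N.indep_var_lebesgue_integral[OF ind beta_moment(1)[OF B] iZ] beta_moment(2)[OF B]
    by (simp add: integral_distr)
qed

section \<open>One-sided expansion of a moment generating function\<close>

text \<open>The factor \<open>1 + e^y\<close>, in place of \<open>e^|y|\<close>, matters because exponential moments will be available on one
  side only.\<close>

lemma exp_taylor3_le: "\<bar>exp y - (1 + y + y\<^sup>2 / 2 + y ^ 3 / 6)\<bar> \<le> \<bar>y\<bar> ^ 3 * (1 + exp (y :: real))"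
proof -
  have fact3: "(fact 3 :: real) = 6" by (simp add: fact_numeral)
  have s: "(\<Sum>m<3. y ^ m / fact m) = 1 + y + y\<^sup>2 / 2"
    by (simp add: eval_nat_numeral)
  obtain x where x: "exp x \<le> 1 + exp y" "exp y = (\<Sum>m<3. y ^ m / fact m) + exp x / fact 3 * y ^ 3"
  proof (cases "y < 0")
    case True
    obtain x where "y < x" "x < 0" "exp y = (\<Sum>m<3. exp 0 / fact m * y ^ m) + exp x / fact 3 * y ^ 3"
      using Maclaurin_minus[of y 3 "\<lambda>_. exp" exp] True by (auto intro!: DERIV_exp)
    moreover have "exp x \<le> 1 + exp y"
      using \<open>x < 0\<close> by (simp add: add_increasing2)
    ultimately show thesis by (intro that[of x]) (simp_all only: exp_zero times_divide_eq_left mult_1)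
  next
    case False
    obtain x where "\<bar>x\<bar> \<le> \<bar>y\<bar>" "exp y = (\<Sum>m<3. y ^ m / fact m) + exp x / fact 3 * y ^ 3"
      using Maclaurin_exp_le[of y 3] by auto
    moreover have "exp x \<le> 1 + exp y"
      using False \<open>\<bar>x\<bar> \<le> \<bar>y\<bar>\<close> by (intro add_increasing) auto
    ultimately show thesis by (intro that[of x])
  qed
  have eq: "exp y - (1 + y + y\<^sup>2 / 2 + y ^ 3 / 6) = y ^ 3 * ((exp x - 1) / 6)"
    using x(2) unfolding s fact3 by (simp add: field_simps)
  have bound: "\<bar>(exp x - 1) / 6\<bar> \<le> 1 + exp y"
  proof (rule abs_leI)
    show "(exp x - 1) / 6 \<le> 1 + exp y" "- ((exp x - 1) / 6) \<le> 1 + exp y"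
      using x(1) exp_gt_zero[of x] exp_gt_zero[of y] by argo+
  qed
  show ?thesis
    unfolding eq abs_mult power_abs by (rule mult_left_mono[OF bound]) simp
qed

lemma (in prob_space) integrable_exp_mult_le:
  fixes R :: "'a \<Rightarrow> real" and t T :: real
  assumes R[measurable]: "R \<in> borel_measurable M" and int: "integrable M (\<lambda>\<omega>. exp (T * R \<omega>))"
    and t: "0 \<le> t" "t \<le> T"
  shows "integrable M (\<lambda>\<omega>. exp (t * R \<omega>))"
proof (rule Bochner_Integration.integrable_bound)
  show "integrable M (\<lambda>\<omega>. 1 + exp (T * R \<omega>))" using int by simp
  show "AE \<omega> in M. norm (exp (t * R \<omega>)) \<le> norm (1 + exp (T * R \<omega>))"
  proof (rule AE_I2)
    fix \<omega>
    show "norm (exp (t * R \<omega>)) \<le> norm (1 + exp (T * R \<omega>))"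
    proof (cases "0 \<le> R \<omega>")
      case True
      then have "exp (t * R \<omega>) \<le> exp (T * R \<omega>)" using t by (simp add: mult_right_mono)
      then show ?thesis by (simp add: add_increasing)
    next
      case False
      then have "exp (t * R \<omega>) \<le> 1" using t by (simp add: mult_nonneg_nonpos)
      then show ?thesis by (simp add: add_increasing2)
    qed
  qed
qed measurable

text \<open>The remainder divided by \<open>t^3\<close> is dominated, for \<open>t \<le> t0/2\<close>, by \<open>2 |R|^3\<close> where \<open>R < 0\<close>. Where
  \<open>R \<ge> 0\<close> the cube is absorbed by half of the exponential rate, \<open>(t0 R/2)^3 \<le> 3! e^(t0 R/2)\<close>, whence the
  constant \<open>48 = 2^3 3!\<close>.\<close>

lemma (in prob_space) mgf_taylor3:
  fixes R :: "'a \<Rightarrow> real" and t0 :: real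
  assumes R[measurable]: "R \<in> borel_measurable M" and mom: "\<And>j. j \<le> 3 \<Longrightarrow> integrable M (\<lambda>\<omega>. R \<omega> ^ j)"
    and t0: "0 < t0" and int: "integrable M (\<lambda>\<omega>. exp (t0 * R \<omega>))"
  shows "((\<lambda>t. ((\<integral>\<omega>. exp (t * R \<omega>) \<partial>M) - (1 + (\<integral>\<omega>. R \<omega> \<partial>M) * t + (\<integral>\<omega>. (R \<omega>)\<^sup>2 \<partial>M) * t\<^sup>2 / 2
      + (\<integral>\<omega>. R \<omega> ^ 3 \<partial>M) * t ^ 3 / 6)) / t ^ 3) \<longlongrightarrow> 0) (at_right 0)"
    (is "(?L \<longlongrightarrow> 0) _")
proof -
  let ?D = "\<lambda>t \<omega>. (exp (t * R \<omega>) - (1 + t * R \<omega> + (t * R \<omega>)\<^sup>2 / 2 + (t * R \<omega>) ^ 3 / 6)) / t ^ 3"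
  let ?w = "\<lambda>\<omega>. 2 * \<bar>R \<omega> ^ 3\<bar> + 48 / t0 ^ 3 * exp (t0 * R \<omega>)"
  note int_le = integrable_exp_mult_le[OF R int]
  have eq: "?L t = (\<integral>\<omega>. ?D t \<omega> \<partial>M)" if "0 < t" "t < t0" for t
    using int_le[of t] mom[of 1] mom[of 2] mom[of 3] that prob_space
    by (simp add: power_mult_distrib mult.commute)
  have dom: "norm (?D t \<omega>) \<le> ?w \<omega>" if t: "0 < t" "t \<le> t0 / 2" for t \<omega>
  proof -
    have "norm (?D t \<omega>) \<le> \<bar>t * R \<omega>\<bar> ^ 3 * (1 + exp (t * R \<omega>)) / t ^ 3"
      using exp_taylor3_le[of "t * R \<omega>"] t by (simp add: abs_divide divide_right_mono)
    also have "\<dots> = \<bar>R \<omega> ^ 3\<bar> * (1 + exp (t * R \<omega>))"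
      using t by (simp add: abs_mult power_mult_distrib power_abs)
    also have "\<dots> \<le> ?w \<omega>"
    proof (cases "0 \<le> R \<omega>")
      case True
      let ?y = "t0 / 2 * R \<omega>"
      have y: "0 \<le> ?y" using True t0 by simp
      have "?y ^ 3 / fact 3 \<le> exp ?y"
      proof -
        obtain x where x: "exp ?y = (\<Sum>m<4. ?y ^ m / fact m) + exp x / fact 4 * ?y ^ 4"
          using Maclaurin_exp_le[of ?y 4] by blast
        have "(\<Sum>m<4. ?y ^ m / fact m) = 1 + ?y + ?y\<^sup>2 / 2 + ?y ^ 3 / fact 3"
          by (simp add: eval_nat_numeral)
        moreover have "0 \<le> ?y\<^sup>2 / 2" "0 \<le> exp x / fact 4 * ?y ^ 4" by simp_all
        ultimately show ?thesis unfolding x using y by linarith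
      qed
      then have "R \<omega> ^ 3 \<le> 48 / t0 ^ 3 * exp ?y"
        using t0 by (simp add: fact_numeral field_simps power_mult_distrib)
      then have "R \<omega> ^ 3 * exp (t * R \<omega>) \<le> 48 / t0 ^ 3 * exp ?y * exp ?y"
      proof (intro mult_mono)
        have "t * R \<omega> \<le> ?y" using True t by (intro mult_right_mono) auto
        then show "exp (t * R \<omega>) \<le> exp ?y" by simp
      qed (use t0 in auto)
      also have "\<dots> = 48 / t0 ^ 3 * exp (t0 * R \<omega>)"
        by (simp add: exp_add[symmetric] mult.assoc)
      finally have "R \<omega> ^ 3 * exp (t * R \<omega>) \<le> 48 / t0 ^ 3 * exp (t0 * R \<omega>)" .
      moreover have "0 \<le> R \<omega> ^ 3" using True by simp
      ultimately show ?thesis by (simp only: abs_of_nonneg distrib_left)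
    next
      case False
      then have "exp (t * R \<omega>) \<le> 1" using t by (simp add: mult_nonneg_nonpos)
      then have "\<bar>R \<omega> ^ 3\<bar> * (1 + exp (t * R \<omega>)) \<le> \<bar>R \<omega> ^ 3\<bar> * 2"
        by (intro mult_left_mono) auto
      then show ?thesis using t0 by (simp add: add_increasing2)
    qed
    finally show ?thesis .
  qed
  have pw: "((\<lambda>t. ?D t \<omega>) \<longlongrightarrow> 0) (at_right 0)" for \<omega>
  proof (rule Lim_null_comparison)
    let ?c = "exp \<bar>R \<omega>\<bar> / 24 * R \<omega> ^ 4"
    show "\<forall>\<^sub>F t in at_right 0. norm (?D t \<omega>) \<le> t * ?c"
      using eventually_at_right_less[of 0] eventually_at_right_real[OF zero_less_one]
    proof eventually_elim
      case (elim t)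
      obtain x where x: "\<bar>x\<bar> \<le> \<bar>t * R \<omega>\<bar>" "exp (t * R \<omega>) = (\<Sum>m<4. (t * R \<omega>) ^ m / fact m) + exp x / fact 4 * (t * R \<omega>) ^ 4"
        using Maclaurin_exp_le[of "t * R \<omega>" 4] by auto
      have "\<bar>t * R \<omega>\<bar> \<le> 1 * \<bar>R \<omega>\<bar>" unfolding abs_mult using elim by (intro mult_right_mono) auto
      then have "exp x \<le> exp \<bar>R \<omega>\<bar>" using x(1) by simp
      have "(\<Sum>m<4. (t * R \<omega>) ^ m / fact m) = 1 + t * R \<omega> + (t * R \<omega>)\<^sup>2 / 2 + (t * R \<omega>) ^ 3 / 6"
        by (simp add: eval_nat_numeral)
      then have D: "?D t \<omega> = t * (exp x / 24 * R \<omega> ^ 4)"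
        unfolding x(2) using elim by (simp add: fact_numeral power_mult_distrib eval_nat_numeral)
      have "norm (t * (exp x / 24 * R \<omega> ^ 4)) = t * (exp x / 24 * R \<omega> ^ 4)"
        using elim by simp
      also have "\<dots> \<le> t * ?c"
        using elim \<open>exp x \<le> exp \<bar>R \<omega>\<bar>\<close> by (intro mult_left_mono mult_right_mono) auto
      finally show ?case unfolding D .
    qed
    have "((\<lambda>t. t * ?c) \<longlongrightarrow> 0 * ?c) (at_right 0)" by (intro tendsto_intros)
    then show "((\<lambda>t. t * ?c) \<longlongrightarrow> 0) (at_right 0)" by simp
  qed
  have "((\<lambda>t. \<integral>\<omega>. ?D t \<omega> \<partial>M) \<longlongrightarrow> (\<integral>\<omega>. 0 \<partial>M)) (at_right 0)"
    unfolding tendsto_at_iff_sequentially comp_def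
  proof (intro allI impI)
    fix X :: "nat \<Rightarrow> real" assume X: "\<forall>i. X i \<in> {0<..} - {0}" "X \<longlonglongrightarrow> 0"
    from X(2) obtain n0 where n0: "\<And>n. n \<ge> n0 \<Longrightarrow> \<bar>X n\<bar> < t0 / 2"
      using LIMSEQ_D[OF X(2), of "t0 / 2"] t0 by auto
    have Y: "0 < X (n + n0)" "X (n + n0) \<le> t0 / 2" for n
      using n0[of "n + n0"] X(1) by (auto simp: abs_less_iff)
    have "(\<lambda>n. \<integral>\<omega>. ?D (X (n + n0)) \<omega> \<partial>M) \<longlonglongrightarrow> (\<integral>\<omega>. 0 \<partial>M)"
    proof (rule integral_dominated_convergence[where w = ?w])
      show "integrable M ?w"
        using mom[of 3] int by (intro Bochner_Integration.integrable_add integrable_mult_right integrable_abs) auto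
      show "AE \<omega> in M. (\<lambda>n. ?D (X (n + n0)) \<omega>) \<longlonglongrightarrow> 0"
      proof (rule AE_I2)
        fix \<omega>
        have "(\<lambda>n. ?D (X n) \<omega>) \<longlonglongrightarrow> 0"
          using pw[of \<omega>] X unfolding tendsto_at_iff_sequentially comp_def by blast
        then show "(\<lambda>n. ?D (X (n + n0)) \<omega>) \<longlonglongrightarrow> 0" by (rule LIMSEQ_ignore_initial_segment)
      qed
      show "AE \<omega> in M. norm (?D (X (n + n0)) \<omega>) \<le> ?w \<omega>" for n
        by (intro AE_I2 dom Y)
    qed measurable
    then show "(\<lambda>n. \<integral>\<omega>. ?D (X n) \<omega> \<partial>M) \<longlonglongrightarrow> (\<integral>\<omega>. 0 \<partial>M)"
      by (rule LIMSEQ_offset)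
  qed
  then have "((\<lambda>t. \<integral>\<omega>. ?D t \<omega> \<partial>M) \<longlongrightarrow> 0) (at_right 0)" by simp
  then show ?thesis
  proof (rule Lim_transform_eventually)
    show "\<forall>\<^sub>F t in at_right 0. (\<integral>\<omega>. ?D t \<omega> \<partial>M) = ?L t"
      using eventually_at_right_real[OF t0] by eventually_elim (rule eq[symmetric], auto)
  qed
qed

lemma (in prob_space) continuous_on_mgf:
  fixes R :: "'a \<Rightarrow> real" and T :: real
  assumes R[measurable]: "R \<in> borel_measurable M" and int: "integrable M (\<lambda>\<omega>. exp (T * R \<omega>))"
  shows "continuous_on {0..T} (\<lambda>t. \<integral>\<omega>. exp (t * R \<omega>) \<partial>M)"
  unfolding continuous_on_sequentially comp_def
proof (intro allI ballI impI)
  fix X :: "nat \<Rightarrow> real" and t assume t: "t \<in> {0..T}" and X: "(\<forall>n. X n \<in> {0..T}) \<and> X \<longlonglongrightarrow> t"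
  show "(\<lambda>n. \<integral>\<omega>. exp (X n * R \<omega>) \<partial>M) \<longlonglongrightarrow> (\<integral>\<omega>. exp (t * R \<omega>) \<partial>M)"
  proof (rule integral_dominated_convergence[where w = "\<lambda>\<omega>. 1 + exp (T * R \<omega>)"])
    show "AE \<omega> in M. (\<lambda>n. exp (X n * R \<omega>)) \<longlonglongrightarrow> exp (t * R \<omega>)"
      using X by (intro AE_I2 tendsto_intros) auto
    show "AE \<omega> in M. norm (exp (X n * R \<omega>)) \<le> 1 + exp (T * R \<omega>)" for n
    proof (rule AE_I2)
      fix \<omega>
      have "0 \<le> X n" "X n \<le> T" using X by auto
      then have "X n * R \<omega> \<le> 0 \<or> X n * R \<omega> \<le> T * R \<omega>"
        by (cases "0 \<le> R \<omega>") (auto simp: mult_right_mono mult_nonneg_nonpos)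
      then have "exp (X n * R \<omega>) \<le> 1 \<or> exp (X n * R \<omega>) \<le> exp (T * R \<omega>)" by simp
      then show "norm (exp (X n * R \<omega>)) \<le> 1 + exp (T * R \<omega>)" by (auto intro: add_increasing add_increasing2)
    qed
  qed (use int in auto)
qed

section \<open>Maxima under a singular perturbation\<close>

text \<open>The coefficient of \<open>t\<close> in the expansion of \<open>(1 - 1/M(t))/t\<close> is \<open>m2/2 - m1^2\<close>, which vanishes here; the
  coefficient of \<open>t^2\<close> is then \<open>-\<gamma>\<close>.\<close>

lemma psi_expansion:
  fixes m1 m2 m3 \<gamma> :: real
  assumes M: "((\<lambda>t. (M t - (1 + m1 * t + m2 * t\<^sup>2 / 2 + m3 * t ^ 3 / 6)) / t ^ 3) \<longlongrightarrow> 0) (at_right 0)"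
    and \<kappa>: "m1\<^sup>2 - m2 / 2 = 0" and \<gamma>: "\<gamma> = m1 * m2 - m1 ^ 3 - m3 / 6"
  shows "(M \<longlongrightarrow> 1) (at_right 0)"
    and "((\<lambda>t. ((1 - 1 / M t) / t - m1) / t\<^sup>2) \<longlongrightarrow> - \<gamma>) (at_right 0)"
proof -
  define r where "r t = (M t - (1 + m1 * t + m2 * t\<^sup>2 / 2 + m3 * t ^ 3 / 6)) / t ^ 3" for t
  have r: "(r \<longlongrightarrow> 0) (at_right 0)" using M unfolding r_def .
  let ?p = "\<lambda>t. 1 + m1 * t + m2 * t\<^sup>2 / 2 + m3 * t ^ 3 / 6 + t ^ 3 * r t" and ?n = "\<lambda>t. m3 / 6 - m1 * m2 / 2 - m1 * m3 / 6 * t + r t - m1 * t * r t"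
  have Mr: "M t = ?p t" if "0 < t" for t
    using that by (simp add: r_def)
  have "(?p \<longlongrightarrow> 1 + m1 * 0 + m2 * 0\<^sup>2 / 2 + m3 * 0 ^ 3 / 6 + 0 ^ 3 * 0) (at_right 0)"
    by (intro tendsto_intros r) auto
  then have "(?p \<longlongrightarrow> 1) (at_right 0)"
    by simp
  then show lim1: "(M \<longlongrightarrow> 1) (at_right 0)"
  proof (rule Lim_transform_eventually)
    show "\<forall>\<^sub>F t in at_right 0. ?p t = M t"
      using eventually_at_right_less[of 0] by eventually_elim (simp only: Mr)
  qed
  have pos: "\<forall>\<^sub>F t in at_right 0. 0 < M t"
    using order_tendstoD(1)[OF lim1, of 0] by simp
  have "((\<lambda>t. ?n t / M t) \<longlongrightarrow>
      (m3 / 6 - m1 * m2 / 2 - m1 * m3 / 6 * 0 + 0 - m1 * 0 * 0) / 1) (at_right 0)"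
    by (intro tendsto_intros r lim1) auto
  moreover have "(m3 / 6 - m1 * m2 / 2 - m1 * m3 / 6 * 0 + 0 - m1 * 0 * 0) / 1 = - \<gamma>"
  proof -
    have "m1 * (m1\<^sup>2 - m2 / 2) = 0" using \<kappa> by simp
    then have "m1 ^ 3 = m1 * m2 / 2" by (simp add: algebra_simps power3_eq_cube power2_eq_square)
    then show ?thesis by (simp add: \<gamma>)
  qed
  ultimately have "((\<lambda>t. ?n t / M t) \<longlongrightarrow> - \<gamma>) (at_right 0)"
    by simp
  then show "((\<lambda>t. ((1 - 1 / M t) / t - m1) / t\<^sup>2) \<longlongrightarrow> - \<gamma>) (at_right 0)"
  proof (rule Lim_transform_eventually)
    show "\<forall>\<^sub>F t in at_right 0. ?n t / M t = ((1 - 1 / M t) / t - m1) / t\<^sup>2"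
      using pos eventually_at_right_less[of 0]
    proof eventually_elim
      case (elim t)
      have "M t - 1 - m1 * t * M t = (m2 / 2 - m1\<^sup>2) * t\<^sup>2 + t ^ 3 * ?n t"
        unfolding Mr[OF elim(2)] by (simp add: field_simps power2_eq_square power3_eq_cube)
      then have *: "M t - 1 - m1 * t * M t = t ^ 3 * ?n t"
        using \<kappa> by simp
      have "((1 - 1 / M t) / t - m1) / t\<^sup>2 = (M t - 1 - m1 * t * M t) / (t ^ 3 * M t)"
        using elim by (simp add: field_simps power2_eq_square power3_eq_cube)
      then show ?case unfolding * using elim by simp
    qed
  qed
qed

lemma tendsto_cube_root_scale:
  fixes \<gamma> :: real
  assumes "0 < \<gamma>"
  shows "((\<lambda>\<epsilon>. (\<epsilon> / (2 * \<gamma>)) powr (1 / 3)) \<longlongrightarrow> 0) (at_right 0)"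
proof -
  have "((\<lambda>\<epsilon>. (\<epsilon> / (2 * \<gamma>)) powr (1 / 3)) \<longlongrightarrow> (0 / (2 * \<gamma>)) powr (1 / 3)) (at_right 0)"
    using assms by (intro tendsto_intros tendsto_powr2) (auto simp: eventually_at_filter)
  then show ?thesis by simp
qed

text \<open>Near \<open>0\<close> the perturbed function \<open>\<psi> t - \<epsilon> q t/t\<close> lies between \<open>m - (1 + \<eta>) w(t)\<close> and
  \<open>m - (1 - \<eta>) w(t)\<close> with \<open>w(t) = \<gamma> t^2 + \<epsilon>/t\<close>. Writing \<open>t = x s(\<epsilon>)\<close> with \<open>2 \<gamma> s(\<epsilon>)^3 = \<epsilon>\<close> gives
  \<open>w(t) = \<gamma> s(\<epsilon>)^2 (x^2 + 2/x)\<close>, and \<open>x^2 + 2/x = 3 + (x - 1)^2 (1 + 2/x)\<close>. Hence \<open>w\<close> has minimum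
  \<open>W(\<epsilon>) = 3 \<gamma> s(\<epsilon>)^2\<close> at \<open>x = 1\<close>, and a point whose value is almost optimal has \<open>x\<close> close to \<open>1\<close>. Away
  from \<open>0\<close> the gap below \<open>m\<close> eventually exceeds \<open>(1 + \<eta>) W(\<epsilon>)\<close>.\<close>

lemma perturbed_maximum:
  fixes \<psi> q :: "real \<Rightarrow> real" and m \<gamma> \<eta> :: real
  assumes \<gamma>: "0 < \<gamma>" and loc: "((\<lambda>t. (\<psi> t - m) / t\<^sup>2) \<longlongrightarrow> - \<gamma>) (at_right 0)"
    and q1: "(q \<longlongrightarrow> 1) (at_right 0)" and q0: "\<And>t. 0 < t \<Longrightarrow> 0 \<le> q t"
    and gap: "\<forall>\<delta>>0. \<exists>\<eta>>0. \<forall>t\<ge>\<delta>. \<psi> t \<le> m - \<eta>"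
    and \<eta>: "0 < \<eta>" "\<eta> < 1"
  defines "s \<equiv> \<lambda>\<epsilon>. (\<epsilon> / (2 * \<gamma>)) powr (1 / 3)"
  defines "W \<equiv> \<lambda>\<epsilon>. 3 * \<gamma> * (s \<epsilon>)\<^sup>2"
  shows "\<forall>\<^sub>F \<epsilon> in at_right 0.
      (\<forall>t>0. \<psi> t - \<epsilon> * q t / t \<le> m - (1 - \<eta>) * W \<epsilon>) \<and>
      m - (1 + \<eta>) * W \<epsilon> < \<psi> (s \<epsilon>) - \<epsilon> * q (s \<epsilon>) / s \<epsilon> \<and>
      (\<forall>t>0. m - (1 + \<eta>) * W \<epsilon> \<le> \<psi> t - \<epsilon> * q t / t \<longrightarrow> (t / s \<epsilon> - 1)\<^sup>2 \<le> 6 * \<eta> / (1 - \<eta>))"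
proof -
  have "\<forall>\<^sub>F t in at_right 0. - \<gamma> - \<eta> * \<gamma> < (\<psi> t - m) / t\<^sup>2 \<and> (\<psi> t - m) / t\<^sup>2 < - \<gamma> + \<eta> * \<gamma>
      \<and> 1 - \<eta> < q t \<and> q t < 1 + \<eta>"
    using \<gamma> \<eta> by (intro eventually_conj order_tendstoD[OF loc] order_tendstoD[OF q1]) auto
  then obtain \<delta> where \<delta>: "0 < \<delta>"
    and near: "\<And>t. 0 < t \<Longrightarrow> t < \<delta> \<Longrightarrow> - \<gamma> - \<eta> * \<gamma> < (\<psi> t - m) / t\<^sup>2 \<and> (\<psi> t - m) / t\<^sup>2 < - \<gamma> + \<eta> * \<gamma>
      \<and> 1 - \<eta> < q t \<and> q t < 1 + \<eta>"
    unfolding eventually_at_right_field by auto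
  have bounds: "- ((1 + \<eta>) * (\<gamma> * t\<^sup>2 + \<epsilon> / t)) < \<psi> t - m - \<epsilon> * q t / t"
      "\<psi> t - m - \<epsilon> * q t / t \<le> - ((1 - \<eta>) * (\<gamma> * t\<^sup>2 + \<epsilon> / t))"
    if t: "0 < t" "t < \<delta>" and \<epsilon>: "0 < \<epsilon>" for t \<epsilon>
  proof -
    have t2: "0 < t\<^sup>2" using t by simp
    have 1: "(- \<gamma> - \<eta> * \<gamma>) * t\<^sup>2 < \<psi> t - m" "\<psi> t - m < (- \<gamma> + \<eta> * \<gamma>) * t\<^sup>2"
      using near[OF t] t2 by (simp_all add: pos_less_divide_eq pos_divide_less_eq)
    have 2: "(1 - \<eta>) * (\<epsilon> / t) \<le> q t * (\<epsilon> / t)" "q t * (\<epsilon> / t) \<le> (1 + \<eta>) * (\<epsilon> / t)"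
      using near[OF t] t \<epsilon> by (intro mult_right_mono; simp)+
    show "- ((1 + \<eta>) * (\<gamma> * t\<^sup>2 + \<epsilon> / t)) < \<psi> t - m - \<epsilon> * q t / t"
      "\<psi> t - m - \<epsilon> * q t / t \<le> - ((1 - \<eta>) * (\<gamma> * t\<^sup>2 + \<epsilon> / t))"
      using 1 2 by (simp_all add: algebra_simps)
  qed
  obtain \<eta>' where \<eta>': "0 < \<eta>'" and far: "\<And>t. \<delta> \<le> t \<Longrightarrow> \<psi> t \<le> m - \<eta>'"
    using gap \<delta> by blast
  have s_lim: "(s \<longlongrightarrow> 0) (at_right 0)"
    unfolding s_def by (rule tendsto_cube_root_scale) fact
  have W_lim: "((\<lambda>\<epsilon>. (1 + \<eta>) * W \<epsilon>) \<longlongrightarrow> (1 + \<eta>) * (3 * \<gamma> * 0\<^sup>2)) (at_right 0)"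
    unfolding W_def by (intro tendsto_intros s_lim)
  have "\<forall>\<^sub>F \<epsilon> in at_right 0. s \<epsilon> < \<delta>"
    using order_tendstoD(2)[OF s_lim \<delta>] .
  moreover have "\<forall>\<^sub>F \<epsilon> in at_right 0. (1 + \<eta>) * W \<epsilon> < \<eta>'"
    using order_tendstoD(2)[OF W_lim] \<eta>' by simp
  ultimately show ?thesis
    using eventually_at_right_less[of 0]
  proof eventually_elim
    case (elim \<epsilon>)
    have s0: "0 < s \<epsilon>" using elim \<gamma> by (simp add: s_def)
    have s3: "2 * \<gamma> * s \<epsilon> ^ 3 = \<epsilon>"
    proof -
      have "s \<epsilon> ^ 3 = s \<epsilon> powr 3" using s0 by simp
      also have "\<dots> = \<epsilon> / (2 * \<gamma>)" unfolding s_def using elim \<gamma> by (simp add: powr_powr)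
      finally show ?thesis using \<gamma> by simp
    qed
    have W0: "0 < W \<epsilon>" using s0 \<gamma> by (simp add: W_def)
    have profile: "\<gamma> * t\<^sup>2 + \<epsilon> / t = W \<epsilon> + \<gamma> * (s \<epsilon>)\<^sup>2 * ((t / s \<epsilon> - 1)\<^sup>2 * (1 + 2 * s \<epsilon> / t))" if "0 < t" for t
    proof -
      have "\<epsilon> / t = 2 * \<gamma> * s \<epsilon> ^ 3 / t" by (simp add: s3)
      then show ?thesis
        using that s0 by (simp add: W_def field_simps power2_eq_square power3_eq_cube)
    qed
    have profile_ge: "W \<epsilon> + \<gamma> * (s \<epsilon>)\<^sup>2 * (t / s \<epsilon> - 1)\<^sup>2 \<le> \<gamma> * t\<^sup>2 + \<epsilon> / t" if "0 < t" for t
    proof -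
      have "(t / s \<epsilon> - 1)\<^sup>2 * 1 \<le> (t / s \<epsilon> - 1)\<^sup>2 * (1 + 2 * s \<epsilon> / t)"
        using that s0 by (intro mult_left_mono) auto
      then have "\<gamma> * (s \<epsilon>)\<^sup>2 * (t / s \<epsilon> - 1)\<^sup>2 \<le> \<gamma> * (s \<epsilon>)\<^sup>2 * ((t / s \<epsilon> - 1)\<^sup>2 * (1 + 2 * s \<epsilon> / t))"
        using \<gamma> by (intro mult_left_mono) auto
      then show ?thesis unfolding profile[OF that] by simp
    qed
    have profile_ge_W: "W \<epsilon> \<le> \<gamma> * t\<^sup>2 + \<epsilon> / t" if "0 < t" for t
      using profile_ge[OF that] \<gamma> by (smt (verit) mult_nonneg_nonneg zero_le_power2)
    have far': "\<psi> t - \<epsilon> * q t / t < m - (1 + \<eta>) * W \<epsilon>" if "\<delta> \<le> t" for t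
    proof -
      have "0 < t" using \<delta> that by simp
      then have "0 \<le> \<epsilon> * q t / t" using q0[of t] elim by simp
      then show ?thesis using far[OF that] elim by linarith
    qed
    show ?case
    proof (intro conjI allI impI)
      fix t :: real assume t: "0 < t"
      show "\<psi> t - \<epsilon> * q t / t \<le> m - (1 - \<eta>) * W \<epsilon>"
      proof (cases "t < \<delta>")
        case True
        have "(1 - \<eta>) * W \<epsilon> \<le> (1 - \<eta>) * (\<gamma> * t\<^sup>2 + \<epsilon> / t)"
          using \<eta> profile_ge_W[OF t] by (intro mult_left_mono) auto
        then show ?thesis using bounds(2)[OF t True] elim by fastforce
      next
        case False
        have "(1 - \<eta>) * W \<epsilon> \<le> (1 + \<eta>) * W \<epsilon>" using W0 \<eta> by (intro mult_right_mono) auto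
        then show ?thesis using far'[of t] False by linarith
      qed
    next
      have "\<gamma> * (s \<epsilon>)\<^sup>2 + \<epsilon> / s \<epsilon> = W \<epsilon>" using profile[OF s0] s0 by simp
      then show "m - (1 + \<eta>) * W \<epsilon> < \<psi> (s \<epsilon>) - \<epsilon> * q (s \<epsilon>) / s \<epsilon>"
        using bounds(1)[OF s0, of \<epsilon>] elim by simp
    next
      fix t :: real assume t: "0 < t" and ge: "m - (1 + \<eta>) * W \<epsilon> \<le> \<psi> t - \<epsilon> * q t / t"
      have "t < \<delta>" using far'[of t] ge by fastforce
      then have "(1 - \<eta>) * (\<gamma> * t\<^sup>2 + \<epsilon> / t) \<le> (1 + \<eta>) * W \<epsilon>"
        using bounds(2)[OF t, of \<epsilon>] elim ge by fastforce
      moreover have "(1 - \<eta>) * (W \<epsilon> + \<gamma> * (s \<epsilon>)\<^sup>2 * (t / s \<epsilon> - 1)\<^sup>2) \<le> (1 - \<eta>) * (\<gamma> * t\<^sup>2 + \<epsilon> / t)"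
        using \<eta> by (intro mult_left_mono profile_ge t) auto
      ultimately have "(1 - \<eta>) * (W \<epsilon> + \<gamma> * (s \<epsilon>)\<^sup>2 * (t / s \<epsilon> - 1)\<^sup>2) \<le> (1 + \<eta>) * W \<epsilon>"
        by linarith
      then have "(\<gamma> * (s \<epsilon>)\<^sup>2) * ((1 - \<eta>) * (t / s \<epsilon> - 1)\<^sup>2) \<le> (\<gamma> * (s \<epsilon>)\<^sup>2) * (6 * \<eta>)"
        by (simp add: W_def algebra_simps)
      then have "(1 - \<eta>) * (t / s \<epsilon> - 1)\<^sup>2 \<le> 6 * \<eta>"
        using \<gamma> s0 by (subst (asm) mult_le_cancel_left_pos) auto
      then show "(t / s \<epsilon> - 1)\<^sup>2 \<le> 6 * \<eta> / (1 - \<eta>)"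
        using \<eta> by (simp add: pos_le_divide_eq mult.commute)
    qed
  qed
qed

section \<open>Feasibility as a bound on Psi\<close>

text \<open>The Levy-Khintchine formula at a real argument. A finite exponential moment forces a finite integral by
  the lower bound, a finite integral forces a finite moment by the upper bound, and then the two bounds
  agree.\<close>

lemma exp_moment_eq_lk:
  assumes P: "real_distribution P" and \<mu>: "real_distribution \<mu>" and V: "0 < V" and inf: "infinitely_divisible \<mu>"
    and char: "\<And>u. char \<mu> u = exp (lk_exponent P V u)"
    and mean: "integrable \<mu> (\<lambda>x. x)" "(\<integral>x. x \<partial>\<mu>) = 0"
  defines "L \<equiv> \<lambda>t. \<integral>\<^sup>+z. ennreal (2 * exp_rem (t * z)) \<partial>P"
  shows "exp_moment \<mu> t = (if L t = \<infinity> then \<infinity> else ennreal (exp (V * t\<^sup>2 / 2 * enn2real (L t))))"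
proof -
  interpret P: real_distribution P by fact
  interpret \<mu>: real_distribution \<mu> by fact
  have ln0: "0 \<le> ln r" if r: "exp_moment \<mu> t = ennreal r" "0 < r" for r
  proof -
    have int: "integrable \<mu> (\<lambda>x. exp (t * x))"
      using r by (simp add: integrable_iff_bounded)
    have "1 = (\<integral>x. 1 + t * x \<partial>\<mu>)" using mean \<mu>.prob_space by simp
    also have "\<dots> \<le> (\<integral>x. exp (t * x) \<partial>\<mu>)"
      using mean int by (intro integral_mono) (auto simp: exp_ge_add_one_self)
    also have "\<dots> = r" using nn_integral_eq_integral[OF int] r by simp
    finally show ?thesis by simp
  qed
  have lower: "ennreal (t\<^sup>2 / 2) * L t \<le> ennreal (ln r / V)"
    if r: "exp_moment \<mu> t = ennreal r" "0 < r" for r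
  proof -
    have "ennreal (t\<^sup>2 / 2) * L t = (\<integral>\<^sup>+z. ennreal (t\<^sup>2 * exp_rem (t * z)) \<partial>P)"
      unfolding L_def by (subst nn_integral_cmult[symmetric])
        (auto intro!: nn_integral_cong simp: ennreal_mult[symmetric] exp_rem_nonneg)
    also have "\<dots> \<le> ennreal (ln r / V)"
      using r ln0[OF r] by (intro lk_le_exp_moment[OF P V inf char mean]) auto
    finally show ?thesis .
  qed
  have pos: "exp_moment \<mu> t \<noteq> 0"
    by (subst nn_integral_0_iff_AE) auto
  show ?thesis
  proof (cases "L t = \<infinity>")
    case True
    have "exp_moment \<mu> t = \<infinity>"
    proof (rule ccontr)
      assume "exp_moment \<mu> t \<noteq> \<infinity>"
      then obtain r where r: "exp_moment \<mu> t = ennreal r" "0 < r"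
        using pos by (cases "exp_moment \<mu> t") (auto simp: less_le)
      have "t \<noteq> 0"
      proof
        assume "t = 0"
        then have "L t = 1" by (simp add: L_def P.emeasure_space_1[simplified])
        then show False using True by simp
      qed
      then have "ennreal (t\<^sup>2 / 2) * L t = \<infinity>" by (simp add: True ennreal_mult_top)
      then show False using lower[OF r] by (simp add: top_unique)
    qed
    then show ?thesis by (simp add: True)
  next
    case False
    have int: "integrable P (\<lambda>z. exp_rem (t * z))"
    proof -
      have "integrable P (\<lambda>z. 2 * exp_rem (t * z))"
      proof (rule integrableI_bounded)
        have "norm (2 * exp_rem (t * z)) = 2 * exp_rem (t * z)" for z by (simp add: exp_rem_nonneg)
        then have "(\<integral>\<^sup>+z. ennreal (norm (2 * exp_rem (t * z))) \<partial>P) = L t"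
          by (simp only: L_def)
        then show "(\<integral>\<^sup>+z. ennreal (norm (2 * exp_rem (t * z))) \<partial>P) < \<infinity>"
          using False by (simp only: less_top infinity_ennreal_def)
      qed measurable
      then show ?thesis by simp
    qed
    define I where "I = (\<integral>z. exp_rem (t * z) \<partial>P)"
    have I0: "0 \<le> I" unfolding I_def by (intro Bochner_Integration.integral_nonneg exp_rem_nonneg)
    have L: "L t = ennreal (2 * I)"
      unfolding L_def I_def using int by (subst nn_integral_eq_integral) (auto simp: exp_rem_nonneg)
    have upper: "exp_moment \<mu> t \<le> ennreal (exp (V * t\<^sup>2 * I))"
      using P.exp_moment_le_lk[OF \<mu> V char int] by (simp add: I_def mult.assoc)
    then obtain r where r: "exp_moment \<mu> t = ennreal r" "0 < r"
      using pos by (cases "exp_moment \<mu> t") (auto simp: less_le top_unique)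
    have "ennreal (t\<^sup>2 * I) \<le> ennreal (ln r / V)"
      using lower[OF r] I0 by (simp add: L ennreal_mult[symmetric])
    moreover have "0 \<le> ln r / V" using ln0[OF r] V by simp
    ultimately have "t\<^sup>2 * I \<le> ln r / V" by (simp add: ennreal_le_iff)
    then have "V * t\<^sup>2 * I \<le> ln r" using V by (simp add: pos_le_divide_eq mult_ac)
    then have "exp (V * t\<^sup>2 * I) \<le> r" using r by (metis exp_le_cancel_iff exp_ln)
    then have "exp_moment \<mu> t = ennreal (exp (V * t\<^sup>2 * I))"
      using upper r by (intro antisym) (auto intro: ennreal_leI)
    then show ?thesis using I0 by (simp add: L)
  qed
qed

lemma Psi_eq:
  assumes "0 \<le> \<theta>"
  shows "Psi N R \<theta> t = (1 - \<theta> * enn2real (inverse (mgf N R t))) / t"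
  using assms by (simp add: Psi_def divide_ennreal_def enn2real_mult)

text \<open>The level enters only through a multiple of the reciprocal of \<open>t\<close> times the moment generating
  function, the singular perturbation studied above. The inverse in \<open>ennreal\<close> is \<open>0\<close> at arguments where
  the moment generating function is infinite.\<close>

lemma Psi_perturb:
  assumes "0 \<le> \<epsilon>"
  shows "Psi N R (1 + \<epsilon>) t = Psi N R 1 t - \<epsilon> * enn2real (inverse (mgf N R t)) / t"
  using assms by (simp add: Psi_eq algebra_simps add_divide_distrib diff_divide_distrib)

lemma Psi_le_inverse: "0 \<le> \<theta> \<Longrightarrow> 0 < t \<Longrightarrow> Psi N R \<theta> t \<le> 1 / t"
  by (simp add: Psi_eq divide_right_mono)

text \<open>For \<open>c t < 1\<close> the inequality between \<open>K(t)\<close> and its bound is equivalent to \<open>Psi \<le> c\<close> at \<open>t\<close> after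
  clearing denominators. For \<open>c t \<ge> 1\<close> feasibility imposes no condition, and \<open>Psi \<le> 1/t \<le> c\<close>.\<close>

lemma feasible_iff_Psi_le:
  assumes cgf: "\<And>t. cgf M X t = (if mgf N R t = \<infinity> then \<infinity> else ereal (V * t\<^sup>2 / 2 * enn2real (mgf N R t)))"
    and zero: "mgf N R 0 = 1" and pos: "\<And>t. mgf N R t \<noteq> 0" and V: "0 < V" and \<theta>: "0 < \<theta>"
  shows "feasible M X (\<theta> * V) c \<longleftrightarrow> 0 \<le> c \<and> (\<forall>t>0. Psi N R \<theta> t \<le> c)"
proof -
  have pointwise: "((c = 0 \<or> t < 1 / c) \<longrightarrow> cgf M X t \<le> ereal (\<theta> * V * t\<^sup>2 / (2 * (1 - c * t)))) \<longleftrightarrow> Psi N R \<theta> t \<le> c"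
    if c: "0 \<le> c" and t: "0 < t" for t
  proof (cases "c * t < 1")
    case True
    then have dom: "c = 0 \<or> t < 1 / c"
      using c by (cases "c = 0") (auto simp: pos_less_divide_eq mult.commute)
    show ?thesis
    proof (cases "mgf N R t = \<infinity>")
      case inf: True
      have "c < 1 / t" using True t by (simp add: field_simps)
      moreover have "Psi N R \<theta> t = 1 / t" using \<theta> by (simp add: Psi_eq inf)
      ultimately show ?thesis using dom by (simp add: cgf inf)
    next
      case fin: False
      then obtain x where x: "mgf N R t = ennreal x" "0 < x"
        using pos[of t] by (cases "mgf N R t") (auto simp: less_le)
      have "cgf M X t \<le> ereal (\<theta> * V * t\<^sup>2 / (2 * (1 - c * t))) \<longleftrightarrow> (V * t\<^sup>2 / 2) * x \<le> (V * t\<^sup>2 / 2) * (\<theta> / (1 - c * t))"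
        using x by (simp add: cgf mult_ac)
      also have "\<dots> \<longleftrightarrow> x \<le> \<theta> / (1 - c * t)"
        using V t by (subst mult_le_cancel_left_pos) auto
      also have "\<dots> \<longleftrightarrow> (1 - \<theta> / x) / t \<le> c"
        using True t x by (simp add: field_simps)
      also have "(1 - \<theta> / x) / t = Psi N R \<theta> t"
        using \<theta> x by (simp add: Psi_eq inverse_ennreal divide_inverse)
      finally show ?thesis using dom by simp
    qed
  next
    case False
    then have "c \<noteq> 0" by auto
    then have "\<not> (c = 0 \<or> t < 1 / c)" using False c by (auto simp: field_simps)
    moreover have "1 / t \<le> c" using False t by (simp add: field_simps)
    then have "Psi N R \<theta> t \<le> c" using Psi_le_inverse[of \<theta> t N R] \<theta> t by linarith
    ultimately show ?thesis by simp
  qed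
  have "cgf M X 0 = 0" by (simp add: cgf zero zero_ereal_def)
  then have at_0: "cgf M X 0 \<le> ereal (\<theta> * V * 0\<^sup>2 / (2 * (1 - c * 0)))" by (simp add: zero_ereal_def)
  have \<theta>V: "0 < \<theta> * V" using \<theta> V by simp
  show ?thesis
  proof (intro iffI conjI allI impI)
    assume f: "feasible M X (\<theta> * V) c"
    then show c: "0 \<le> c" by (simp add: feasible_def)
    fix t :: real assume t: "0 < t"
    then show "Psi N R \<theta> t \<le> c"
      using f unfolding pointwise[OF c t, symmetric] feasible_def by auto
  next
    assume *: "0 \<le> c \<and> (\<forall>t>0. Psi N R \<theta> t \<le> c)"
    show "feasible M X (\<theta> * V) c"
      unfolding feasible_def
    proof (intro conjI allI impI \<theta>V)
      show "0 \<le> c" using * by simp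
      fix t :: real assume t: "0 \<le> t" and dom: "c = 0 \<or> t < 1 / c"
      show "cgf M X t \<le> ereal (\<theta> * V * t\<^sup>2 / (2 * (1 - c * t)))"
      proof (cases "t = 0")
        case True
        then show ?thesis using at_0 by simp
      next
        case False
        then have "0 < t" using t by simp
        then show ?thesis using pointwise[of t] * dom by blast
      qed
    qed
  qed
qed

text \<open>A decrease of order \<open>\<epsilon>^(2/3)\<close> is infinitely steep compared with \<open>\<epsilon> V = v - V\<close>.\<close>

lemma tendsto_MInfty_quotient:
  fixes C :: "real \<Rightarrow> ereal" and V K m :: real
  assumes V: "0 < V" and K: "0 < K"
    and le: "\<forall>\<^sub>F \<epsilon> in at_right 0. C ((1 + \<epsilon>) * V) \<le> ereal (m - K * \<epsilon> powr (2 / 3))" and C: "C V = ereal m"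
  shows "((\<lambda>v. (C v - C V) / ereal (v - V)) \<longlongrightarrow> -\<infinity>) (at_right V)"
  unfolding tendsto_MInfty
proof
  fix r :: real
  have "((\<lambda>\<epsilon> :: real. \<epsilon> powr (1 / 3)) \<longlongrightarrow> 0 powr (1 / 3)) (at_right 0)"
    by (intro tendsto_powr2 tendsto_intros) (auto simp: eventually_at_filter)
  then have "\<forall>\<^sub>F \<epsilon> in at_right 0. \<epsilon> powr (1 / 3) < K / (V * (\<bar>r\<bar> + 1))"
    using V K by (intro order_tendstoD(2)) auto
  with le obtain b where b: "0 < b" and near: "\<And>\<epsilon>. 0 < \<epsilon> \<Longrightarrow> \<epsilon> < b \<Longrightarrow> C ((1 + \<epsilon>) * V) \<le> ereal (m - K * \<epsilon> powr (2 / 3))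
      \<and> \<epsilon> powr (1 / 3) < K / (V * (\<bar>r\<bar> + 1))"
    using eventually_conj unfolding eventually_at_right_field by (smt (verit, ccfv_SIG))
  have "\<forall>\<^sub>F v in at_right V. v \<in> {V<..<V + b * V}"
    using b V by (intro eventually_at_right_real) auto
  then show "\<forall>\<^sub>F v in at_right V. (C v - C V) / ereal (v - V) < ereal r"
  proof eventually_elim
    case (elim v)
    define \<epsilon> where "\<epsilon> = (v - V) / V"
    have \<epsilon>: "0 < \<epsilon>" "\<epsilon> < b" using elim V by (auto simp: \<epsilon>_def field_simps)
    have v: "v = (1 + \<epsilon>) * V" "v - V = \<epsilon> * V" using V by (auto simp: \<epsilon>_def field_simps)
    have e3: "\<epsilon> = \<epsilon> powr (1 / 3) * \<epsilon> powr (2 / 3)" using \<epsilon> by (simp add: powr_add[symmetric])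
    have "\<epsilon> powr (1 / 3) * (V * (\<bar>r\<bar> + 1)) < K"
      using near[OF \<epsilon>] V by (simp add: pos_less_divide_eq)
    then have "(\<epsilon> powr (1 / 3) * (V * (\<bar>r\<bar> + 1))) * \<epsilon> powr (2 / 3) < K * \<epsilon> powr (2 / 3)"
      using \<epsilon> by (intro mult_strict_right_mono) auto
    then have key: "\<epsilon> * V * (\<bar>r\<bar> + 1) < K * \<epsilon> powr (2 / 3)"
      by (subst e3) (simp add: mult_ac)
    have "\<epsilon> * V * - r \<le> \<epsilon> * V * (\<bar>r\<bar> + 1)"
      using \<epsilon> V by (intro mult_left_mono) auto
    with key have "- (K * \<epsilon> powr (2 / 3)) < r * (\<epsilon> * V)" by (simp add: mult_ac)
    then have "- (K * \<epsilon> powr (2 / 3)) / (\<epsilon> * V) < r"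
      using \<epsilon> V by (subst pos_divide_less_eq) auto
    moreover have "C v - C V \<le> ereal (- (K * \<epsilon> powr (2 / 3)))"
    proof -
      have "C v - C V \<le> ereal (m - K * \<epsilon> powr (2 / 3)) - ereal m"
        unfolding C v(1) using near[OF \<epsilon>] by (intro ereal_minus_mono) auto
      then show ?thesis by simp
    qed
    then have "(C v - C V) / ereal (v - V) \<le> ereal (- (K * \<epsilon> powr (2 / 3))) / ereal (v - V)"
      using \<epsilon> V v by (intro ereal_divide_right_mono) auto
    then have "(C v - C V) / ereal (v - V) \<le> ereal (- (K * \<epsilon> powr (2 / 3)) / (\<epsilon> * V))"
      using \<epsilon> V v by simp
    ultimately show ?case by (meson ereal_less_eq(3) less_ereal.simps(1) order_le_less_trans)
  qed
qed

lemma c_star_bounds: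
  assumes feas: "\<And>c. feasible M X v c \<longleftrightarrow> 0 \<le> c \<and> (\<forall>t>0. G t \<le> c)"
    and hi: "0 \<le> hi" "\<And>t. 0 < t \<Longrightarrow> G t \<le> hi"
    and lo: "\<And>c. (\<And>t. 0 < t \<Longrightarrow> G t \<le> c) \<Longrightarrow> lo \<le> c"
  shows "\<exists>x. c_star M X v = ereal x \<and> lo \<le> x \<and> x \<le> hi"
proof -
  have "c_star M X v \<le> ereal hi"
    unfolding c_star_def using hi by (intro Inf_lower) (auto simp: feas)
  moreover have "ereal lo \<le> c_star M X v"
    unfolding c_star_def by (intro Inf_greatest) (auto simp: feas intro!: lo)
  ultimately show ?thesis by (cases "c_star M X v") auto
qed

section \<open>The critical case\<close>

theorem theorem5p2:
  fixes M :: "'a measure" and X :: "'a \<Rightarrow> real"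
    and N :: "'b measure" and B Z R :: "'b \<Rightarrow> real"
    and \<nu> :: "real measure"
    and a b V \<kappa>\<^sub>3 \<kappa>\<^sub>4 \<kappa>\<^sub>5 m\<^sub>1 m\<^sub>2 m\<^sub>3 \<kappa> \<gamma> :: real
  assumes "prob_space M" and "X \<in> borel_measurable M"
    and "integrable M X" and "prob_space.expectation M X = 0"
    and "integrable M (\<lambda>\<omega>. (X \<omega>)\<^sup>2)" and "V = prob_space.variance M X" and "0 < V"
    and "infinitely_divisible (distr M borel X)"
    and "has_levy_triplet (distr M borel X) b a \<nu>"
    and "(\<integral>\<^sup>+x\<in>{x. 1 < \<bar>x\<bar>}. ennreal (\<bar>x\<bar> ^ 5) \<partial>\<nu>) < \<infinity>"
    and "\<kappa>\<^sub>3 = cumulant M X 3" and "\<kappa>\<^sub>4 = cumulant M X 4" and "\<kappa>\<^sub>5 = cumulant M X 5"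
    and "beta_size_bias N B Z a \<nu> V" and "R = (\<lambda>\<omega>. B \<omega> * Z \<omega>)"
    and "m\<^sub>1 = prob_space.expectation N R"
    and "m\<^sub>2 = prob_space.expectation N (\<lambda>\<omega>. (R \<omega>)\<^sup>2)"
    and "m\<^sub>3 = prob_space.expectation N (\<lambda>\<omega>. (R \<omega>) ^ 3)"
    and "\<kappa> = m\<^sub>1\<^sup>2 - m\<^sub>2 / 2" and "\<gamma> = m\<^sub>1 * m\<^sub>2 - m\<^sub>1 ^ 3 - m\<^sub>3 / 6"
    and "0 < tau M X" and "0 < m\<^sub>1"
    and "\<And>t. 0 < t \<Longrightarrow> Psi N R 1 t < m\<^sub>1"
    and "tau M X < \<infinity> \<Longrightarrow> 1 / tau M X < ereal m\<^sub>1"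
    and "\<kappa> = 0" and "0 < \<gamma>"
  shows "(m\<^sub>1 = \<kappa>\<^sub>3 / (3 * V) \<and> m\<^sub>2 = \<kappa>\<^sub>4 / (6 * V) \<and> m\<^sub>3 = \<kappa>\<^sub>5 / (10 * V) \<and>
       \<kappa> = \<kappa>\<^sub>3\<^sup>2 / (9 * V\<^sup>2) - \<kappa>\<^sub>4 / (12 * V) \<and>
       \<gamma> = \<kappa>\<^sub>3 * \<kappa>\<^sub>4 / (18 * V\<^sup>2) - \<kappa>\<^sub>3 ^ 3 / (27 * V ^ 3) - \<kappa>\<^sub>5 / (60 * V)) \<and>
    ((\<forall>\<^sub>F \<epsilon> in at_right 0. \<bar>c_star M X ((1 + \<epsilon>) * V)\<bar> \<noteq> \<infinity>) \<and>
      (\<lambda>\<epsilon>. real_of_ereal (c_star M X ((1 + \<epsilon>) * V)) - (m\<^sub>1 - 3 * (\<gamma> * \<epsilon>\<^sup>2 / 4) powr (1 / 3)))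
        \<in> o[at_right 0](\<lambda>\<epsilon>. \<epsilon> powr (2 / 3))) \<and>
    (\<forall>\<delta>>0. \<forall>\<^sub>F \<epsilon> in at_right 0. \<forall>t. is_arg_max (Psi N R (1 + \<epsilon>)) (\<lambda>s. 0 < s) t \<longrightarrow>
      \<bar>t / (\<epsilon> / (2 * \<gamma>)) powr (1 / 3) - 1\<bar> < \<delta>) \<and>
    (\<bar>c_star M X V\<bar> \<noteq> \<infinity> \<and>
      ((\<lambda>v. (c_star M X v - c_star M X V) / ereal (v - V)) \<longlongrightarrow> -\<infinity>) (at_right V))"
proof -
  interpret M: prob_space M by fact
  note [measurable] = \<open>X \<in> borel_measurable M\<close>
  have N: "prob_space N" and B: "distributed N lborel B beta_density"
    and Z[measurable]: "Z \<in> borel_measurable N" and law_Z: "distr N borel Z = scale_measure (ennreal (1 / V)) (H_meas a \<nu>)"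
    and indep: "prob_space.indep_var N borel B borel Z"
    using \<open>beta_size_bias N B Z a \<nu> V\<close> unfolding beta_size_bias_def by auto
  interpret N: prob_space N by (rule N)
  define P where "P = distr N borel Z"
  have P: "real_distribution P"
    unfolding P_def real_distribution_def real_distribution_axioms_def by (auto intro: N.prob_space_distr)
  interpret P: real_distribution P by (rule P)
  define \<mu> where "\<mu> = distr M borel X"
  have \<mu>: "real_distribution \<mu>"
    unfolding \<mu>_def real_distribution_def real_distribution_axioms_def by (auto intro: M.prob_space_distr)
  have a: "0 \<le> a" and \<nu>: "sets \<nu> = sets borel"
    using \<open>has_levy_triplet (distr M borel X) b a \<nu>\<close> unfolding has_levy_triplet_def levy_measure_def by auto
  note size_bias = P \<nu> a \<open>0 < V\<close> law_Z[folded P_def]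

  have mean: "integrable \<mu> (\<lambda>x. x)" "(\<integral>x. x \<partial>\<mu>) = 0"
    using \<open>integrable M X\<close> \<open>M.expectation X = 0\<close> by (simp_all add: \<mu>_def integrable_distr_eq integral_distr)
  obtain c where "\<And>u. char \<mu> u = exp (\<i> * complex_of_real (c * u) + lk_exponent P V u)"
    using char_levy_triplet[OF size_bias] \<open>has_levy_triplet (distr M borel X) b a \<nu>\<close> unfolding \<mu>_def by blast
  with P.lk_drift_eq_0[OF \<mu> this mean] have char: "char \<mu> u = exp (lk_exponent P V u)" for u by simp

  have momZ: "integrable P (\<lambda>z. z ^ j)" if "j \<le> 3" for j
    by (rule integrable_moments_size_bias[OF size_bias _ that]) fact
  have momR: "integrable N (\<lambda>\<omega>. R \<omega> ^ j)"
    "(\<integral>\<omega>. R \<omega> ^ j \<partial>N) = 2 / (real (j + 1) * real (j + 2)) * (\<integral>z. z ^ j \<partial>P)" if "j \<le> 3" for j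
    using beta_product_moment[OF N B indep momZ[OF that, unfolded P_def]] by (simp_all add: \<open>R = _\<close> P_def)
  have cumul: "cumulant M X (j + 2) = V * (\<integral>z. z ^ j \<partial>P)" if "j \<le> 3" for j
    by (rule P.cumulant_eq_moment[OF char[unfolded \<mu>_def] momZ]) (use that in simp)
  have m: "m\<^sub>1 = \<kappa>\<^sub>3 / (3 * V)" "m\<^sub>2 = \<kappa>\<^sub>4 / (6 * V)" "m\<^sub>3 = \<kappa>\<^sub>5 / (10 * V)"
    using cumul[of 1] cumul[of 2] cumul[of 3] momR(2)[of 1] momR(2)[of 2] momR(2)[of 3] \<open>0 < V\<close>
    by (simp_all add: \<open>m\<^sub>1 = N.expectation R\<close> \<open>m\<^sub>2 = N.expectation (\<lambda>\<omega>. (R \<omega>)\<^sup>2)\<close> \<open>m\<^sub>3 = N.expectation (\<lambda>\<omega>. (R \<omega>) ^ 3)\<close>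
        \<open>\<kappa>\<^sub>3 = cumulant M X 3\<close> \<open>\<kappa>\<^sub>4 = cumulant M X 4\<close> \<open>\<kappa>\<^sub>5 = cumulant M X 5\<close> numeral_eq_Suc)
  have moments: "m\<^sub>1 = \<kappa>\<^sub>3 / (3 * V) \<and> m\<^sub>2 = \<kappa>\<^sub>4 / (6 * V) \<and> m\<^sub>3 = \<kappa>\<^sub>5 / (10 * V) \<and>
       \<kappa> = \<kappa>\<^sub>3\<^sup>2 / (9 * V\<^sup>2) - \<kappa>\<^sub>4 / (12 * V) \<and>
       \<gamma> = \<kappa>\<^sub>3 * \<kappa>\<^sub>4 / (18 * V\<^sup>2) - \<kappa>\<^sub>3 ^ 3 / (27 * V ^ 3) - \<kappa>\<^sub>5 / (60 * V)"
  proof (intro conjI m)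
    show "\<kappa> = \<kappa>\<^sub>3\<^sup>2 / (9 * V\<^sup>2) - \<kappa>\<^sub>4 / (12 * V)"
      unfolding \<open>\<kappa> = m\<^sub>1\<^sup>2 - m\<^sub>2 / 2\<close> m by (simp add: power_divide power_mult_distrib)
    show "\<gamma> = \<kappa>\<^sub>3 * \<kappa>\<^sub>4 / (18 * V\<^sup>2) - \<kappa>\<^sub>3 ^ 3 / (27 * V ^ 3) - \<kappa>\<^sub>5 / (60 * V)"
      unfolding \<open>\<gamma> = m\<^sub>1 * m\<^sub>2 - m\<^sub>1 ^ 3 - m\<^sub>3 / 6\<close> m by (simp add: power_divide power_mult_distrib power2_eq_square)
  qed

  have B_meas[measurable]: "B \<in> borel_measurable N" by (rule N.indep_var_rv1[OF indep])
  have R[measurable]: "R \<in> borel_measurable N" unfolding \<open>R = _\<close> by measurable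
  have mgfR: "mgf N R t = (\<integral>\<^sup>+z. ennreal (2 * exp_rem (t * z)) \<partial>P)" for t
    unfolding \<open>R = _\<close> P_def by (rule mgf_beta_product[OF N B indep])
  have mgfR_pos: "mgf N R t \<noteq> 0" for t
    unfolding mgf_def by (subst nn_integral_0_iff_AE) auto
  have mgfR_0: "mgf N R 0 = 1" unfolding mgf_def by (simp add: N.emeasure_space_1)
  have mgfX: "mgf M X t = (if mgf N R t = \<infinity> then \<infinity> else ennreal (exp (V * t\<^sup>2 / 2 * enn2real (mgf N R t))))" for t
  proof -
    have "mgf M X t = (\<integral>\<^sup>+x. ennreal (exp (t * x)) \<partial>\<mu>)"
      unfolding mgf_def \<mu>_def by (subst nn_integral_distr) auto
    also have "\<dots> = (if mgf N R t = \<infinity> then \<infinity> else ennreal (exp (V * t\<^sup>2 / 2 * enn2real (mgf N R t))))"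
      unfolding mgfR
      by (rule exp_moment_eq_lk[OF P \<mu> \<open>0 < V\<close> _ char mean]) (unfold \<mu>_def, fact)
    finally show ?thesis .
  qed
  have cgf: "cgf M X t = (if mgf N R t = \<infinity> then \<infinity> else ereal (V * t\<^sup>2 / 2 * enn2real (mgf N R t)))" for t
    by (simp add: cgf_def mgfX)
  have feas: "feasible M X (\<theta> * V) c \<longleftrightarrow> 0 \<le> c \<and> (\<forall>t>0. Psi N R \<theta> t \<le> c)" if "0 < \<theta>" for \<theta> c
    by (rule feasible_iff_Psi_le[OF cgf mgfR_0 mgfR_pos \<open>0 < V\<close> that])

  \<comment> \<open>A point of finiteness beyond \<open>1/m\<^sub>1\<close>: to its right the bound \<open>Psi \<le> 1/t\<close> already separates \<open>Psi\<close> from \<open>m\<^sub>1\<close>.\<close>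
  obtain T where T: "1 / m\<^sub>1 < T" and fin: "mgf N R T \<noteq> \<infinity>"
  proof -
    have "ereal (1 / m\<^sub>1) < tau M X"
    proof (cases "tau M X")
      case (real s)
      with \<open>0 < tau M X\<close> \<open>tau M X < \<infinity> \<Longrightarrow> 1 / tau M X < ereal m\<^sub>1\<close> \<open>0 < m\<^sub>1\<close> show ?thesis
        by (auto simp: one_ereal_def field_simps split: if_splits)
    qed (use \<open>0 < tau M X\<close> in auto)
    then obtain x where "x \<in> insert 0 {ereal t | t. 0 < t \<and> cgf M X t < \<infinity>}" "ereal (1 / m\<^sub>1) < x"
      unfolding tau_def less_Sup_iff by blast
    moreover have "0 < 1 / m\<^sub>1" using \<open>0 < m\<^sub>1\<close> by simp
    ultimately obtain t where "1 / m\<^sub>1 < t" "cgf M X t < \<infinity>"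
      by (auto simp: zero_ereal_def)
    then show thesis by (intro that[of t]) (auto simp: cgf split: if_splits)
  qed
  have T0: "0 < T" using T \<open>0 < m\<^sub>1\<close> by (meson less_trans zero_less_divide_1_iff)
  have intT: "integrable N (\<lambda>\<omega>. exp (T * R \<omega>))"
    using fin by (auto simp: integrable_iff_bounded mgf_def less_top)
  define E where "E t = (\<integral>\<omega>. exp (t * R \<omega>) \<partial>N)" for t
  define q where "q t = enn2real (inverse (mgf N R t))" for t
  have mgf_E: "mgf N R t = ennreal (E t)" and E_pos: "0 < E t" and q_E: "q t = 1 / E t" if "0 \<le> t" "t \<le> T" for t
  proof -
    show *: "mgf N R t = ennreal (E t)"
      unfolding mgf_def E_def
      by (rule nn_integral_eq_integral[OF N.integrable_exp_mult_le[OF R intT that]]) simp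
    show "0 < E t" using mgfR_pos[of t] unfolding * by (simp add: less_le ennreal_eq_0_iff not_le)
    then show "q t = 1 / E t" by (simp add: q_def * inverse_ennreal divide_inverse)
  qed
  have Psi_E: "Psi N R 1 t = (1 - 1 / E t) / t" if "0 \<le> t" "t \<le> T" for t
    using q_E[OF that] by (simp add: Psi_eq q_def)
  have near_0: "\<forall>\<^sub>F t in at_right 0. 0 < t \<and> t < T"
    using eventually_at_right_real[OF T0] by eventually_elim auto

  have taylor: "((\<lambda>t. (E t - (1 + m\<^sub>1 * t + m\<^sub>2 * t\<^sup>2 / 2 + m\<^sub>3 * t ^ 3 / 6)) / t ^ 3) \<longlongrightarrow> 0) (at_right 0)"
    unfolding E_def \<open>m\<^sub>1 = N.expectation R\<close> \<open>m\<^sub>2 = N.expectation (\<lambda>\<omega>. (R \<omega>)\<^sup>2)\<close> \<open>m\<^sub>3 = N.expectation (\<lambda>\<omega>. (R \<omega>) ^ 3)\<close>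
    by (rule N.mgf_taylor3[OF R momR(1) T0 intT])
  have "m\<^sub>1\<^sup>2 - m\<^sub>2 / 2 = 0" using \<open>\<kappa> = m\<^sub>1\<^sup>2 - m\<^sub>2 / 2\<close> \<open>\<kappa> = 0\<close> by simp
  note expansion = psi_expansion[OF taylor this \<open>\<gamma> = m\<^sub>1 * m\<^sub>2 - m\<^sub>1 ^ 3 - m\<^sub>3 / 6\<close>]
  have loc: "((\<lambda>t. (Psi N R 1 t - m\<^sub>1) / t\<^sup>2) \<longlongrightarrow> - \<gamma>) (at_right 0)"
    by (rule Lim_transform_eventually[OF expansion(2)])
      (use near_0 in eventually_elim, simp add: Psi_E)
  have q_lim: "(q \<longlongrightarrow> 1) (at_right 0)"
  proof (rule Lim_transform_eventually)
    show "((\<lambda>t. 1 / E t) \<longlongrightarrow> 1) (at_right 0)"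
      using tendsto_divide[OF tendsto_const[of 1] expansion(1)] by simp
    show "\<forall>\<^sub>F t in at_right 0. 1 / E t = q t"
      using near_0 by eventually_elim (simp add: q_E)
  qed
  have gap: "\<forall>\<delta>>0. \<exists>\<eta>>0. \<forall>t\<ge>\<delta>. Psi N R 1 t \<le> m\<^sub>1 - \<eta>"
  proof (intro allI impI)
    fix \<delta> :: real assume \<delta>: "0 < \<delta>"
    have far: "0 < m\<^sub>1 - 1 / T" using T T0 \<open>0 < m\<^sub>1\<close> by (simp add: field_simps)
    have beyond: "Psi N R 1 t \<le> 1 / T" if "T \<le> t" for t
      using Psi_le_inverse[of 1 t N R] T0 that frac_le[of 1 1 T t] by auto
    have "continuous_on {\<delta>..T} (\<lambda>t. (1 - 1 / E t) / t)"
    proof -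
      have "continuous_on {\<delta>..T} E"
        unfolding E_def using \<delta>
        by (intro continuous_on_subset[OF N.continuous_on_mgf[OF R intT]]) auto
      moreover have "E t \<noteq> 0" "t \<noteq> 0" if "t \<in> {\<delta>..T}" for t
        using E_pos[of t] that \<delta> by auto
      ultimately show ?thesis by (intro continuous_intros) auto
    qed
    then have cont: "continuous_on {\<delta>..T} (Psi N R 1)"
      by (rule continuous_on_cong[THEN iffD1, rotated 2]) (use Psi_E \<delta> in auto)
    show "\<exists>\<eta>>0. \<forall>t\<ge>\<delta>. Psi N R 1 t \<le> m\<^sub>1 - \<eta>"
    proof (cases "\<delta> \<le> T")
      case True
      then obtain s where s: "s \<in> {\<delta>..T}" "\<And>t. t \<in> {\<delta>..T} \<Longrightarrow> Psi N R 1 t \<le> Psi N R 1 s"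
        using continuous_attains_sup[OF compact_Icc _ cont] by auto
      have "Psi N R 1 s < m\<^sub>1" using s \<delta> by (intro \<open>\<And>t. 0 < t \<Longrightarrow> Psi N R 1 t < m\<^sub>1\<close>) auto
      show ?thesis
      proof (intro exI[of _ "min (m\<^sub>1 - Psi N R 1 s) (m\<^sub>1 - 1 / T)"] conjI allI impI)
        show "0 < min (m\<^sub>1 - Psi N R 1 s) (m\<^sub>1 - 1 / T)" using \<open>Psi N R 1 s < m\<^sub>1\<close> far by simp
        fix t assume "\<delta> \<le> t"
        then have "Psi N R 1 t \<le> Psi N R 1 s \<or> Psi N R 1 t \<le> 1 / T"
          using s(2)[of t] beyond[of t] by fastforce
        then show "Psi N R 1 t \<le> m\<^sub>1 - min (m\<^sub>1 - Psi N R 1 s) (m\<^sub>1 - 1 / T)"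
          by linarith
      qed
    next
      case False
      then show ?thesis using far beyond by (intro exI[of _ "m\<^sub>1 - 1 / T"]) auto
    qed
  qed
  have q0: "0 \<le> q t" for t by (simp add: q_def)

  \<comment> \<open>The maximiser \<open>s\<close> and the decrease \<open>W\<close> of the supremum, to leading order.\<close>
  define s where "s \<epsilon> = (\<epsilon> / (2 * \<gamma>)) powr (1 / 3)" for \<epsilon>
  define W where "W \<epsilon> = 3 * \<gamma> * (s \<epsilon>)\<^sup>2" for \<epsilon>
  define G where "G \<epsilon> t = Psi N R (1 + \<epsilon>) t" for \<epsilon> t
  have core: "\<forall>\<^sub>F \<epsilon> in at_right 0. 0 < \<epsilon> \<and>
      (\<forall>t>0. G \<epsilon> t \<le> m\<^sub>1 - (1 - \<eta>) * W \<epsilon>) \<and> m\<^sub>1 - (1 + \<eta>) * W \<epsilon> < G \<epsilon> (s \<epsilon>) \<and>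
      (\<forall>t>0. m\<^sub>1 - (1 + \<eta>) * W \<epsilon> \<le> G \<epsilon> t \<longrightarrow> (t / s \<epsilon> - 1)\<^sup>2 \<le> 6 * \<eta> / (1 - \<eta>))"
    if "0 < \<eta>" "\<eta> < 1" for \<eta>
    using perturbed_maximum[OF \<open>0 < \<gamma>\<close> loc q_lim q0 gap that, folded s_def, folded W_def] eventually_at_right_less[of 0]
    by eventually_elim (simp add: G_def Psi_perturb q_def)

  have W_eq: "W \<epsilon> = 3 * (\<gamma> * \<epsilon>\<^sup>2 / 4) powr (1 / 3)" "W \<epsilon> = 3 * (\<gamma> / 4) powr (1 / 3) * \<epsilon> powr (2 / 3)" if "0 < \<epsilon>" for \<epsilon>
  proof -
    have e2: "(\<epsilon>\<^sup>2) powr (1 / 3) = \<epsilon> powr (2 / 3)"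
      using that by (simp add: powr_powr flip: powr_numeral)
    have g: "\<gamma> = (\<gamma> ^ 3) powr (1 / 3)"
      using \<open>0 < \<gamma>\<close> by (simp add: powr_powr flip: powr_numeral)
    have "(s \<epsilon>)\<^sup>2 = ((\<epsilon> / (2 * \<gamma>))\<^sup>2) powr (1 / 3)"
      unfolding s_def using that \<open>0 < \<gamma>\<close> by (simp add: powr_powr flip: powr_numeral)
    then have "\<gamma> * (s \<epsilon>)\<^sup>2 = (\<gamma> ^ 3 * (\<epsilon> / (2 * \<gamma>))\<^sup>2) powr (1 / 3)"
      using that \<open>0 < \<gamma>\<close> g by (simp add: powr_mult)
    also have "\<gamma> ^ 3 * (\<epsilon> / (2 * \<gamma>))\<^sup>2 = \<gamma> * \<epsilon>\<^sup>2 / 4"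
      using \<open>0 < \<gamma>\<close> by (simp add: field_simps power2_eq_square power3_eq_cube)
    finally show eq: "W \<epsilon> = 3 * (\<gamma> * \<epsilon>\<^sup>2 / 4) powr (1 / 3)" by (simp add: W_def)
    have "(\<gamma> * \<epsilon>\<^sup>2 / 4) powr (1 / 3) = (\<gamma> / 4 * \<epsilon>\<^sup>2) powr (1 / 3)" by simp
    also have "\<dots> = (\<gamma> / 4) powr (1 / 3) * \<epsilon> powr (2 / 3)"
      using that \<open>0 < \<gamma>\<close> by (subst powr_mult) (auto simp: e2)
    finally show "W \<epsilon> = 3 * (\<gamma> / 4) powr (1 / 3) * \<epsilon> powr (2 / 3)"
      unfolding eq by simp
  qed
  have s_lim: "(s \<longlongrightarrow> 0) (at_right 0)"
    unfolding s_def by (rule tendsto_cube_root_scale) fact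
  have "(W \<longlongrightarrow> 3 * \<gamma> * 0\<^sup>2) (at_right 0)"
    unfolding W_def by (intro tendsto_intros s_lim)
  then have W_small: "\<forall>\<^sub>F \<epsilon> in at_right 0. W \<epsilon> < m\<^sub>1"
    using \<open>0 < m\<^sub>1\<close> by (intro order_tendstoD(2)) auto
  have c_star: "\<forall>\<^sub>F \<epsilon> in at_right 0. 0 < \<epsilon> \<and> (\<exists>x. c_star M X ((1 + \<epsilon>) * V) = ereal x \<and>
      m\<^sub>1 - (1 + \<eta>) * W \<epsilon> \<le> x \<and> x \<le> m\<^sub>1 - (1 - \<eta>) * W \<epsilon>)" if \<eta>: "0 < \<eta>" "\<eta> < 1" for \<eta>
    using core[OF \<eta>] W_small
  proof eventually_elim
    case (elim \<epsilon>)
    have s: "0 < s \<epsilon>" using elim \<open>0 < \<gamma>\<close> by (simp add: s_def)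
    have "0 \<le> W \<epsilon>" using \<open>0 < \<gamma>\<close> by (simp add: W_def)
    then have "(1 - \<eta>) * W \<epsilon> \<le> W \<epsilon>" using \<eta> by (simp add: mult_left_le_one_le)
    then have "0 \<le> m\<^sub>1 - (1 - \<eta>) * W \<epsilon>" using elim by linarith
    moreover have "feasible M X ((1 + \<epsilon>) * V) c \<longleftrightarrow> 0 \<le> c \<and> (\<forall>t>0. G \<epsilon> t \<le> c)" for c
      unfolding G_def using elim by (intro feas) simp
    ultimately have "\<exists>x. c_star M X ((1 + \<epsilon>) * V) = ereal x \<and>
      m\<^sub>1 - (1 + \<eta>) * W \<epsilon> \<le> x \<and> x \<le> m\<^sub>1 - (1 - \<eta>) * W \<epsilon>"
    proof (intro c_star_bounds[where G = "G \<epsilon>"])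
      show "m\<^sub>1 - (1 + \<eta>) * W \<epsilon> \<le> c" if "\<And>t. 0 < t \<Longrightarrow> G \<epsilon> t \<le> c" for c
        using that[OF s] elim by linarith
    qed (use elim in auto)
    then show ?case using elim by simp
  qed

  have finite: "\<forall>\<^sub>F \<epsilon> in at_right 0. \<bar>c_star M X ((1 + \<epsilon>) * V)\<bar> \<noteq> \<infinity>"
    using c_star[of "1 / 2", simplified] by eventually_elim auto
  have asymp: "(\<lambda>\<epsilon>. real_of_ereal (c_star M X ((1 + \<epsilon>) * V)) - (m\<^sub>1 - 3 * (\<gamma> * \<epsilon>\<^sup>2 / 4) powr (1 / 3)))
        \<in> o[at_right 0](\<lambda>\<epsilon>. \<epsilon> powr (2 / 3))"
  proof (rule landau_o.smallI)
    fix c :: real assume c: "0 < c"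
    define K where "K = 3 * (\<gamma> / 4) powr (1 / 3)"
    have K: "0 < K" using \<open>0 < \<gamma>\<close> by (simp add: K_def)
    \<comment> \<open>The relative error \<open>\<eta>\<close> is chosen so that \<open>\<eta> W(\<epsilon>) \<le> c \<epsilon>^(2/3)\<close>.\<close>
    define \<eta> where "\<eta> = min (1 / 2) (c / K)"
    have \<eta>: "0 < \<eta>" "\<eta> < 1" "\<eta> * K \<le> c"
      using c K by (auto simp: \<eta>_def min_def field_simps)
    show "\<forall>\<^sub>F \<epsilon> in at_right 0. norm (real_of_ereal (c_star M X ((1 + \<epsilon>) * V)) - (m\<^sub>1 - 3 * (\<gamma> * \<epsilon>\<^sup>2 / 4) powr (1 / 3)))
        \<le> c * norm (\<epsilon> powr (2 / 3))"
      using c_star[OF \<eta>(1,2)]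
    proof eventually_elim
      case (elim \<epsilon>)
      then obtain x where x: "c_star M X ((1 + \<epsilon>) * V) = ereal x"
        "m\<^sub>1 - (1 + \<eta>) * W \<epsilon> \<le> x" "x \<le> m\<^sub>1 - (1 - \<eta>) * W \<epsilon>" by blast
      have "\<bar>x - (m\<^sub>1 - W \<epsilon>)\<bar> \<le> \<eta> * W \<epsilon>"
        unfolding abs_le_iff using x by (simp add: algebra_simps)
      also have "\<dots> = (\<eta> * K) * \<epsilon> powr (2 / 3)"
        using W_eq(2) elim by (simp add: K_def)
      also have "\<dots> \<le> c * \<epsilon> powr (2 / 3)"
        using \<eta> by (intro mult_right_mono) auto
      finally show ?case
        using x(1) W_eq(1) elim by simp
    qed
  qed

  have maximiser: "\<forall>\<delta>>0. \<forall>\<^sub>F \<epsilon> in at_right 0. \<forall>t. is_arg_max (Psi N R (1 + \<epsilon>)) (\<lambda>s. 0 < s) t \<longrightarrow>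
      \<bar>t / (\<epsilon> / (2 * \<gamma>)) powr (1 / 3) - 1\<bar> < \<delta>"
  proof (intro allI impI)
    fix \<delta> :: real assume \<delta>: "0 < \<delta>"
    \<comment> \<open>For \<open>\<eta> \<le> 1/2\<close> the bound \<open>6 \<eta>/(1 - \<eta>)\<close> is at most \<open>12 \<eta>\<close>, which this choice keeps below \<open>\<delta>^2\<close>.\<close>
    define \<eta> where "\<eta> = min (1 / 2) (\<delta>\<^sup>2 / 24)"
    have \<eta>: "0 < \<eta>" "\<eta> < 1" "\<eta> \<le> 1 / 2" "\<eta> \<le> \<delta>\<^sup>2 / 24" using \<delta> by (auto simp: \<eta>_def)
    have "6 * \<eta> / (1 - \<eta>) \<le> 12 * \<eta>" using \<eta> by (simp add: field_simps)
    also have "\<dots> \<le> \<delta>\<^sup>2 / 2" using \<eta>(4) by simp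
    also have "\<dots> < \<delta>\<^sup>2" using \<delta> by simp
    finally have small: "6 * \<eta> / (1 - \<eta>) < \<delta>\<^sup>2" .
    show "\<forall>\<^sub>F \<epsilon> in at_right 0. \<forall>t. is_arg_max (Psi N R (1 + \<epsilon>)) (\<lambda>s. 0 < s) t \<longrightarrow>
      \<bar>t / (\<epsilon> / (2 * \<gamma>)) powr (1 / 3) - 1\<bar> < \<delta>"
      using core[OF \<eta>(1,2)]
    proof eventually_elim
      case (elim \<epsilon>)
      show ?case
      proof (intro allI impI)
        fix t assume t: "is_arg_max (Psi N R (1 + \<epsilon>)) (\<lambda>s. 0 < s) t"
        have "0 < s \<epsilon>" using elim \<open>0 < \<gamma>\<close> by (simp add: s_def)
        then have "0 < t" "G \<epsilon> (s \<epsilon>) \<le> G \<epsilon> t"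
          using t by (auto simp: is_arg_max_linorder G_def)
        moreover have "m\<^sub>1 - (1 + \<eta>) * W \<epsilon> < G \<epsilon> (s \<epsilon>)" using elim by blast
        ultimately have "(t / s \<epsilon> - 1)\<^sup>2 \<le> 6 * \<eta> / (1 - \<eta>)" using elim by force
        then have "\<bar>t / s \<epsilon> - 1\<bar>\<^sup>2 < \<delta>\<^sup>2" using small by simp
        then have "\<bar>t / s \<epsilon> - 1\<bar> < \<delta>" using \<delta> by (rule power2_less_imp_less[OF _ less_imp_le])
        then show "\<bar>t / (\<epsilon> / (2 * \<gamma>)) powr (1 / 3) - 1\<bar> < \<delta>" by (simp add: s_def)
      qed
    qed
  qed

  have at_V: "c_star M X V = ereal m\<^sub>1"
  proof -
    have "((\<lambda>t. (Psi N R 1 t - m\<^sub>1) / t\<^sup>2 * t\<^sup>2 + m\<^sub>1) \<longlongrightarrow> - \<gamma> * 0\<^sup>2 + m\<^sub>1) (at_right 0)"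
      by (intro tendsto_intros loc)
    then have "((\<lambda>t. (Psi N R 1 t - m\<^sub>1) / t\<^sup>2 * t\<^sup>2 + m\<^sub>1) \<longlongrightarrow> m\<^sub>1) (at_right 0)" by simp
    then have lim: "(Psi N R 1 \<longlongrightarrow> m\<^sub>1) (at_right 0)"
    proof (rule Lim_transform_eventually)
      show "\<forall>\<^sub>F t in at_right 0. (Psi N R 1 t - m\<^sub>1) / t\<^sup>2 * t\<^sup>2 + m\<^sub>1 = Psi N R 1 t"
        using near_0 by eventually_elim simp
    qed
    have "\<exists>x. c_star M X V = ereal x \<and> m\<^sub>1 \<le> x \<and> x \<le> m\<^sub>1"
    proof (rule c_star_bounds[where G = "Psi N R 1"])
      show "feasible M X V c \<longleftrightarrow> 0 \<le> c \<and> (\<forall>t>0. Psi N R 1 t \<le> c)" for c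
        using feas[of 1 c] by simp
      show "m\<^sub>1 \<le> c" if "\<And>t. 0 < t \<Longrightarrow> Psi N R 1 t \<le> c" for c
      proof (rule tendsto_upperbound[OF lim])
        show "\<forall>\<^sub>F t in at_right 0. Psi N R 1 t \<le> c"
          using near_0 by eventually_elim (simp add: that)
      qed simp
      show "Psi N R 1 t \<le> m\<^sub>1" if "0 < t" for t
        using \<open>\<And>t. 0 < t \<Longrightarrow> Psi N R 1 t < m\<^sub>1\<close>[OF that] by simp
    qed (use \<open>0 < m\<^sub>1\<close> in simp)
    then show ?thesis by (metis order_antisym)
  qed
  have slope: "((\<lambda>v. (c_star M X v - c_star M X V) / ereal (v - V)) \<longlongrightarrow> -\<infinity>) (at_right V)"
  proof (rule tendsto_MInfty_quotient[where C = "c_star M X", OF \<open>0 < V\<close> _ _ at_V])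
    \<comment> \<open>The factor \<open>1/2\<close> is \<open>1 - \<eta>\<close> for \<open>\<eta> = 1/2\<close>; any fixed \<open>\<eta>\<close> suffices for an infinite slope.\<close>
    let ?K = "1 / 2 * (3 * (\<gamma> / 4) powr (1 / 3))"
    show "0 < ?K" using \<open>0 < \<gamma>\<close> by simp
    show "\<forall>\<^sub>F \<epsilon> in at_right 0. c_star M X ((1 + \<epsilon>) * V) \<le> ereal (m\<^sub>1 - ?K * \<epsilon> powr (2 / 3))"
      using c_star[of "1 / 2", simplified] by eventually_elim (auto simp: W_eq(2))
  qed
  have at_V_finite: "\<bar>c_star M X V\<bar> \<noteq> \<infinity>" using at_V by simp
  show ?thesis
    by (rule conjI[OF moments conjI[OF conjI[OF finite asymp] conjI[OF maximiser conjI[OF at_V_finite slope]]]])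
qed

end
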